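(* Let $p\ge 4$. Let $({\mathbb R}^2,g,f)$ be Hamilton's cigar soliton, and let $\tilde g=e^{-\frac{2f}{2-p}}g=(1+x^2+y^2)^{\frac{p}{2-p}}(dx^2+dy^2)$. Then there does not exist any nonconstant positive $p$-harmonic function on $({\mathbb R}^2,\tilde g)$.
   Context: Hamilton's cigar soliton is ${\mathbb R}^2$ with the complete metric $g=\frac{dx^2+dy^2}{1+x^2+y^2}$ and potential function $f(x,y)=-\log(1+x^2+y^2)$; it is a steady gradient Ricci soliton, i.e. $\mathrm{Ric}+\nabla\nabla f=0$. On a Riemannian manifold, for a constant $p>1$, a function $v\in W^{1,p}_{loc}\cap L^\infty_{loc}$ is $p$-harmonic if it is a weak solution of $\mathrm{div}(|\nabla v|^{p-2}\nabla v)=0$. Such functions are known to be $C^{1,\alpha}$. *)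

theory Defs
  imports "HOL-Analysis.Analysis"
begin

definition partial_deriv :: "'n::finite \<Rightarrow> (real^'n \<Rightarrow> real) \<Rightarrow> real^'n \<Rightarrow> real" where
  "partial_deriv i f x = frechet_derivative f (at x) (axis i 1)"

definition differential :: "(real^'n::finite \<Rightarrow> real) \<Rightarrow> real^'n \<Rightarrow> real^'n" where
  "differential f x = (\<chi> i. partial_deriv i f x)"

fun Ck :: "nat \<Rightarrow> (real^'n::finite \<Rightarrow> real) \<Rightarrow> bool" where
  "Ck 0 f \<longleftrightarrow> continuous_on UNIV f"
| "Ck (Suc k) f \<longleftrightarrow> f differentiable_on UNIV \<and> (\<forall>i. Ck k (partial_deriv i f))"

definition test_function :: "(real^'n::finite \<Rightarrow> real) \<Rightarrow> bool" where
  "test_function \<psi> \<longleftrightarrow> (\<forall>k. Ck k \<psi>) \<and> compact (closure {x. \<psi> x \<noteq> 0})"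

text \<open>Functions and covector fields represent their classes modulo Lebesgue null sets.
  The weak differential does not involve a metric.  Local integrability is required of both
  sides, so that neither Bochner integral takes its default value.\<close>

definition weak_differential ::
  "(real^'n::finite \<Rightarrow> real) \<Rightarrow> (real^'n \<Rightarrow> real^'n) \<Rightarrow> bool" where
  "weak_differential v D \<longleftrightarrow>
     (\<forall>K. compact K \<longrightarrow> set_integrable lebesgue K v \<and> set_integrable lebesgue K D) \<and>
     (\<forall>\<psi> i. test_function \<psi> \<longrightarrow>
        (\<integral>x. v x * partial_deriv i \<psi> x \<partial>lebesgue) = - (\<integral>x. D x $ i * \<psi> x \<partial>lebesgue))"

text \<open>A metric on coordinate space is given by its matrix \<open>g\<^sub>i\<^sub>j\<close> at each point.\<close>

type_synonym 'n metric_field = "real^'n \<Rightarrow> real^'n^'n"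

definition g_inner :: "'n::finite metric_field \<Rightarrow> real^'n \<Rightarrow> real^'n \<Rightarrow> real^'n \<Rightarrow> real" where
  "g_inner g x a b = a \<bullet> (g x *v b)"

definition g_norm :: "'n::finite metric_field \<Rightarrow> real^'n \<Rightarrow> real^'n \<Rightarrow> real" where
  "g_norm g x a = sqrt (g_inner g x a a)"

definition g_volume :: "'n::finite metric_field \<Rightarrow> (real^'n) measure" where
  "g_volume g = density lebesgue (\<lambda>x. ennreal (sqrt (det (g x))))"

text \<open>The gradient is the vector field with components \<open>g\<^sup>i\<^sup>j D\<^sub>j\<close> for a (weak) differential \<open>D\<close>.\<close>

definition g_grad :: "'n::finite metric_field \<Rightarrow> (real^'n \<Rightarrow> real^'n) \<Rightarrow> real^'n \<Rightarrow> real^'n" where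
  "g_grad g D x = matrix_inv (g x) *v D x"

text \<open>The function \<open>v\<close> is of class \<open>W\<^sup>1\<^sup>,\<^sup>p\<close>-loc for the metric \<open>g\<close>, with weak differential \<open>D\<close>
  (which is unique up to null sets).\<close>

definition W1p_loc ::
  "real \<Rightarrow> 'n::finite metric_field \<Rightarrow> (real^'n \<Rightarrow> real) \<Rightarrow> (real^'n \<Rightarrow> real^'n) \<Rightarrow> bool" where
  "W1p_loc p g v D \<longleftrightarrow>
     weak_differential v D \<and>
     (\<forall>K. compact K \<longrightarrow>
        set_integrable (g_volume g) K (\<lambda>x. \<bar>v x\<bar> powr p) \<and>
        set_integrable (g_volume g) K (\<lambda>x. g_norm g x (g_grad g D x) powr p))"

definition Linf_loc :: "'n::finite metric_field \<Rightarrow> (real^'n \<Rightarrow> real) \<Rightarrow> bool" where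
  "Linf_loc g v \<longleftrightarrow>
     v \<in> borel_measurable lebesgue \<and>
     (\<forall>K. compact K \<longrightarrow> (\<exists>C. AE x in g_volume g. x \<in> K \<longrightarrow> \<bar>v x\<bar> \<le> C))"

definition p_harmonic :: "real \<Rightarrow> 'n::finite metric_field \<Rightarrow> (real^'n \<Rightarrow> real) \<Rightarrow> bool" where
  "p_harmonic p g v \<longleftrightarrow>
     Linf_loc g v \<and>
     (\<exists>D. W1p_loc p g v D \<and>
        (\<forall>\<psi>. test_function \<psi> \<longrightarrow>
           (\<integral>x. g_norm g x (g_grad g D x) powr (p - 2) *
                g_inner g x (g_grad g D x) (g_grad g (differential \<psi>) x) \<partial>g_volume g) = 0))"

text \<open>Positivity and constancy refer to the class of \<open>v\<close>.  For the continuous representative,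
  constancy almost everywhere is constancy.\<close>

definition positive_ae :: "'n::finite metric_field \<Rightarrow> (real^'n \<Rightarrow> real) \<Rightarrow> bool" where
  "positive_ae g v \<longleftrightarrow> (AE x in g_volume g. 0 < v x)"

definition constant_ae :: "'n::finite metric_field \<Rightarrow> (real^'n \<Rightarrow> real) \<Rightarrow> bool" where
  "constant_ae g v \<longleftrightarrow> (\<exists>c. AE x in g_volume g. v x = c)"

definition cigar_metric :: "2 metric_field" where
  "cigar_metric z = mat (1 / (1 + (z$1)\<^sup>2 + (z$2)\<^sup>2))"

definition cigar_potential :: "real^2 \<Rightarrow> real" where
  "cigar_potential z = - ln (1 + (z$1)\<^sup>2 + (z$2)\<^sup>2)"

definition conformal_metric ::
  "real \<Rightarrow> 'n::finite metric_field \<Rightarrow> (real^'n \<Rightarrow> real) \<Rightarrow> 'n metric_field" where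
  "conformal_metric p g f z = exp (- (2 * f z) / (2 - p)) *\<^sub>R g z"

lemma conformal_cigar_metric:
  assumes "p \<noteq> 2"
  shows "conformal_metric p cigar_metric cigar_potential z =
           mat ((1 + (z$1)\<^sup>2 + (z$2)\<^sup>2) powr (p / (2 - p)))"
proof -
  let ?w = "1 + (z$1)\<^sup>2 + (z$2)\<^sup>2"
  have w: "?w > 0"
    by (smt (verit) zero_le_power2)
  have "p / (2 - p) = 2 / (2 - p) - 1"
    using assms by (simp add: field_simps)
  then have "?w powr (p / (2 - p)) = ?w powr (2 / (2 - p)) / ?w"
    using w by (simp add: powr_diff)
  also have "\<dots> = exp (2 * ln ?w / (2 - p)) / ?w"
    using w by (simp add: powr_def)
  finally show ?thesis
    by (simp add: conformal_metric_def cigar_metric_def cigar_potential_def mat_def vec_eq_iff)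
qed

end

(* In coordinates v solves div(A |dv|^(p-2) dv) = 0 on the plane with the weight A = (1 + |x|^2)^(p/2).
   Testing with a cutoff times (v - L + \<delta>)^(1-p) bounds the p-energy of log (v - L + \<delta>) on the annulus of
   radius R by a multiple of R^(2-p), because A is comparable to R^p there.  Since p exceeds the dimension,
   Morrey's estimate turns this scale-invariant bound into a Harnack inequality on annuli whose constant
   depends neither on R nor on the lower bound L of v.
   By the comparison principle the infimum of v over the annulus of radius R is the infimum over the disc, so it
   tends to m = inf v; by Harnack the supremum over the annulus tends to m as well, and the comparison principle
   carries this bound back to the disc.  All test functions are made admissible by mollifying v. *)

theory Submission
  imports Defs
begin

section \<open>Smooth functions\<close>

text \<open>The solution is a class with a weak differential, so functions of \<open>v\<close> are
  not at once admissible in the weak equation. Mollifications of \<open>v\<close> keep its lower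
  bound, can therefore be composed with powers and logarithms, and have gradients converging in the
  p-norm; this supplies the chain rule. Scaling explains why R disappears. A cutoff at scale R
  contributes R^(-p), the weight at most a multiple of R^p, the area R^2, so the weighted energy of
  the logarithm is O(R^2). Dividing by the weight on the annulus gives R^(2-p), exactly what
  Morrey's estimate at length R absorbs. Near the origin the weight is of order 1 and this division
  is lost; hence Harnack is confined to annuli and the comparison principle must carry the
  information into the disc. Morrey's estimate is derived from Young's inequality in place of
  Hoelder's. The price is p > n + 1 rather than p > n, that is p > 3 in the plane, which p \<ge> 4
  supplies.\<close>

definition smooth :: "(real^'n::finite \<Rightarrow> real) \<Rightarrow> bool" where
  "smooth f \<longleftrightarrow> (\<forall>k. Ck k f)"

lemma partial_deriv_eq:
  assumes "(f has_derivative f') (at x)"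
  shows "partial_deriv i f x = f' (axis i 1)"
  using assms by (simp add: partial_deriv_def frechet_derivative_at[symmetric])

lemma differential_eq:
  assumes "(f has_derivative (\<lambda>h. a \<bullet> h)) (at x)"
  shows "differential f x = a"
  using assms by (simp add: differential_def partial_deriv_eq vec_eq_iff inner_axis)

lemma has_derivative_differential:
  assumes "f differentiable (at x)"
  shows "(f has_derivative (\<lambda>h. differential f x \<bullet> h)) (at x)"
proof -
  let ?f' = "frechet_derivative f (at x)"
  have D: "(f has_derivative ?f') (at x)"
    using assms frechet_derivative_works by blast
  then have "linear ?f'" by (rule has_derivative_linear)
  have "?f' h = differential f x \<bullet> h" for h
  proof -
    have "?f' h = ?f' (\<Sum>i\<in>UNIV. (h$i) *\<^sub>R axis i 1)"
      by (simp add: basis_expansion flip: scalar_mult_eq_scaleR)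
    also have "\<dots> = (\<Sum>i\<in>UNIV. h$i * ?f' (axis i 1))"
      using \<open>linear ?f'\<close> by (simp add: linear_sum linear_cmul)
    also have "\<dots> = differential f x \<bullet> h"
      by (simp add: inner_vec_def differential_def partial_deriv_def mult.commute)
    finally show ?thesis .
  qed
  then have "?f' = (\<lambda>h. differential f x \<bullet> h)" by blast
  with D show ?thesis by simp
qed

lemma Ck_Suc_differentiable: "Ck (Suc k) f \<Longrightarrow> f differentiable (at x)"
  by (simp add: differentiable_on_def)

text \<open>The definition of \<open>Ck\<close> speaks of \<open>frechet_derivative\<close>. Here an
  explicit gradient field \<open>d\<close> replaces it, the form in which sums, products and
  compositions yield to induction on k.\<close>

lemma Ck_SucI:
  assumes "\<And>x. (f has_derivative (\<lambda>h. d x \<bullet> h)) (at x)" "\<And>i. Ck k (\<lambda>x. d x $ i)"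
  shows "Ck (Suc k) f"
proof -
  have "partial_deriv i f = (\<lambda>x. d x $ i)" for i
    by (rule ext) (subst partial_deriv_eq[OF assms(1)], simp add: inner_axis)
  then show ?thesis
    using assms by (auto simp: differentiable_on_def differentiable_def)
qed

lemma Ck_partial: "Ck (Suc k) f \<Longrightarrow> Ck k (\<lambda>x. differential f x $ i)"
  by (simp add: differential_def)

lemma Ck_continuous: "Ck k f \<Longrightarrow> continuous_on UNIV f"
  by (cases k) (auto intro: differentiable_imp_continuous_on)

lemma Ck_Suc: "Ck (Suc k) f \<Longrightarrow> Ck k f"
proof (induction k arbitrary: f)
  case 0
  then show ?case using Ck_continuous by fastforce
next
  case (Suc k)
  then show ?case by (metis Ck.simps(2))
qed

lemma Ck_const [simp]: "Ck k (\<lambda>x. c)"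
proof (induction k arbitrary: c)
  case (Suc k)
  show ?case by (rule Ck_SucI[of _ "\<lambda>_. 0"]) (auto intro: Suc)
qed auto

lemma Ck_component [simp]: "Ck k (\<lambda>x. x $ i)"
proof (cases k)
  case (Suc j)
  have "((\<lambda>x. x $ i) has_derivative (\<lambda>h. axis i 1 \<bullet> h)) (at x)" for x :: "real^'a"
    by (simp add: inner_axis' bounded_linear_imp_has_derivative bounded_linear_vec_nth)
  then show ?thesis unfolding Suc by (rule Ck_SucI) simp
qed (auto intro: continuous_intros)

lemma Ck_add: "Ck k f \<Longrightarrow> Ck k g \<Longrightarrow> Ck k (\<lambda>x. f x + g x)"
proof (induction k arbitrary: f g)
  case (Suc k)
  show ?case
  proof (rule Ck_SucI)
    show "((\<lambda>x. f x + g x) has_derivative (\<lambda>h. (differential f x + differential g x) \<bullet> h)) (at x)" for x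
      using Suc.prems by (auto intro!: derivative_eq_intros has_derivative_differential
          Ck_Suc_differentiable simp: inner_add_left)
    show "Ck k (\<lambda>x. (differential f x + differential g x) $ i)" for i
      using Suc.IH[OF Ck_partial[OF Suc.prems(1)] Ck_partial[OF Suc.prems(2)]] by simp
  qed
qed (auto intro: continuous_intros)

lemma has_derivative_mult_differential:
  assumes "f differentiable (at x)" "g differentiable (at x)"
  shows "((\<lambda>x. f x * g x) has_derivative
    (\<lambda>h. (f x *\<^sub>R differential g x + g x *\<^sub>R differential f x) \<bullet> h)) (at x)"
  using assms by (auto intro!: derivative_eq_intros has_derivative_differential
      simp: inner_add_left)

lemma Ck_mult: "Ck k f \<Longrightarrow> Ck k g \<Longrightarrow> Ck k (\<lambda>x. f x * g x)"
proof (induction k arbitrary: f g)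
  case (Suc k)
  show ?case
  proof (rule Ck_SucI)
    show "((\<lambda>x. f x * g x) has_derivative
        (\<lambda>h. (f x *\<^sub>R differential g x + g x *\<^sub>R differential f x) \<bullet> h)) (at x)" for x
      using Suc.prems by (intro has_derivative_mult_differential Ck_Suc_differentiable)
    show "Ck k (\<lambda>x. (f x *\<^sub>R differential g x + g x *\<^sub>R differential f x) $ i)" for i
      using Ck_add[OF Suc.IH[OF Ck_Suc[OF Suc.prems(1)] Ck_partial[OF Suc.prems(2)]]
          Suc.IH[OF Ck_Suc[OF Suc.prems(2)] Ck_partial[OF Suc.prems(1)]]] by simp
  qed
qed (auto intro: continuous_intros)

lemma Ck_affine:
  fixes f :: "real^'n::finite \<Rightarrow> real"
  shows "Ck k f \<Longrightarrow> Ck k (\<lambda>x. f (a + c *\<^sub>R x))"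
proof (induction k arbitrary: f)
  case 0
  then show ?case
    by (auto intro!: continuous_on_compose2[of UNIV f] continuous_intros)
next
  case (Suc k)
  show ?case
  proof (rule Ck_SucI)
    show "((\<lambda>x. f (a + c *\<^sub>R x)) has_derivative
        (\<lambda>h. (c *\<^sub>R differential f (a + c *\<^sub>R x)) \<bullet> h)) (at x)" for x
    proof -
      have "((\<lambda>x. a + c *\<^sub>R x) has_derivative (\<lambda>h. c *\<^sub>R h)) (at x)"
        by (auto intro!: derivative_eq_intros)
      moreover have "(f has_derivative (\<lambda>h. differential f (a + c *\<^sub>R x) \<bullet> h)) (at (a + c *\<^sub>R x))"
        using Suc.prems by (intro has_derivative_differential Ck_Suc_differentiable)
      ultimately show ?thesis
        using has_derivative_compose by fastforce
    qed
    show "Ck k (\<lambda>x. (c *\<^sub>R differential f (a + c *\<^sub>R x)) $ i)" for i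
      using Ck_mult[OF Ck_const Suc.IH[OF Ck_partial[OF Suc.prems]]] by simp
  qed
qed

section \<open>Smooth outer functions of one variable\<close>

fun Dk :: "nat \<Rightarrow> real set \<Rightarrow> (real \<Rightarrow> real) \<Rightarrow> bool" where
  "Dk 0 S h \<longleftrightarrow> continuous_on S h"
| "Dk (Suc k) S h \<longleftrightarrow> (\<exists>h'. (\<forall>t\<in>S. (h has_real_derivative h' t) (at t)) \<and> Dk k S h')"

text \<open>By induction, since the gradient is h'(u) du and the class is closed under products. The
  set \<open>S\<close> is carried along because powers and the logarithm are smooth only on the
  positive half-line. Derivatives in \<open>Dk\<close> are two-sided at every point of
  \<open>S\<close>, so \<open>S\<close> may be closed, such as \<open>{L..}\<close>.\<close>

lemma Ck_compose:
  assumes "\<And>x. u x \<in> S"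
  shows "Dk k S h \<Longrightarrow> Ck k u \<Longrightarrow> Ck k (\<lambda>x. h (u x))"
proof (induction k arbitrary: h)
  case 0
  then show ?case using assms by (auto intro: continuous_on_compose2[of S h])
next
  case (Suc k)
  then obtain h' where h': "\<And>t. t \<in> S \<Longrightarrow> (h has_real_derivative h' t) (at t)" "Dk k S h'"
    by auto
  show ?case
  proof (rule Ck_SucI)
    show "((\<lambda>x. h (u x)) has_derivative (\<lambda>y. (h' (u x) *\<^sub>R differential u x) \<bullet> y)) (at x)" for x
      using has_derivative_compose[OF has_derivative_differential[OF Ck_Suc_differentiable[OF Suc.prems(2)]]
          h'(1)[OF assms, unfolded has_field_derivative_def]] by simp
    show "Ck k (\<lambda>x. (h' (u x) *\<^sub>R differential u x) $ i)" for i
      using Ck_mult[OF Suc.IH[OF h'(2) Ck_Suc[OF Suc.prems(2)]] Ck_partial[OF Suc.prems(2)]]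
      by simp
  qed
qed

lemma Dk_add: "Dk k S g \<Longrightarrow> Dk k S h \<Longrightarrow> Dk k S (\<lambda>t. g t + h t)"
proof (induction k arbitrary: g h)
  case (Suc k)
  then obtain g' h' where
    "\<forall>t\<in>S. (g has_real_derivative g' t) (at t)" "Dk k S g'"
    "\<forall>t\<in>S. (h has_real_derivative h' t) (at t)" "Dk k S h'" by auto
  then show ?case
    using Suc.IH by (auto intro!: exI[of _ "\<lambda>t. g' t + h' t"] derivative_intros)
qed (auto intro: continuous_intros)

lemma Dk_cmult: "Dk k S h \<Longrightarrow> Dk k S (\<lambda>t. c * h t)"
proof (induction k arbitrary: h)
  case (Suc k)
  then obtain h' where
    "\<And>t. t\<in>S \<Longrightarrow> (h has_real_derivative h' t) (at t)" "Dk k S h'" by auto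
  then show ?case
    using Suc.IH by (auto intro!: exI[of _ "\<lambda>t. c * h' t"] DERIV_cmult)
qed (auto intro: continuous_intros)

lemma Dk_affine: "Dk k T h \<Longrightarrow> (\<And>t. t \<in> S \<Longrightarrow> a + c * t \<in> T) \<Longrightarrow> Dk k S (\<lambda>t. h (a + c * t))"
proof (induction k arbitrary: h)
  case 0
  then show ?case by (auto intro!: continuous_on_compose2[of T h] continuous_intros)
next
  case (Suc k)
  then obtain h' where h': "\<And>t. t\<in>T \<Longrightarrow> (h has_real_derivative h' t) (at t)" "Dk k T h'" by auto
  have "((\<lambda>t. h (a + c * t)) has_real_derivative c * h' (a + c * t)) (at t)" if "t \<in> S" for t
  proof -
    have "((\<lambda>t. a + c * t) has_real_derivative c) (at t)"
      by (auto intro!: derivative_eq_intros)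
    from DERIV_chain2[OF h'(1)[OF Suc.prems(2)[OF that]] this] show ?thesis
      by (simp add: mult.commute)
  qed
  moreover have "Dk k S (\<lambda>t. c * h' (a + c * t))"
    using Suc.IH[OF h'(2)] Suc.prems(2) by (auto intro: Dk_cmult)
  ultimately show ?case by (auto intro!: exI[of _ "\<lambda>t. c * h' (a + c * t)"])
qed

lemma Dk_powr: "Dk k {0<..} (\<lambda>t. t powr a)"
proof (induction k arbitrary: a)
  case (Suc k)
  have "Dk k {0<..} (\<lambda>t. a * t powr (a - 1))" by (rule Dk_cmult[OF Suc.IH])
  then show ?case
    by (auto intro!: exI[of _ "\<lambda>t. a * t powr (a - 1)"] has_real_derivative_powr)
qed (auto intro!: continuous_intros)

lemma Dk_ln: "Dk k {0<..} ln"
proof (cases k)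
  case (Suc j)
  have "(ln has_real_derivative t powr (-1)) (at t)" if "t > 0" for t :: real
    using DERIV_ln[OF that] that by (simp add: powr_minus)
  then show ?thesis unfolding Suc
    by (auto intro!: exI[of _ "\<lambda>t. t powr (-1)"] Dk_powr)
qed (auto intro!: continuous_intros)

text \<open>The function exp(-1/t) t^(-j), extended by 0. Differentiation maps this family into its
  own span, so one induction over all j proves every member smooth; \<open>bump 0\<close> is the
  classical function flat at 0.\<close>

definition bump :: "nat \<Rightarrow> real \<Rightarrow> real" where
  "bump j t = (if t > 0 then exp (- inverse t) * inverse t ^ j else 0)"

lemma bump_pos: "t > 0 \<Longrightarrow> bump j t > 0"
  by (simp add: bump_def)

lemma bump_zero [simp]: "t \<le> 0 \<Longrightarrow> bump j t = 0"
  by (simp add: bump_def)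

lemma bump_nonneg: "bump j t \<ge> 0"
  by (simp add: bump_def)

lemma bump_tendsto_0: "((bump j) \<longlongrightarrow> 0) (at 0)"
proof -
  have "((\<lambda>t. inverse t ^ j / exp (inverse t)) \<longlongrightarrow> (0::real)) (at_right 0)"
    by (rule filterlim_compose[OF tendsto_power_div_exp_0 filterlim_inverse_at_top_right])
  then have "(bump j \<longlongrightarrow> 0) (at_right 0)"
    by (rule Lim_transform_eventually)
       (auto simp: bump_def exp_minus divide_inverse mult.commute eventually_at_right_less intro!: eventually_at_rightI[of 0 1])
  moreover have "(bump j \<longlongrightarrow> 0) (at_left 0)"
    by (rule Lim_transform_eventually[of "\<lambda>_. 0"])
       (auto intro!: eventually_at_leftI[of "-1"])
  ultimately show ?thesis by (simp add: filterlim_split_at_real)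
qed

lemma has_real_derivative_bump:
  "(bump j has_real_derivative - real j * bump (Suc j) t + bump (Suc (Suc j)) t) (at t)"
proof -
  consider "t > 0" | "t < 0" | "t = 0" by linarith
  then show ?thesis
  proof cases
    case 1
    have "((\<lambda>t. exp (- inverse t) * inverse t ^ j) has_real_derivative
       - real j * bump (Suc j) t + bump (Suc (Suc j)) t) (at t)"
    proof (cases j)
      case (Suc i)
      show ?thesis
        by (rule derivative_eq_intros refl | use 1 in \<open>simp add: Suc bump_def algebra_simps\<close>)+
    qed (use 1 in \<open>auto intro!: derivative_eq_intros simp: bump_def algebra_simps power2_eq_square\<close>)
    then show ?thesis
      by (rule has_field_derivative_transform_within_open[where S="{0<..}"])
         (use 1 in \<open>auto simp: bump_def\<close>)
  next
    case 2
    have "((\<lambda>t. 0) has_real_derivative 0) (at t)" by simp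
    then have "(bump j has_real_derivative 0) (at t)"
      by (rule has_field_derivative_transform_within_open[where S="{..<0}"])
         (use 2 in \<open>auto simp: bump_def\<close>)
    with 2 show ?thesis by simp
  next
    case 3
    \<comment> \<open>The difference quotient of \<open>bump j\<close> at 0 is
      \<open>bump (Suc j)\<close>, whose limit is known.\<close>
    have "((\<lambda>h. (bump j (0 + h) - bump j 0) / h) \<longlongrightarrow> 0) (at 0)"
      using bump_tendsto_0[of "Suc j"]
      by (rule Lim_transform_eventually)
         (auto simp: bump_def divide_inverse eventually_at_filter)
    then show ?thesis using 3 by (simp add: DERIV_def)
  qed
qed

lemma Dk_bump: "Dk k UNIV (bump j)"
proof (induction k arbitrary: j)
  case 0
  show ?case
    by (auto intro!: continuous_at_imp_continuous_on DERIV_isCont has_real_derivative_bump)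
next
  case (Suc k)
  have "Dk k UNIV (\<lambda>t. - real j * bump (Suc j) t + bump (Suc (Suc j)) t)"
    by (intro Dk_add Dk_cmult Suc.IH)
  then show ?case unfolding Dk.simps
    by (intro exI[of _ "\<lambda>t. - real j * bump (Suc j) t + bump (Suc (Suc j)) t"] conjI ballI
        has_real_derivative_bump)
qed


section \<open>Smooth functions and test functions\<close>

lemma smooth_const [simp]: "smooth (\<lambda>x. c)"
  by (simp add: smooth_def)

lemma smooth_component [simp]: "smooth (\<lambda>x. x $ i)"
  by (simp add: smooth_def)

lemma smooth_add: "smooth f \<Longrightarrow> smooth g \<Longrightarrow> smooth (\<lambda>x. f x + g x)"
  by (simp add: smooth_def Ck_add)

lemma smooth_mult: "smooth f \<Longrightarrow> smooth g \<Longrightarrow> smooth (\<lambda>x. f x * g x)"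
  by (simp add: smooth_def Ck_mult)

lemma smooth_diff: "smooth f \<Longrightarrow> smooth g \<Longrightarrow> smooth (\<lambda>x. f x - g x)"
  using smooth_add[of f "\<lambda>x. (-1) * g x"] smooth_mult[of "\<lambda>_. -1" g] by simp

lemma smooth_power: "smooth f \<Longrightarrow> smooth (\<lambda>x. f x ^ k)"
  by (induction k) (auto intro: smooth_mult)

lemma smooth_sum: "finite I \<Longrightarrow> (\<And>i. i \<in> I \<Longrightarrow> smooth (f i)) \<Longrightarrow> smooth (\<lambda>x. \<Sum>i\<in>I. f i x)"
  by (induction I rule: finite_induct) (auto intro: smooth_add)

lemma smooth_affine: "smooth f \<Longrightarrow> smooth (\<lambda>x. f (a + c *\<^sub>R x))"
  by (simp add: smooth_def Ck_affine)

lemma smooth_compose: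
  "(\<And>k. Dk k S h) \<Longrightarrow> smooth u \<Longrightarrow> (\<And>x. u x \<in> S) \<Longrightarrow> smooth (\<lambda>x. h (u x))"
  unfolding smooth_def by (blast intro: Ck_compose)

lemma smooth_norm_squared: "smooth (\<lambda>x::real^'n::finite. (norm x)\<^sup>2)"
  unfolding dot_square_norm[symmetric] inner_vec_def
  by (simp add: smooth_sum smooth_mult)

lemma smooth_differentiable: "smooth f \<Longrightarrow> f differentiable (at x)"
  unfolding smooth_def using Ck_Suc_differentiable by blast

lemma smooth_has_derivative:
  "smooth f \<Longrightarrow> (f has_derivative (\<lambda>h. differential f x \<bullet> h)) (at x)"
  by (intro has_derivative_differential smooth_differentiable)

lemma smooth_continuous: "smooth f \<Longrightarrow> continuous_on UNIV f"
  unfolding smooth_def using Ck_continuous by blast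

lemma smooth_borel: "smooth f \<Longrightarrow> f \<in> borel_measurable borel"
  by (intro borel_measurable_continuous_onI smooth_continuous)

lemma smooth_partial: "smooth f \<Longrightarrow> smooth (partial_deriv i f)"
  unfolding smooth_def by (metis Ck.simps(2))

lemma smooth_differential_continuous: "smooth f \<Longrightarrow> continuous_on UNIV (differential f)"
  unfolding differential_def
  by (intro continuous_on_vec_lambda smooth_continuous smooth_partial)

lemma smooth_differential_borel: "smooth f \<Longrightarrow> differential f \<in> borel_measurable borel"
  by (intro borel_measurable_continuous_onI smooth_differential_continuous)

lemma test_functionI:
  assumes "smooth f" "\<And>x. norm x > r \<Longrightarrow> f x = 0"
  shows "test_function f"
proof -
  have "{x. f x \<noteq> 0} \<subseteq> cball 0 r" using assms(2) by (force simp: not_le)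
  then have "bounded {x. f x \<noteq> 0}" using bounded_cball bounded_subset by blast
  then show ?thesis using assms(1) unfolding test_function_def smooth_def
    by (simp add: compact_closure)
qed

lemma test_function_smooth: "test_function f \<Longrightarrow> smooth f"
  by (simp add: test_function_def smooth_def)

lemma test_function_support:
  assumes "test_function f"
  obtains r where "r > 0" "\<And>x. norm x > r \<Longrightarrow> f x = 0" 
proof -
  have "bounded {x. f x \<noteq> 0}"
    using assms unfolding test_function_def by (meson bounded_subset closure_subset compact_imp_bounded)
  then obtain r where "r > 0" "\<forall>x\<in>{x. f x \<noteq> 0}. norm x \<le> r"
    using bounded_pos by blast
  then show ?thesis using that by force
qed

lemma test_function_mult:
  assumes "test_function f" "smooth g"
  shows "test_function (\<lambda>x. f x * g x)"
proof -
  obtain r where "\<And>x. norm x > r \<Longrightarrow> f x = 0"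
    using test_function_support[OF assms(1)] by blast
  then show ?thesis
    by (intro test_functionI[of _ r] smooth_mult[OF test_function_smooth[OF assms(1)] assms(2)]) simp
qed

lemma differential_outside:
  assumes "\<And>x. norm x > r \<Longrightarrow> f x = 0" "norm x > r"
  shows "differential f x = 0"
proof (rule differential_eq)
  have "((\<lambda>x. 0) has_derivative (\<lambda>h. 0 \<bullet> h)) (at x)" by simp
  then show "(f has_derivative (\<lambda>h. 0 \<bullet> h)) (at x)"
    by (rule has_derivative_transform_within_open[where s="- cball 0 r"])
       (use assms in auto)
qed

section \<open>Mollification\<close>

text \<open>A convex function lies above its tangent at \<open>m\<close>. Young's inequality with
  exponents p and p/(p-1), applied to \<open>a\<close> and m^(p-1), is this inequality
  rearranged.\<close>

lemma powr_tangent: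
  fixes a m p :: real
  assumes "a \<ge> 0" "m \<ge> 0" "p \<ge> 1"
  shows "m powr p + p * m powr (p - 1) * (a - m) \<le> a powr p"
proof (cases "p = 1 \<or> m = 0")
  case True
  then show ?thesis using assms by (cases "m = 0") auto
next
  case False
  then have p: "p > 1" "m > 0" using assms by auto
  define q where "q = p / (p - 1)"
  have q: "q > 1" "1/p + 1/q = 1" using p by (auto simp: q_def field_simps)
  have "a * m powr (p - 1) \<le> a powr p / p + (m powr (p - 1)) powr q / q"
    using Youngs_inequality[OF p(1) q assms(1)] by simp
  also have "(m powr (p - 1)) powr q = m powr p"
    using p by (simp add: powr_powr q_def)
  also have "a powr p / p + m powr p / q = (a powr p + (p - 1) * m powr p) / p"
    using p by (simp add: q_def field_simps)
  finally have "p * a * m powr (p - 1) \<le> a powr p + (p - 1) * m powr p"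
    using p by (simp add: field_simps)
  moreover have "m powr (p - 1) * m = m powr p"
    using p by (simp add: powr_diff)
  ultimately show ?thesis by (simp add: algebra_simps)
qed

lemma nn_integral_lborel_affine:
  fixes t :: "'a::euclidean_space"
  assumes [measurable]: "h \<in> borel_measurable borel" and c: "c \<noteq> 0"
  shows "(\<integral>\<^sup>+x. h x \<partial>lborel) = ennreal (\<bar>c\<bar>^DIM('a)) * (\<integral>\<^sup>+x. h (t + c *\<^sub>R x) \<partial>lborel)"
  by (subst lborel_affine[OF c, of t])
     (simp add: nn_integral_density nn_integral_distr nn_integral_cmult ennreal_power)

lemma nn_integral_lborel_diff:
  fixes t :: "'a::euclidean_space"
  assumes "h \<in> borel_measurable borel"
  shows "(\<integral>\<^sup>+x. h (t - x) \<partial>lborel) = (\<integral>\<^sup>+x. h x \<partial>lborel)"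
    "(\<integral>\<^sup>+x. h (x - t) \<partial>lborel) = (\<integral>\<^sup>+x. h x \<partial>lborel)"
  using nn_integral_lborel_affine[OF assms, of "-1" t] nn_integral_lborel_affine[OF assms, of 1 "-t"]
  by (simp_all add: ennreal_power[symmetric])

lemma continuous_bounded_support:
  fixes f :: "'a::euclidean_space \<Rightarrow> real"
  assumes "continuous_on UNIV f" "\<And>x. norm x > r \<Longrightarrow> f x = 0"
  obtains C where "C > 0" "\<And>x. \<bar>f x\<bar> \<le> C"
proof -
  have "compact (f ` cball 0 r)"
    using assms(1) by (intro compact_continuous_image) (auto intro: continuous_on_subset)
  then obtain C where "C > 0" "\<forall>y\<in>f ` cball 0 r. norm y \<le> C"
    using bounded_pos compact_imp_bounded by blast
  then have "\<bar>f x\<bar> \<le> C" for x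
    by (cases "norm x \<le> r") (auto simp: assms(2))
  with \<open>C > 0\<close> show ?thesis using that by blast
qed

section \<open>Local integrability, convolution and mollifiers\<close>

definition loc_int :: "(real^'n::finite \<Rightarrow> real) \<Rightarrow> bool" where
  "loc_int f \<longleftrightarrow> (\<forall>r. set_integrable lborel (cball 0 r) f)"

lemma loc_int_mult:
  assumes "loc_int f" "continuous_on UNIV g" "\<And>x. norm x > r \<Longrightarrow> g x = 0"
  shows "integrable lborel (\<lambda>x. f x * g x)"
proof -
  obtain C where C: "C > 0" "\<And>x. \<bar>g x\<bar> \<le> C"
    using continuous_bounded_support[OF assms(2,3)] by blast
  have I: "integrable lborel (\<lambda>x. indicator (cball 0 r) x * f x)"
    using assms(1) by (simp add: loc_int_def set_integrable_def)
  have [measurable]: "g \<in> borel_measurable borel"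
    using assms(2) by (rule borel_measurable_continuous_onI)
  have eq: "f x * g x = (indicator (cball 0 r) x * f x) * g x" for x
    using assms(3)[of x] by (auto simp: indicator_def)
  show ?thesis
  proof (subst eq, rule Bochner_Integration.integrable_bound)
    show "integrable lborel (\<lambda>x. C * (indicator (cball 0 r) x * f x))"
      using I by simp
    show "(\<lambda>x. indicator (cball 0 r) x * f x * g x) \<in> borel_measurable lborel"
      using borel_measurable_integrable[OF I] by measurable
    show "AE x in lborel. norm (indicator (cball 0 r) x * f x * g x) \<le> norm (C * (indicator (cball 0 r) x * f x))"
      using C by (auto simp: abs_mult mult.commute[of _ "\<bar>g _\<bar>"] intro!: mult_right_mono always_eventually)
  qed
qed

lemma loc_int_const: "loc_int (\<lambda>x. c)"
  unfolding loc_int_def set_integrable_def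
  by (auto simp: emeasure_bounded_finite[unfolded infinity_ennreal_def]
      intro!: integrable_scaleR_left integrable_real_indicator)

lemma loc_int_mult_test:
  assumes "loc_int f" "test_function \<psi>"
  shows "integrable lborel (\<lambda>x. f x * \<psi> x)"
proof -
  obtain r where "\<And>x. norm x > r \<Longrightarrow> \<psi> x = 0"
    using test_function_support[OF assms(2)] by blast
  then show ?thesis
    by (intro loc_int_mult[OF assms(1) smooth_continuous[OF test_function_smooth[OF assms(2)]]])
qed

lemma test_function_reflect:
  assumes "test_function \<psi>"
  shows "test_function (\<lambda>y. \<psi> (x - y))"
proof -
  obtain r where r: "\<And>x. norm x > r \<Longrightarrow> \<psi> x = 0"
    using test_function_support[OF assms] by blast
  show ?thesis
  proof (rule test_functionI[of _ "r + norm x"])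
    show "smooth (\<lambda>y. \<psi> (x - y))"
      using smooth_affine[OF test_function_smooth[OF assms], of x "-1"] by simp
    show "\<psi> (x - y) = 0" if "r + norm x < norm y" for y
      using that norm_triangle_ineq2[of y x] by (intro r) (auto simp: norm_minus_commute)
  qed
qed

definition conv :: "(real^'n::finite \<Rightarrow> real) \<Rightarrow> (real^'n \<Rightarrow> real) \<Rightarrow> real^'n \<Rightarrow> real" where
  "conv f \<rho> x = (\<integral>y. f y * \<rho> (x - y) \<partial>lborel)"

text \<open>The mass is a nonnegative integral, so that its value 1 also yields
  integrability.\<close>

definition mollifier :: "real \<Rightarrow> (real^'n::finite \<Rightarrow> real) \<Rightarrow> bool" where
  "mollifier e \<rho> \<longleftrightarrow> test_function \<rho> \<and> (\<forall>x. 0 \<le> \<rho> x) \<and> (\<forall>x. norm x \<ge> e \<longrightarrow> \<rho> x = 0) \<and>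
     (\<integral>\<^sup>+x. ennreal (\<rho> x) \<partial>lborel) = 1"

lemma mollifier_exists:
  assumes "e > 0"
  obtains \<rho> :: "real^'n::finite \<Rightarrow> real" where "mollifier e \<rho>"
proof -
  \<comment> \<open>The squared norm makes the argument polynomial, hence smooth also at the
    origin.\<close>
  define b :: "real^'n \<Rightarrow> real" where "b x = bump 0 (e\<^sup>2 - (norm x)\<^sup>2)" for x
  have b0: "b x = 0" if "norm x \<ge> e" for x
    using that assms by (auto simp: b_def intro!: bump_zero power_mono)
  have bpos: "b x > 0" if "norm x < e" for x
    using that assms by (auto simp: b_def intro!: bump_pos power_strict_mono)
  have bnn: "b x \<ge> 0" for x by (simp add: b_def bump_nonneg)
  have sm: "smooth b" unfolding b_def
    by (rule smooth_compose[OF Dk_bump]) (auto intro: smooth_diff smooth_norm_squared)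
  then have [measurable]: "b \<in> borel_measurable borel" by (rule smooth_borel)
  have tb: "test_function b"
    by (rule test_functionI[OF sm, of e]) (simp add: b0)
  have int: "integrable lborel b"
    using loc_int_mult_test[OF loc_int_const[of 1] tb] by simp
  define I where "I = (\<integral>x. b x \<partial>lborel)"
  have "I \<noteq> 0"
  proof
    assume "I = 0"
    then have "AE x in lborel. b x = 0"
      using integral_nonneg_eq_0_iff_AE[OF int] bnn by (simp add: I_def)
    then have "AE x in lborel. x \<notin> ball (0::real^'n) e"
      by eventually_elim (use bpos in force)
    then have "emeasure lborel (ball (0::real^'n) e) = 0"
      by (subst (asm) AE_iff_measurable[of "ball (0::real^'n) e"]) auto
    then have "ball (0::real^'n) e \<in> null_sets lborel" by auto
    then have "negligible (ball (0::real^'n) e)"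
      using negligible_iff_null_sets null_sets_completionI by blast
    then show False using assms open_not_negligible[of "ball (0::real^'n) e"] by auto
  qed
  moreover have "I \<ge> 0" unfolding I_def using bnn by simp
  ultimately have I: "I > 0" by simp
  have "mollifier e (\<lambda>x. b x * inverse I)"
    unfolding mollifier_def
  proof (intro conjI allI impI)
    show "test_function (\<lambda>x. b x * inverse I)" by (rule test_function_mult[OF tb]) simp
    have "(\<integral>\<^sup>+x. ennreal (b x * inverse I) \<partial>lborel) = (\<integral>x. b x * inverse I \<partial>lborel)"
      using int bnn I by (intro nn_integral_eq_integral) auto
    then show "(\<integral>\<^sup>+x. ennreal (b x * inverse I) \<partial>lborel) = 1"
      using I by (simp add: I_def)
  qed (use bnn I b0 in auto)
  then show ?thesis using that by blast
qed

lemma mollifier_borel: "mollifier e \<rho> \<Longrightarrow> \<rho> \<in> borel_measurable borel"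
  using mollifier_def smooth_borel test_function_smooth by blast

lemma mollifier_shift:
  assumes "mollifier e \<rho>"
  shows "(\<integral>\<^sup>+y. ennreal (\<rho> (x - y)) \<partial>lborel) = 1" "(\<integral>\<^sup>+y. ennreal (\<rho> (y - x)) \<partial>lborel) = 1"
    "integrable lborel (\<lambda>y. \<rho> (x - y))" "(\<integral>y. \<rho> (x - y) \<partial>lborel) = 1"
proof -
  note [measurable] = mollifier_borel[OF assms]
  show 1: "(\<integral>\<^sup>+y. ennreal (\<rho> (x - y)) \<partial>lborel) = 1" "(\<integral>\<^sup>+y. ennreal (\<rho> (y - x)) \<partial>lborel) = 1"
    using assms nn_integral_lborel_diff[of "\<lambda>y. ennreal (\<rho> y)" x] by (auto simp: mollifier_def)
  show int: "integrable lborel (\<lambda>y. \<rho> (x - y))"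
    using 1 assms by (intro integrableI_nonneg) (auto simp: mollifier_def)
  show "(\<integral>y. \<rho> (x - y) \<partial>lborel) = 1"
    using nn_integral_eq_integral[OF int] 1 assms
    by (auto simp: mollifier_def simp flip: ennreal_1)
qed

text \<open>The convolution is an average over the ball of radius \<open>e\<close> around
  \<open>x\<close>, so bounds valid almost everywhere on this ball become pointwise bounds. Equal
  bounds compute the value exactly; this is how supports and plateaus are found below.\<close>

lemma conv_bounds:
  assumes "mollifier e \<rho>" "loc_int f" "AE y in lborel. norm (x - y) < e \<longrightarrow> L \<le> f y \<and> f y \<le> M"
  shows "L \<le> conv f \<rho> x" "conv f \<rho> x \<le> M"
proof -
  have t: "test_function (\<lambda>y. \<rho> (x - y))"
    using assms(1) by (intro test_function_reflect) (simp add: mollifier_def)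
  have int: "integrable lborel (\<lambda>y. f y * \<rho> (x - y))"
    by (rule loc_int_mult_test[OF assms(2) t])
  have z: "\<rho> (x - y) \<ge> 0" "norm (x - y) \<ge> e \<Longrightarrow> \<rho> (x - y) = 0" for y
    using assms(1) by (auto simp: mollifier_def)
  have AE: "AE y in lborel. L * \<rho> (x - y) \<le> f y * \<rho> (x - y) \<and> f y * \<rho> (x - y) \<le> M * \<rho> (x - y)"
    using assms(3) by eventually_elim (metis z linorder_not_less mult_right_mono mult_zero_right order_refl)
  have "L * 1 \<le> conv f \<rho> x" 
    unfolding conv_def mollifier_shift(4)[OF assms(1), of x, symmetric]
      integral_mult_right_zero[symmetric]
    using AE mollifier_shift(3)[OF assms(1)] int by (intro integral_mono_AE) auto
  then show "L \<le> conv f \<rho> x" by simp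
  have "conv f \<rho> x \<le> M * 1" 
    unfolding conv_def mollifier_shift(4)[OF assms(1), of x, symmetric]
      integral_mult_right_zero[symmetric]
    using AE mollifier_shift(3)[OF assms(1)] int by (intro integral_mono_AE) auto
  then show "conv f \<rho> x \<le> M" by simp
qed

lemma borel_measurable_conv:
  assumes [measurable]: "f \<in> borel_measurable borel" and "mollifier e \<rho>"
  shows "conv f \<rho> \<in> borel_measurable borel"
proof -
  note [measurable] = mollifier_borel[OF assms(2)]
  show ?thesis unfolding conv_def[abs_def] by measurable
qed

lemma cball_sets_borel [measurable]: "cball (x::'a::metric_space) r \<in> sets borel"
  by simp

lemma powr_integrable_loc_int:
  fixes f :: "real^'n::finite \<Rightarrow> real"
  assumes [measurable]: "f \<in> borel_measurable borel" and "p \<ge> 1"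
    and "\<And>r. (\<integral>\<^sup>+x\<in>cball 0 r. ennreal (\<bar>f x\<bar> powr p) \<partial>lborel) < \<infinity>"
  shows "loc_int f"
  unfolding loc_int_def set_integrable_def
proof (intro allI integrableI_bounded)
  fix r
  have le: "\<bar>t\<bar> \<le> 1 + \<bar>t\<bar> powr p" for t :: real
    using assms(2) powr_mono[of 1 p "\<bar>t\<bar>"] by (cases "\<bar>t\<bar> \<ge> 1") (auto intro: add_increasing2)
  have "(\<integral>\<^sup>+x. ennreal (norm (indicat_real (cball 0 r) x *\<^sub>R f x)) \<partial>lborel) \<le>
    (\<integral>\<^sup>+x\<in>cball 0 r. 1 + ennreal (\<bar>f x\<bar> powr p) \<partial>lborel)"
    using ennreal_leI[OF le] by (intro nn_integral_mono) (auto simp: indicator_def ennreal_plus)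
  also have "\<dots> = (\<integral>\<^sup>+x\<in>cball (0::real^'n) r. 1 \<partial>lborel) + (\<integral>\<^sup>+x\<in>cball 0 r. ennreal (\<bar>f x\<bar> powr p) \<partial>lborel)"
    by (subst nn_integral_add[symmetric]) (auto simp: distrib_right)
  also have "\<dots> < \<infinity>" using assms(3)[of r] emeasure_bounded_finite[of "cball (0::real^'n) r"]
    by (simp add: nn_integral_cmult_indicator)
  finally show "(\<integral>\<^sup>+x. ennreal (norm (indicat_real (cball 0 r) x *\<^sub>R f x)) \<partial>lborel) < \<infinity>" .
qed (auto intro!: borel_measurable_scaleR borel_measurable_indicator)

text \<open>Jensen's inequality for the probability density \<rho>(x - y): the tangent of t^p at the
  mean \<open>c\<close> of |f| is integrated, and its linear term has integral 0.\<close>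

lemma conv_jensen:
  assumes [measurable]: "f \<in> borel_measurable borel" and m: "mollifier e \<rho>" and p: "p \<ge> 1"
    and f: "loc_int f"
  shows "ennreal (\<bar>conv f \<rho> x\<bar> powr p) \<le> (\<integral>\<^sup>+y. ennreal (\<bar>f y\<bar> powr p * \<rho> (x - y)) \<partial>lborel)"
proof (cases "(\<integral>\<^sup>+y. ennreal (\<bar>f y\<bar> powr p * \<rho> (x - y)) \<partial>lborel) = \<infinity>")
  case False
  note [measurable] = mollifier_borel[OF m]
  have nn: "\<rho> (x - y) \<ge> 0" for y using m by (simp add: mollifier_def)
  have int: "integrable lborel (\<lambda>y. \<bar>f y\<bar> powr p * \<rho> (x - y))"
    using False nn by (intro integrableI_nonneg) (auto simp: less_top)
  have t: "test_function (\<lambda>y. \<rho> (x - y))"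
    using m by (intro test_function_reflect) (simp add: mollifier_def)
  have i1: "integrable lborel (\<lambda>y. f y * \<rho> (x - y))"
    by (rule loc_int_mult_test[OF f t])
  then have i2: "integrable lborel (\<lambda>y. \<bar>f y\<bar> * \<rho> (x - y))"
    using integrable_abs[OF i1] nn by (simp add: abs_mult)
  define c where "c = (\<integral>y. \<bar>f y\<bar> * \<rho> (x - y) \<partial>lborel)"
  have c0: "c \<ge> 0" unfolding c_def using nn by simp
  have "\<bar>conv f \<rho> x\<bar> \<le> c"
    unfolding conv_def c_def using integral_abs_bound[of lborel "\<lambda>y. f y * \<rho> (x - y)"] nn
    by (simp add: abs_mult)
  then have "\<bar>conv f \<rho> x\<bar> powr p \<le> c powr p" using p by (intro powr_mono2) auto
  also have "\<dots> = (\<integral>y. c powr p * \<rho> (x - y) + p * c powr (p - 1) * (\<bar>f y\<bar> * \<rho> (x - y) - c * \<rho> (x - y)) \<partial>lborel)"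
    using i2 mollifier_shift(3,4)[OF m, of x] by (simp add: c_def[symmetric])
  also have "\<dots> \<le> (\<integral>y. \<bar>f y\<bar> powr p * \<rho> (x - y) \<partial>lborel)"
  proof (rule integral_mono)
    show "c powr p * \<rho> (x - y) + p * c powr (p - 1) * (\<bar>f y\<bar> * \<rho> (x - y) - c * \<rho> (x - y))
      \<le> \<bar>f y\<bar> powr p * \<rho> (x - y)" for y
      using mult_right_mono[OF powr_tangent[OF _ c0 p, of "\<bar>f y\<bar>"] nn[of y]] by (simp add: algebra_simps)
  qed (use int i2 mollifier_shift(3)[OF m, of x] in auto)
  finally show ?thesis
    using nn int by (subst nn_integral_eq_integral) (auto intro: ennreal_leI)
qed simp

text \<open>Jensen's inequality at each point, then Fubini: \<rho>(x - y) has mass 1 in x as well as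
  in y.\<close>

lemma conv_contraction:
  assumes [measurable]: "f \<in> borel_measurable borel" and m: "mollifier e \<rho>" and p: "p \<ge> 1"
    and f: "loc_int f"
  shows "(\<integral>\<^sup>+x. ennreal (\<bar>conv f \<rho> x\<bar> powr p) \<partial>lborel) \<le> (\<integral>\<^sup>+x. ennreal (\<bar>f x\<bar> powr p) \<partial>lborel)"
proof -
  note [measurable] = mollifier_borel[OF m]
  have nn: "\<rho> z \<ge> 0" for z using m by (simp add: mollifier_def)
  have "(\<integral>\<^sup>+x. ennreal (\<bar>conv f \<rho> x\<bar> powr p) \<partial>lborel)
     \<le> (\<integral>\<^sup>+x. (\<integral>\<^sup>+y. ennreal (\<bar>f y\<bar> powr p * \<rho> (x - y)) \<partial>lborel) \<partial>lborel)"
    by (intro nn_integral_mono conv_jensen[OF assms])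
  also have "\<dots> = (\<integral>\<^sup>+y. (\<integral>\<^sup>+x. ennreal (\<bar>f y\<bar> powr p * \<rho> (x - y)) \<partial>lborel) \<partial>lborel)"
    by (rule lborel_pair.Fubini') measurable
  also have "\<dots> = (\<integral>\<^sup>+x. ennreal (\<bar>f x\<bar> powr p) \<partial>lborel)"
    using nn by (intro nn_integral_cong)
      (simp add: ennreal_mult nn_integral_cmult mollifier_shift(2)[OF m])
  finally show ?thesis .
qed

lemma powr_add_le:
  fixes a b p :: real
  assumes "a \<ge> 0" "b \<ge> 0" "p \<ge> 0"
  shows "(a + b) powr p \<le> 2 powr p * (a powr p + b powr p)"
proof -
  have "(a + b) powr p \<le> (2 * max a b) powr p" using assms by (intro powr_mono2) auto
  also have "\<dots> = 2 powr p * max a b powr p" using assms by (simp add: powr_mult)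
  also have "max a b powr p \<le> a powr p + b powr p" by (auto simp: max_def)
  finally show ?thesis by (simp add: mult_left_mono)
qed

lemma powr_norm_add_le:
  fixes a b :: "'a::real_normed_vector"
  assumes "p \<ge> (0::real)"
  shows "norm (a + b) powr p \<le> 2 powr p * (norm a powr p + norm b powr p)"
  using powr_mono2[OF assms norm_ge_zero norm_triangle_ineq, of a b] powr_add_le[of "norm a" "norm b" p] assms
  by simp

section \<open>Convergence of mollifications in the p-norm\<close>

lemma tendsto_ennreal_0I:
  fixes f :: "'a \<Rightarrow> ennreal"
  assumes "\<And>e::real. e > 0 \<Longrightarrow> \<forall>\<^sub>F n in F. f n \<le> ennreal e"
  shows "(f \<longlongrightarrow> 0) F"
proof (rule order_tendstoI)
  fix a :: ennreal assume "0 < a"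
  then obtain b where b: "0 < b" "b < a" using dense by blast
  have "b < top" using b(2) by (rule order_less_le_trans) simp
  then obtain e where e: "b = ennreal e" "e > 0" using b by (cases b) (auto simp: ennreal_less_zero_iff)
  show "\<forall>\<^sub>F n in F. f n < a"
    using assms[OF e(2)] by eventually_elim (use b e in auto)
qed auto

lemma nn_integral_powr_add_le:
  fixes f g :: "'a \<Rightarrow> 'b::{real_normed_vector,second_countable_topology}"
  assumes [measurable]: "f \<in> borel_measurable M" "g \<in> borel_measurable M" and "p \<ge> (0::real)"
  shows "(\<integral>\<^sup>+x. ennreal (norm (f x + g x) powr p) \<partial>M) \<le>
    ennreal (2 powr p) * ((\<integral>\<^sup>+x. ennreal (norm (f x) powr p) \<partial>M) + (\<integral>\<^sup>+x. ennreal (norm (g x) powr p) \<partial>M))"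
proof -
  have "(\<integral>\<^sup>+x. ennreal (norm (f x + g x) powr p) \<partial>M) \<le>
    (\<integral>\<^sup>+x. ennreal (2 powr p) * (ennreal (norm (f x) powr p) + ennreal (norm (g x) powr p)) \<partial>M)"
    using ennreal_leI[OF powr_norm_add_le[OF assms(3)]]
    by (intro nn_integral_mono) (auto simp: ennreal_mult ennreal_plus)
  then show ?thesis by (simp add: nn_integral_cmult nn_integral_add)
qed

text \<open>Truncation in value and in space reduces to a bounded function of bounded support. A
  measurable function is an almost everywhere limit of continuous ones, and these are clipped and
  cut off in turn so that dominated convergence applies.\<close>

lemma Lp_dense_continuous:
  fixes f :: "'a::euclidean_space \<Rightarrow> real"
  assumes [measurable]: "f \<in> borel_measurable borel" and p: "p \<ge> 1"
    and fin: "(\<integral>\<^sup>+x. ennreal (\<bar>f x\<bar> powr p) \<partial>lborel) < \<infinity>" and e: "e > (0::real)"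
  obtains g r where "continuous_on UNIV g" "\<And>x. norm x > r \<Longrightarrow> g x = 0"
    "(\<integral>\<^sup>+x. ennreal (\<bar>f x - g x\<bar> powr p) \<partial>lborel) \<le> ennreal e"
proof -
  define clip :: "nat \<Rightarrow> real \<Rightarrow> real" where "clip k t = max (- real k) (min (real k) t)" for k t
  define F where "F k x = (if norm x \<le> real k then clip k (f x) else 0)" for k x
  define e' where "e' = e / (2 * 2 powr p)"
  have e': "e' > 0" using e by (simp add: e'_def)
  have [measurable]: "clip k \<in> borel_measurable borel" for k unfolding clip_def[abs_def] by measurable
  have [measurable]: "F k \<in> borel_measurable borel" for k unfolding F_def[abs_def] by measurable
  have lim1: "(\<lambda>k. \<integral>\<^sup>+x. ennreal (\<bar>f x - F k x\<bar> powr p) \<partial>lborel) \<longlonglongrightarrow> (\<integral>\<^sup>+x. 0 \<partial>(lborel::'a measure))"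
  proof (rule nn_integral_dominated_convergence[where w="\<lambda>x. ennreal (\<bar>f x\<bar> powr p)"])
    show "AE x in lborel. ennreal (\<bar>f x - F k x\<bar> powr p) \<le> ennreal (\<bar>f x\<bar> powr p)" for k
      using p by (intro always_eventually allI ennreal_leI powr_mono2) (auto simp: F_def clip_def)
    show "AE x in lborel. (\<lambda>k. ennreal (\<bar>f x - F k x\<bar> powr p)) \<longlonglongrightarrow> 0"
    proof (rule AE_I2, rule tendsto_eventually)
      fix x
      obtain m :: nat where m: "real m \<ge> max (norm x) \<bar>f x\<bar>" using real_arch_simple by blast
      show "\<forall>\<^sub>F k in sequentially. ennreal (\<bar>f x - F k x\<bar> powr p) = 0"
        using eventually_ge_at_top[of m]
        by eventually_elim (use m in \<open>auto simp: F_def clip_def\<close>)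
    qed
  qed (use fin in auto)
  have "\<forall>\<^sub>F k in sequentially. (\<integral>\<^sup>+x. ennreal (\<bar>f x - F k x\<bar> powr p) \<partial>lborel) < ennreal e'"
    using order_tendstoD(2)[OF lim1, of "ennreal e'"] e' by simp
  then obtain k where k: "(\<integral>\<^sup>+x. ennreal (\<bar>f x - F k x\<bar> powr p) \<partial>lborel) < ennreal e'"
    using eventually_happens by force
  have "F k \<in> borel_measurable lebesgue" by (rule measurable_completion) simp
  then have "F k measurable_on UNIV"
    by (intro lebesgue_measurable_imp_measurable_on) auto
  then obtain N G where N: "negligible N" and G: "\<And>n. continuous_on UNIV (G n)"
      "\<And>x. x \<notin> N \<Longrightarrow> (\<lambda>n. G n x) \<longlonglongrightarrow> F k x"
    unfolding measurable_on_def by auto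
  \<comment> \<open>The ramp is 1 on the ball of radius k and 0 beyond radius k + 1. Since
    \<open>F k\<close> lives on the smaller ball and is already clipped, the limit does not
    change.\<close>
  define H where "H n x = max 0 (min 1 (real k + 1 - norm x)) * clip k (G n x)" for n x
  have cH: "continuous_on UNIV (H n)" for n
    unfolding H_def clip_def by (intro continuous_intros G)
  have [measurable]: "H n \<in> borel_measurable borel" for n
    by (rule borel_measurable_continuous_onI[OF cH])
  have H0: "H n x = 0" if "norm x > real k + 1" for n x using that by (simp add: H_def)
  have bH: "\<bar>H n x\<bar> \<le> real k" for n x
  proof -
    have "\<bar>H n x\<bar> \<le> 1 * real k" unfolding H_def abs_mult by (intro mult_mono) (auto simp: clip_def)
    then show ?thesis by simp
  qed
  have bF: "\<bar>F k x\<bar> \<le> real k" for x by (auto simp: F_def clip_def)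
  have Hlim: "(\<lambda>n. H n x) \<longlonglongrightarrow> F k x" if "x \<notin> N" for x
  proof -
    have "(\<lambda>n. H n x) \<longlonglongrightarrow> max 0 (min 1 (real k + 1 - norm x)) * clip k (F k x)"
      unfolding H_def clip_def by (intro tendsto_intros G that)
    moreover have "max 0 (min 1 (real k + 1 - norm x)) * clip k (F k x) = F k x"
      by (auto simp: F_def clip_def)
    ultimately show ?thesis by simp
  qed
  have lim2: "(\<lambda>n. \<integral>\<^sup>+x. ennreal (\<bar>F k x - H n x\<bar> powr p) \<partial>lborel) \<longlonglongrightarrow> (\<integral>\<^sup>+x. 0 \<partial>(lborel::'a measure))"
  proof (rule nn_integral_dominated_convergence[where w="\<lambda>x. ennreal ((2 * real k) powr p) * indicator (cball 0 (real k + 1)) x"])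
    show "AE x in lborel. ennreal (\<bar>F k x - H n x\<bar> powr p) \<le>
      ennreal ((2 * real k) powr p) * indicator (cball 0 (real k + 1)) x" for n
    proof (intro always_eventually allI)
      fix x :: 'a
      have "\<bar>F k x - H n x\<bar> powr p \<le> (2 * real k) powr p"
        using p bF[of x] bH[of n x] by (intro powr_mono2) auto
      then show "ennreal (\<bar>F k x - H n x\<bar> powr p) \<le>
          ennreal ((2 * real k) powr p) * indicator (cball 0 (real k + 1)) x"
        using H0[of x n] by (cases "norm x \<le> real k + 1") (auto simp: F_def intro: ennreal_leI)
    qed
    have "AE x in lborel. x \<notin> N"
      using N negligible_iff_null_sets AE_not_in AE_completion_iff by blast
    then show "AE x in lborel. (\<lambda>n. ennreal (\<bar>F k x - H n x\<bar> powr p)) \<longlonglongrightarrow> 0"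
    proof eventually_elim
      case (elim x)
      have "(\<lambda>n. \<bar>F k x - H n x\<bar> powr p) \<longlonglongrightarrow> \<bar>F k x - F k x\<bar> powr p"
        using p by (intro tendsto_powr2 tendsto_intros Hlim elim) auto
      then show ?case using p by (auto intro!: tendsto_ennrealI[of _ 0, simplified])
    qed
    show "(\<integral>\<^sup>+ x. ennreal ((2 * real k) powr p) * indicator (cball 0 (real k + 1)) (x::'a) \<partial>lborel) < \<infinity>"
      using emeasure_bounded_finite[of "cball (0::'a) (real k + 1)"]
      by (simp add: nn_integral_cmult_indicator ennreal_mult_less_top)
  qed auto
  have "\<forall>\<^sub>F n in sequentially. (\<integral>\<^sup>+x. ennreal (\<bar>F k x - H n x\<bar> powr p) \<partial>lborel) < ennreal e'"
    using order_tendstoD(2)[OF lim2, of "ennreal e'"] e' by simp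
  then obtain n where n: "(\<integral>\<^sup>+x. ennreal (\<bar>F k x - H n x\<bar> powr p) \<partial>lborel) < ennreal e'"
    using eventually_happens by force
  have "(\<integral>\<^sup>+x. ennreal (\<bar>f x - H n x\<bar> powr p) \<partial>lborel)
    = (\<integral>\<^sup>+x. ennreal (norm ((f x - F k x) + (F k x - H n x)) powr p) \<partial>lborel)" by simp
  also have "\<dots> \<le> ennreal (2 powr p) * ((\<integral>\<^sup>+x. ennreal (norm (f x - F k x) powr p) \<partial>lborel)
      + (\<integral>\<^sup>+x. ennreal (norm (F k x - H n x) powr p) \<partial>lborel))"
    using p by (intro nn_integral_powr_add_le) auto
  also have "\<dots> \<le> ennreal (2 powr p) * (ennreal e' + ennreal e')"
    using k n by (intro mult_left_mono add_mono) auto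
  also have "\<dots> = ennreal e" using e e' by (simp add: e'_def flip: ennreal_mult ennreal_plus)
  finally show ?thesis using that[OF cH H0] by blast
qed

lemma uniformly_continuous_bounded_support:
  fixes g :: "'a::euclidean_space \<Rightarrow> 'b::real_normed_vector"
  assumes "continuous_on UNIV g" "\<And>x. norm x > r \<Longrightarrow> g x = 0" "\<eta> > 0"
  obtains \<delta> where "\<delta> > 0" "\<And>x y. norm (x - y) < \<delta> \<Longrightarrow> norm (g x - g y) < \<eta>"
proof -
  have "uniformly_continuous_on (cball 0 (r + 2)) g"
    using assms(1) by (intro compact_uniformly_continuous) (auto intro: continuous_on_subset)
  then obtain d where d: "d > 0" "\<And>x y. \<lbrakk>norm x \<le> r + 2; norm y \<le> r + 2; norm (x - y) < d\<rbrakk> \<Longrightarrow> norm (g x - g y) < \<eta>"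
    using assms(3) unfolding uniformly_continuous_on_def dist_norm by (metis dist_norm mem_cball_0)
  have "norm (g x - g y) < \<eta>" if "norm (x - y) < min d 1" for x y
  proof (cases "norm x \<le> r + 1")
    case True
    then show ?thesis using that norm_triangle_ineq2[of y x] by (intro d) (auto simp: norm_minus_commute)
  next
    case False
    then have "norm y > r" using that norm_triangle_ineq2[of x y] by auto
    then show ?thesis using False assms by simp
  qed
  then show ?thesis using that[of "min d 1"] d by auto
qed

lemma conv_diff:
  assumes "loc_int f" "loc_int g" "mollifier e \<rho>"
  shows "conv (\<lambda>x. f x - g x) \<rho> x = conv f \<rho> x - conv g \<rho> x"
proof -
  have t: "test_function (\<lambda>y. \<rho> (x - y))"
    using assms(3) by (intro test_function_reflect) (simp add: mollifier_def)
  show ?thesis unfolding conv_def left_diff_distrib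
    by (rule Bochner_Integration.integral_diff) (auto intro: loc_int_mult_test t assms)
qed

lemma loc_int_continuous: "continuous_on UNIV g \<Longrightarrow> loc_int g"
  unfolding loc_int_def set_integrable_def
  by (intro allI borel_integrable_compact) (auto intro: continuous_on_subset)

lemma loc_int_diff: "loc_int f \<Longrightarrow> loc_int g \<Longrightarrow> loc_int (\<lambda>x. f x - g x)"
  unfolding loc_int_def by (auto intro: set_integral_diff)

lemma nn_set_integral_le: "(\<integral>\<^sup>+x\<in>A. f x \<partial>M) \<le> (\<integral>\<^sup>+x. f x \<partial>M)"
  by (intro nn_integral_mono) (auto simp: indicator_def)

text \<open>The comparison goes through a continuous \<open>g\<close> of bounded support close to
  \<open>f\<close>: contraction controls the mollification of \<open>f - g\<close>, and mollifying
  \<open>g\<close> moves it uniformly little on a fixed ball.\<close>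

lemma mollify_Lp:
  fixes f :: "real^'n::finite \<Rightarrow> real"
  assumes [measurable]: "f \<in> borel_measurable borel" and p: "p \<ge> 1"
    and fin: "(\<integral>\<^sup>+x. ennreal (\<bar>f x\<bar> powr p) \<partial>lborel) < \<infinity>"
    and m: "\<And>n. mollifier (inverse (real (Suc n))) (\<rho> n)"
  shows "(\<lambda>n. \<integral>\<^sup>+x. ennreal (\<bar>conv f (\<rho> n) x - f x\<bar> powr p) \<partial>lborel) \<longlonglongrightarrow> 0"
proof (rule tendsto_ennreal_0I)
  fix e :: real assume e: "e > 0"
  note [measurable] = mollifier_borel[OF m]
  \<comment> \<open>Three errors of size e' are collected by two splittings; the first costs a
    factor 2^p on everything, the second another 2^p on two of the errors.\<close>
  define e' where "e' = e / (2 powr p * (1 + 2 powr p * 2))"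
  have e': "e' > 0" using e by (simp add: e'_def add_pos_pos)
  have li: "loc_int f"
    using p fin by (intro powr_integrable_loc_int) (auto intro: le_less_trans[OF nn_set_integral_le])
  obtain g r where g: "continuous_on UNIV g" "\<And>x. norm x > r \<Longrightarrow> g x = 0"
    "(\<integral>\<^sup>+x. ennreal (\<bar>f x - g x\<bar> powr p) \<partial>lborel) \<le> ennreal e'"
    using Lp_dense_continuous[OF assms(1) p fin e'] by blast
  have [measurable]: "g \<in> borel_measurable borel" by (rule borel_measurable_continuous_onI[OF g(1)])
  have lg: "loc_int g" by (rule loc_int_continuous[OF g(1)])
  have cm [measurable]: "conv g (\<rho> n) \<in> borel_measurable borel"
      "conv (\<lambda>x. f x - g x) (\<rho> n) \<in> borel_measurable borel" for n
    by (auto intro!: borel_measurable_conv m)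
  define V where "V = measure lborel (cball (0::real^'n) (r + 1))"
  \<comment> \<open>A uniform error \<eta> on a ball of volume V contributes \<eta>^p V; V + 1 keeps
    the denominator positive.\<close>
  define \<eta> where "\<eta> = (e' / (V + 1)) powr (1 / p)"
  have V: "V \<ge> 0" by (simp add: V_def)
  then have \<eta>: "\<eta> > 0" using e' by (simp add: \<eta>_def)
  have \<eta>V: "\<eta> powr p * V \<le> e'"
    using p e' V by (simp add: \<eta>_def powr_powr field_simps)
  obtain \<delta> where \<delta>: "\<delta> > 0" "\<And>x y. norm (x - y) < \<delta> \<Longrightarrow> \<bar>g x - g y\<bar> < \<eta>"
    using uniformly_continuous_bounded_support[OF g(1,2) \<eta>] by (metis real_norm_def)
  have "\<forall>\<^sub>F n in sequentially. inverse (real (Suc n)) < \<delta>"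
    using order_tendstoD(2)[OF LIMSEQ_inverse_real_of_nat \<delta>(1)] .
  then show "\<forall>\<^sub>F n in sequentially. (\<integral>\<^sup>+x. ennreal (\<bar>conv f (\<rho> n) x - f x\<bar> powr p) \<partial>lborel) \<le> ennreal e"
  proof eventually_elim
    case (elim n)
    have near: "\<bar>conv g (\<rho> n) x - g x\<bar> \<le> \<eta>" for x
    proof -
      have "g x - \<eta> \<le> g y \<and> g y \<le> g x + \<eta>" if "norm (x - y) < inverse (real (Suc n))" for y
        using \<delta>(2)[of x y] that elim by auto
      then have "AE y in lborel. norm (x - y) < inverse (real (Suc n)) \<longrightarrow> g x - \<eta> \<le> g y \<and> g y \<le> g x + \<eta>"
        by auto
      from conv_bounds[OF m lg this] show ?thesis by auto
    qed
    have out: "conv g (\<rho> n) x = 0" if "norm x > r + 1" for x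
    proof -
      have "g y = 0" if "norm (x - y) < inverse (real (Suc n))" for y
      proof -
        have "inverse (real (Suc n)) \<le> 1" by (simp add: field_simps)
        then show ?thesis using that \<open>norm x > r + 1\<close> norm_triangle_ineq2[of x y] by (intro g) auto
      qed
      then have "AE y in lborel. norm (x - y) < inverse (real (Suc n)) \<longrightarrow> 0 \<le> g y \<and> g y \<le> 0"
        by auto
      from conv_bounds[OF m lg this] show ?thesis by auto
    qed
    have "(\<integral>\<^sup>+x. ennreal (\<bar>conv g (\<rho> n) x - g x\<bar> powr p) \<partial>lborel)
        \<le> (\<integral>\<^sup>+x. ennreal (\<eta> powr p) * indicator (cball (0::real^'n) (r + 1)) x \<partial>lborel)"
    proof (rule nn_integral_mono)
      fix x :: "real^'n"
      show "ennreal (\<bar>conv g (\<rho> n) x - g x\<bar> powr p) \<le> ennreal (\<eta> powr p) * indicator (cball 0 (r + 1)) x"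
        using near[of x] out[of x] g(2)[of x] p
        by (cases "norm x \<le> r + 1") (auto intro!: ennreal_leI powr_mono2)
    qed
    also have "\<dots> = ennreal (\<eta> powr p) * emeasure lborel (cball (0::real^'n) (r + 1))"
      by (simp add: nn_integral_cmult_indicator)
    also have "\<dots> = ennreal (\<eta> powr p * V)"
      using V emeasure_bounded_finite[of "cball (0::real^'n) (r + 1)"]
      by (simp add: V_def ennreal_mult measure_def)
    also have "\<dots> \<le> ennreal e'" using \<eta>V by (rule ennreal_leI)
    finally have T2: "(\<integral>\<^sup>+x. ennreal (\<bar>conv g (\<rho> n) x - g x\<bar> powr p) \<partial>lborel) \<le> ennreal e'" .
    have T1: "(\<integral>\<^sup>+x. ennreal (\<bar>conv (\<lambda>x. f x - g x) (\<rho> n) x\<bar> powr p) \<partial>lborel) \<le> ennreal e'"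
      using conv_contraction[OF _ m p loc_int_diff[OF li lg], of n] g(3) by simp
    have T3: "(\<integral>\<^sup>+x. ennreal (\<bar>g x - f x\<bar> powr p) \<partial>lborel) \<le> ennreal e'"
      using g(3) by (simp add: abs_minus_commute)
    have "(\<integral>\<^sup>+x. ennreal (\<bar>conv f (\<rho> n) x - f x\<bar> powr p) \<partial>lborel)
      = (\<integral>\<^sup>+x. ennreal (norm (conv (\<lambda>x. f x - g x) (\<rho> n) x + ((conv g (\<rho> n) x - g x) + (g x - f x))) powr p) \<partial>lborel)"
      by (simp add: conv_diff[OF li lg m])
    also have "\<dots> \<le> ennreal (2 powr p) * ((\<integral>\<^sup>+x. ennreal (norm (conv (\<lambda>x. f x - g x) (\<rho> n) x) powr p) \<partial>lborel)
       + (\<integral>\<^sup>+x. ennreal (norm ((conv g (\<rho> n) x - g x) + (g x - f x)) powr p) \<partial>lborel))"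
      using p by (intro nn_integral_powr_add_le) auto
    also have "\<dots> \<le> ennreal (2 powr p) * ((\<integral>\<^sup>+x. ennreal (norm (conv (\<lambda>x. f x - g x) (\<rho> n) x) powr p) \<partial>lborel)
       + ennreal (2 powr p) * ((\<integral>\<^sup>+x. ennreal (norm (conv g (\<rho> n) x - g x) powr p) \<partial>lborel) +
       (\<integral>\<^sup>+x. ennreal (norm (g x - f x) powr p) \<partial>lborel)))"
      using p by (intro mult_left_mono add_left_mono nn_integral_powr_add_le) auto
    also have "\<dots> \<le> ennreal (2 powr p) * (ennreal e' + ennreal (2 powr p) * (ennreal e' + ennreal e'))"
      using T1 T2 T3 by (intro mult_left_mono add_mono) auto
    also have "\<dots> = ennreal e"
    proof -
      have "2 powr p * (e' + 2 powr p * (e' + e')) = e' * (2 powr p * (1 + 2 powr p * 2))"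
        by (simp add: algebra_simps)
      also have "\<dots> = e" using add_pos_pos[of 1 "2 powr p * 2"] by (simp add: e'_def)
      finally show ?thesis using e' by (simp flip: ennreal_mult ennreal_plus)
    qed
    finally show ?case .
  qed
qed

section \<open>Derivatives of convolutions and smooth approximation\<close>

lemma test_function_partial: 
  assumes "test_function \<psi>"
  shows "test_function (partial_deriv i \<psi>)"
proof -
  obtain r where "\<And>x. norm x > r \<Longrightarrow> \<psi> x = 0"
    using test_function_support[OF assms] by blast
  then have "differential \<psi> x = 0" if "norm x > r" for x
    using differential_outside that by blast
  then show ?thesis
    using smooth_partial[OF test_function_smooth[OF assms]]
    by (intro test_functionI[of _ r]) (auto simp: differential_def vec_eq_iff)
qed

text \<open>Differentiation under the integral: the first-order Taylor remainder of \<kappa> is at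
  most \<eta> |h| uniformly, because its gradient is uniformly continuous, and only the finite mass
  of |f| on a ball enters.\<close>

lemma has_derivative_conv:
  fixes f :: "real^'n::finite \<Rightarrow> real"
  assumes f: "loc_int f" and t: "test_function \<kappa>"
  shows "(conv f \<kappa> has_derivative (\<lambda>h. (\<chi> i. conv f (partial_deriv i \<kappa>) x) \<bullet> h)) (at x)"
  unfolding has_derivative_at_alt
proof (intro conjI allI impI bounded_linear_inner_right)
  fix e :: real assume e: "e > 0"
  note sm = test_function_smooth[OF t]
  obtain R where R: "R > 0" "\<And>x. norm x > R \<Longrightarrow> \<kappa> x = 0"
    using test_function_support[OF t] by blast
  have R': "differential \<kappa> x = 0" if "norm x > R" for x
    by (rule differential_outside[OF R(2) that])
  \<comment> \<open>For |h| < 1 and y outside \<open>B\<close>, the values of \<kappa> at x - y and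
    x + h - y and the differential at x - y all vanish.\<close>
  define B where "B = cball (0::real^'n) (norm x + R + 1)"
  have fB: "integrable lborel (\<lambda>y. indicator B y * \<bar>f y\<bar>)"
    using integrable_abs[of lborel "\<lambda>y. indicator B y * f y"] f
    by (simp add: loc_int_def set_integrable_def B_def abs_mult)
  define M where "M = (\<integral>y. indicator B y * \<bar>f y\<bar> \<partial>lborel)"
  have M: "M \<ge> 0" unfolding M_def by simp
  define \<eta> where "\<eta> = e / (M + 1)"
  have \<eta>: "\<eta> > 0" "M * \<eta> \<le> e" using M e by (auto simp: \<eta>_def field_simps)
  obtain \<delta> where \<delta>: "\<delta> > 0" "\<And>y z. norm (y - z) < \<delta> \<Longrightarrow> norm (differential \<kappa> y - differential \<kappa> z) < \<eta>"
    using uniformly_continuous_bounded_support[OF smooth_differential_continuous[OF sm] R' \<eta>(1)] by blast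
  have taylor: "\<bar>\<kappa> (z + h) - \<kappa> z - differential \<kappa> z \<bullet> h\<bar> \<le> \<eta> * norm h" if "norm h < \<delta>" for z h
  proof -
    \<comment> \<open>The mean value inequality for \<kappa> minus its linearisation at z, whose
      derivative is below \<eta> on the ball of radius \<delta>.\<close>
    have "norm ((\<kappa> (z + h) - differential \<kappa> z \<bullet> (z + h)) - (\<kappa> z - differential \<kappa> z \<bullet> z)) \<le> \<eta> * norm (z + h - z)"
    proof (rule differentiable_bound[where S="ball z \<delta>" and f' = "\<lambda>u k. (differential \<kappa> u - differential \<kappa> z) \<bullet> k"])
      fix u assume u: "u \<in> ball z \<delta>"
      show "((\<lambda>a. \<kappa> a - differential \<kappa> z \<bullet> a) has_derivative (\<lambda>k. (differential \<kappa> u - differential \<kappa> z) \<bullet> k)) (at u within ball z \<delta>)"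
        using has_derivative_diff[OF smooth_has_derivative[OF sm]
            bounded_linear_imp_has_derivative[OF bounded_linear_inner_right]]
        unfolding inner_diff_left by (rule has_derivative_at_withinI)
      show "onorm (\<lambda>k. (differential \<kappa> u - differential \<kappa> z) \<bullet> k) \<le> \<eta>"
      proof (rule onorm_le)
        fix k
        have "norm ((differential \<kappa> u - differential \<kappa> z) \<bullet> k) \<le> norm (differential \<kappa> u - differential \<kappa> z) * norm k"
          by (simp add: Cauchy_Schwarz_ineq2)
        also have "\<dots> \<le> \<eta> * norm k"
          using \<delta>(2)[of u z] u by (intro mult_right_mono) (auto simp: dist_norm norm_minus_commute)
        finally show "norm ((differential \<kappa> u - differential \<kappa> z) \<bullet> k) \<le> \<eta> * norm k" .
      qed
    qed (use that \<delta> in \<open>auto simp: dist_norm\<close>)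
    then show ?thesis by (simp add: inner_add_right)
  qed
  have i\<kappa>: "integrable lborel (\<lambda>y. f y * \<kappa> (u - y))" for u
    by (rule loc_int_mult_test[OF f test_function_reflect[OF t]])
  have ip: "integrable lborel (\<lambda>y. f y * partial_deriv i \<kappa> (u - y))" for u i
    by (rule loc_int_mult_test[OF f test_function_reflect[OF test_function_partial[OF t]]])
  have dot: "f y * (differential \<kappa> (x - y) \<bullet> h) = (\<Sum>i\<in>UNIV. h $ i * (f y * partial_deriv i \<kappa> (x - y)))" for h y
    by (simp add: inner_vec_def differential_def sum_distrib_left mult_ac)
  have id: "integrable lborel (\<lambda>y. f y * (differential \<kappa> (x - y) \<bullet> h))" for h
    unfolding dot by (intro Bochner_Integration.integrable_sum integrable_mult_right ip)
  have lin: "(\<chi> i. conv f (partial_deriv i \<kappa>) x) \<bullet> h = (\<integral>y. f y * (differential \<kappa> (x - y) \<bullet> h) \<partial>lborel)" for h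
    unfolding dot using ip by (simp add: inner_vec_def conv_def mult.commute)
  show "\<exists>d>0. \<forall>y. norm (y - x) < d \<longrightarrow>
     norm (conv f \<kappa> y - conv f \<kappa> x - (\<chi> i. conv f (partial_deriv i \<kappa>) x) \<bullet> (y - x)) \<le> e * norm (y - x)"
  proof (intro exI[of _ "min \<delta> 1"] conjI allI impI)
    fix u assume u: "norm (u - x) < min \<delta> 1"
    define h where "h = u - x"
    have h: "norm h < \<delta>" "norm h < 1" using u by (auto simp: h_def)
    have "conv f \<kappa> u - conv f \<kappa> x - (\<chi> i. conv f (partial_deriv i \<kappa>) x) \<bullet> (u - x)
      = (\<integral>y. f y * \<kappa> (u - y) - f y * \<kappa> (x - y) - f y * (differential \<kappa> (x - y) \<bullet> h) \<partial>lborel)"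
      unfolding h_def[symmetric] lin unfolding conv_def using i\<kappa> id by simp
    also have "norm \<dots> \<le> (\<integral>y. indicator B y * \<bar>f y\<bar> * (\<eta> * norm h) \<partial>lborel)"
    proof (rule Bochner_Integration.integral_norm_bound_integral)
      fix y
      show "norm (f y * \<kappa> (u - y) - f y * \<kappa> (x - y) - f y * (differential \<kappa> (x - y) \<bullet> h))
         \<le> indicator B y * \<bar>f y\<bar> * (\<eta> * norm h)"
      proof (cases "y \<in> B")
        case True
        have "norm (f y * \<kappa> (u - y) - f y * \<kappa> (x - y) - f y * (differential \<kappa> (x - y) \<bullet> h))
          = \<bar>f y\<bar> * \<bar>\<kappa> ((x - y) + h) - \<kappa> (x - y) - differential \<kappa> (x - y) \<bullet> h\<bar>"
          by (simp add: h_def abs_mult[symmetric] right_diff_distrib)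
        also have "\<dots> \<le> \<bar>f y\<bar> * (\<eta> * norm h)"
          by (intro mult_left_mono taylor h) auto
        finally show ?thesis using True by simp
      next
        case False
        then have y: "norm y > norm x + R + 1" by (simp add: B_def)
        then have "norm (x - y) > R" using norm_triangle_ineq2[of y x] by (simp add: norm_minus_commute)
        moreover have "norm (u - y) > R"
          using y h(2) norm_triangle_ineq2[of y u] norm_triangle_ineq[of x h]
          by (simp add: norm_minus_commute h_def)
        ultimately show ?thesis using R R' False by simp
      qed
    qed (use i\<kappa> id fB in auto)
    also have "\<dots> = M * \<eta> * norm h" by (simp add: M_def)
    also have "\<dots> \<le> e * norm h" using \<eta>(2) by (intro mult_right_mono) auto
    finally show "norm (conv f \<kappa> u - conv f \<kappa> x - (\<chi> i. conv f (partial_deriv i \<kappa>) x) \<bullet> (u - x)) \<le> e * norm (u - x)"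
      by (simp add: h_def)
  qed (use \<delta> in auto)
qed

lemma differential_conv:
  assumes "loc_int f" "test_function \<kappa>"
  shows "differential (conv f \<kappa>) x = (\<chi> i. conv f (partial_deriv i \<kappa>) x)"
  by (rule differential_eq[OF has_derivative_conv[OF assms]])

lemma smooth_conv:
  assumes f: "loc_int f" and t: "test_function \<kappa>"
  shows "smooth (conv f \<kappa>)"
proof -
  have "Ck k (conv f \<kappa>)" if "test_function \<kappa>" for k \<kappa>
    using that
  proof (induction k arbitrary: \<kappa>)
    case 0
    then show ?case
      by (auto intro!: continuous_at_imp_continuous_on has_derivative_continuous[OF has_derivative_conv[OF f]])
  next
    case (Suc k)
    show ?case
      by (rule Ck_SucI[OF has_derivative_conv[OF f Suc.prems]])
         (simp add: Suc.IH test_function_partial Suc.prems)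
  qed
  with t show ?thesis by (simp add: smooth_def)
qed

lemma conv_cong:
  assumes "mollifier e \<rho>" "\<And>y. norm (x - y) < e \<Longrightarrow> f y = g y"
  shows "conv f \<rho> x = conv g \<rho> x"
  unfolding conv_def using assms
  by (intro Bochner_Integration.integral_cong) (auto simp: mollifier_def not_less[symmetric])

lemma powr_sum_le:
  fixes a :: "'i::finite \<Rightarrow> real"
  assumes "p \<ge> 0" "\<And>i. a i \<ge> 0"
  shows "(\<Sum>i\<in>UNIV. a i) powr p \<le> real CARD('i) powr p * (\<Sum>i\<in>UNIV. a i powr p)"
proof -
  obtain j where j: "\<And>i. a i \<le> a j"
  proof -
    have "Max (range a) \<in> range a" by (rule Max_in) auto
    then obtain j where "Max (range a) = a j" by blast
    moreover have "a i \<le> Max (range a)" for i by (rule Max_ge) auto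
    ultimately show ?thesis by (intro that[of j]) simp
  qed
  have "(\<Sum>i\<in>UNIV. a i) \<le> real CARD('i) * a j"
    using sum_bounded_above[of UNIV a "a j"] j by simp
  then have "(\<Sum>i\<in>UNIV. a i) powr p \<le> (real CARD('i) * a j) powr p"
    using assms by (intro powr_mono2 sum_nonneg) auto
  also have "\<dots> = real CARD('i) powr p * a j powr p"
    using assms by (simp add: powr_mult)
  also have "a j powr p \<le> (\<Sum>i\<in>UNIV. a i powr p)"
    by (rule member_le_sum) auto
  finally show ?thesis by (simp add: mult_left_mono)
qed

lemma borel_measurable_vec_nth' [measurable (raw)]:
  fixes f :: "'a \<Rightarrow> real^'n::finite"
  assumes "f \<in> borel_measurable M"
  shows "(\<lambda>x. f x $ i) \<in> borel_measurable M"
  using borel_measurable_inner[OF assms borel_measurable_const[of "axis i 1"]] by (simp add: inner_axis)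

text \<open>Mollification commutes with the weak differential, because \<rho>(x - y) is a test
  function of y. The lower bound \<open>L\<close> is kept at every point of the space, so that
  functions regular only on \<open>{L..}\<close> can be composed with \<open>V n\<close>; the upper
  bound and the convergence are local.\<close>

lemma smooth_approximation:
  fixes v :: "real^'n::finite \<Rightarrow> real" and D :: "real^'n \<Rightarrow> real^'n"
  assumes v [measurable]: "v \<in> borel_measurable borel" and D [measurable]: "D \<in> borel_measurable borel"
    and p: "p \<ge> 1"
    and L: "AE x in lborel. L \<le> v x"
    and bdd: "\<And>r. \<exists>C. AE x in lborel. norm x \<le> r \<longrightarrow> v x \<le> C"
    and fin: "\<And>r. (\<integral>\<^sup>+x\<in>cball 0 r. ennreal (norm (D x) powr p) \<partial>lborel) < \<infinity>"
    and weak: "\<And>\<psi> i. test_function \<psi> \<Longrightarrow>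
      (\<integral>x. v x * partial_deriv i \<psi> x \<partial>lborel) = - (\<integral>x. D x $ i * \<psi> x \<partial>lborel)"
  obtains V M where "\<And>n::nat. smooth (V n)" "\<And>n x. L \<le> V n x"
    "\<And>n x. norm x \<le> r \<Longrightarrow> V n x \<le> M"
    "AE x in lborel. norm x \<le> r \<longrightarrow> (\<lambda>n. V n x) \<longlonglongrightarrow> v x"
    "(\<lambda>n. \<integral>\<^sup>+x\<in>cball 0 r. ennreal (norm (differential (V n) x - D x) powr p) \<partial>lborel) \<longlonglongrightarrow> 0"
proof -
  define \<rho> :: "nat \<Rightarrow> real^'n \<Rightarrow> real" where "\<rho> n = (SOME \<rho>. mollifier (inverse (real (Suc n))) \<rho>)" for n
  have m: "mollifier (inverse (real (Suc n))) (\<rho> n)" for n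
  proof -
    obtain \<rho>' :: "real^'n \<Rightarrow> real" where "mollifier (inverse (real (Suc n))) \<rho>'"
      by (rule mollifier_exists[of "inverse (real (Suc n))"]) auto
    then show ?thesis unfolding \<rho>_def by (rule someI[of "mollifier (inverse (real (Suc n)))"])
  qed
  have t: "test_function (\<rho> n)" for n using m by (simp add: mollifier_def)
  have le1: "inverse (real (Suc n)) \<le> 1" for n by (simp add: field_simps)
  define Q where "Q = cball (0::real^'n) (r + 1)"
  have [measurable]: "Q \<in> sets borel" by (simp add: Q_def)
  have near: "y \<in> Q" if "norm (x - y) < inverse (real (Suc n))" "norm x \<le> r" for x y n
    using that le1[of n] norm_triangle_ineq2[of y x] by (simp add: Q_def norm_minus_commute)
  have bd: "\<exists>C. AE x in lborel. norm x \<le> s \<longrightarrow> L \<le> v x \<and> v x \<le> C" for s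
  proof -
    obtain C where "AE x in lborel. norm x \<le> s \<longrightarrow> v x \<le> C" using bdd by blast
    with L have "AE x in lborel. norm x \<le> s \<longrightarrow> L \<le> v x \<and> v x \<le> C" by eventually_elim auto
    then show ?thesis by blast
  qed
  have fin1: "(\<integral>\<^sup>+x\<in>cball 0 s. ennreal (\<bar>v x\<bar> powr 1) \<partial>lborel) < \<infinity>" for s
  proof -
    obtain C where C: "AE x in lborel. norm x \<le> s \<longrightarrow> L \<le> v x \<and> v x \<le> C" using bd by blast
    have "(\<integral>\<^sup>+x\<in>cball 0 s. ennreal (\<bar>v x\<bar> powr 1) \<partial>lborel)
      \<le> (\<integral>\<^sup>+x. ennreal (max \<bar>L\<bar> \<bar>C\<bar>) * indicator (cball (0::real^'n) s) x \<partial>lborel)"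
      using C by (intro nn_integral_mono_AE, eventually_elim) (auto simp: indicator_def intro!: ennreal_leI)
    also have "\<dots> < \<infinity>" using emeasure_bounded_finite[of "cball (0::real^'n) s"]
      by (simp add: nn_integral_cmult_indicator ennreal_mult_less_top)
    finally show ?thesis .
  qed
  have li: "loc_int v" by (rule powr_integrable_loc_int[OF v _ fin1]) simp
  have lD: "loc_int (\<lambda>x. D x $ i)" for i
  proof (rule powr_integrable_loc_int[OF _ p])
    show "(\<integral>\<^sup>+x\<in>cball 0 s. ennreal (\<bar>D x $ i\<bar> powr p) \<partial>lborel) < \<infinity>" for s
      using p by (intro le_less_trans[OF nn_integral_mono fin[of s]])
        (auto simp: indicator_def intro!: ennreal_leI powr_mono2 component_le_norm_cart)
  qed measurable
  \<comment> \<open>\<open>mollify_Lp\<close> is global, so \<open>v\<close> and \<open>D\<close>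
    are cut off outside a ball one unit larger; mollifiers of radius at most 1 do not see the
    difference on the ball of radius r.\<close>
  define f where "f x = v x * indicator Q x" for x
  define F where "F i x = D x $ i * indicator Q x" for i x
  have [measurable]: "f \<in> borel_measurable borel" "F i \<in> borel_measurable borel" for i
    unfolding f_def[abs_def] F_def[abs_def] by measurable
  have lim_f: "(\<lambda>n. \<integral>\<^sup>+x. ennreal (\<bar>conv f (\<rho> n) x - f x\<bar> powr 1) \<partial>lborel) \<longlonglongrightarrow> 0"
    (is "?I \<longlonglongrightarrow> 0")
  proof (rule mollify_Lp[OF _ _ _ m])
    have "(\<integral>\<^sup>+x. ennreal (\<bar>f x\<bar> powr 1) \<partial>lborel) = (\<integral>\<^sup>+x\<in>Q. ennreal (\<bar>v x\<bar> powr 1) \<partial>lborel)"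
      by (intro nn_integral_cong) (auto simp: f_def indicator_def)
    then show "(\<integral>\<^sup>+x. ennreal (\<bar>f x\<bar> powr 1) \<partial>lborel) < \<infinity>" using fin1[of "r + 1"] by (simp add: Q_def)
  qed auto
  have lim_F: "(\<lambda>n. \<integral>\<^sup>+x. ennreal (\<bar>conv (F i) (\<rho> n) x - F i x\<bar> powr p) \<partial>lborel) \<longlonglongrightarrow> 0" for i
  proof (rule mollify_Lp[OF _ p _ m])
    have "(\<integral>\<^sup>+x. ennreal (\<bar>F i x\<bar> powr p) \<partial>lborel) \<le> (\<integral>\<^sup>+x\<in>Q. ennreal (norm (D x) powr p) \<partial>lborel)"
      using p by (intro nn_integral_mono)
        (auto simp: F_def indicator_def intro!: ennreal_leI powr_mono2 component_le_norm_cart)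
    then show "(\<integral>\<^sup>+x. ennreal (\<bar>F i x\<bar> powr p) \<partial>lborel) < \<infinity>" using fin[of "r + 1"] by (auto simp: Q_def)
  qed auto
  have cf [measurable]: "conv f (\<rho> n) \<in> borel_measurable borel" "conv (F i) (\<rho> n) \<in> borel_measurable borel" for n i
    by (auto intro!: borel_measurable_conv m)
  have "\<forall>\<^sub>F n in sequentially. ?I n < \<infinity>"
    using order_tendstoD(2)[OF lim_f, of \<infinity>] by simp
  \<comment> \<open>Convergence to 0 does not exclude infinite initial terms. They are dropped so
    that the differences are integrable before an almost everywhere convergent subsequence is
    extracted.\<close>
  then obtain N where N: "\<And>n. n \<ge> N \<Longrightarrow> ?I n < \<infinity>"
    unfolding eventually_sequentially by blast
  have int: "integrable lborel (\<lambda>x. conv f (\<rho> (n + N)) x - f x)" for n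
    using N[of "n + N"] by (intro integrableI_bounded) auto
  have "(\<lambda>n. ?I (n + N)) \<longlonglongrightarrow> 0" using LIMSEQ_ignore_initial_segment[OF lim_f] .
  moreover have "?I (n + N) = ennreal (\<integral>x. norm (conv f (\<rho> (n + N)) x - f x) \<partial>lborel)" for n
    using int[of n] by (subst nn_integral_eq_integral[symmetric]) auto
  ultimately have "(\<lambda>n. ennreal (\<integral>x. norm (conv f (\<rho> (n + N)) x - f x) \<partial>lborel)) \<longlonglongrightarrow> ennreal 0" by simp
  then have "(\<lambda>n. \<integral>x. norm (conv f (\<rho> (n + N)) x - f x) \<partial>lborel) \<longlonglongrightarrow> 0"
    by (subst (asm) tendsto_ennreal_iff) auto
  from tendsto_L1_AE_subseq[OF int this] obtain s where s: "strict_mono s"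
    "AE x in lborel. (\<lambda>n. conv f (\<rho> (s n + N)) x - f x) \<longlonglongrightarrow> 0" by blast
  define q where "q n = s n + N" for n
  have q: "strict_mono q" using s(1) by (simp add: q_def strict_mono_def)
  define V where "V n = conv v (\<rho> (q n))" for n
  have dV: "differential (V n) x $ i = conv (\<lambda>x. D x $ i) (\<rho> (q n)) x" for n x i
  proof -
    let ?\<psi> = "\<lambda>y. \<rho> (q n) (x - y)"
    \<comment> \<open>The sign from the reflection cancels the sign in the definition of the weak
      differential.\<close>
    have "partial_deriv i ?\<psi> y = - partial_deriv i (\<rho> (q n)) (x - y)" for y
    proof -
      have "(?\<psi> has_derivative (\<lambda>h. differential (\<rho> (q n)) (x - y) \<bullet> (- h))) (at y)"
        by (rule has_derivative_compose[of "\<lambda>y. x - y", OF _ smooth_has_derivative[OF test_function_smooth[OF t]]])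
           (auto intro!: derivative_eq_intros)
      from partial_deriv_eq[OF this, of i] show ?thesis by (simp add: inner_axis differential_def)
    qed
    then show ?thesis
      using weak[OF test_function_reflect[OF t], of i "q n" x]
      by (simp add: V_def differential_conv[OF li t]) (simp add: conv_def)
  qed
  obtain C where C: "AE x in lborel. norm x \<le> r + 1 \<longrightarrow> L \<le> v x \<and> v x \<le> C" using bd by blast
  show ?thesis
  proof (rule that)
    show "smooth (V n)" for n unfolding V_def by (rule smooth_conv[OF li t])
    show "L \<le> V n x" for n x
    proof -
      obtain C where "AE y in lborel. norm y \<le> norm x + 1 \<longrightarrow> L \<le> v y \<and> v y \<le> C" using bd by blast
      then have "AE y in lborel. norm (x - y) < inverse (real (Suc (q n))) \<longrightarrow> L \<le> v y \<and> v y \<le> C"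
        by eventually_elim (use le1[of "q n"] norm_triangle_ineq2 in \<open>smt (verit) norm_minus_commute\<close>)
      from conv_bounds(1)[OF m li this] show ?thesis by (simp add: V_def)
    qed
    show "V n x \<le> C" if "norm x \<le> r" for n x
    proof -
      have "AE y in lborel. norm (x - y) < inverse (real (Suc (q n))) \<longrightarrow> L \<le> v y \<and> v y \<le> C"
        using C by eventually_elim (use near[OF _ that] in \<open>auto simp: Q_def\<close>)
      from conv_bounds(2)[OF m li this] show ?thesis by (simp add: V_def)
    qed
    show "AE x in lborel. norm x \<le> r \<longrightarrow> (\<lambda>n. V n x) \<longlonglongrightarrow> v x"
      using s(2)
    proof eventually_elim
      case (elim x)
      show ?case
      proof
        assume x: "norm x \<le> r"
        then have "f x = v x" by (simp add: f_def Q_def)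
        moreover have "conv f (\<rho> (s n + N)) x = V n x" for n
          unfolding V_def q_def
          by (rule conv_cong[OF m], drule near[OF _ x]) (simp add: f_def)
        ultimately show "(\<lambda>n. V n x) \<longlonglongrightarrow> v x" using elim LIM_zero_cancel by fastforce
      qed
    qed
    let ?J = "\<lambda>n i. \<integral>\<^sup>+x. ennreal (\<bar>conv (F i) (\<rho> (q n)) x - F i x\<bar> powr p) \<partial>lborel"
    show "(\<lambda>n. \<integral>\<^sup>+x\<in>cball 0 r. ennreal (norm (differential (V n) x - D x) powr p) \<partial>lborel) \<longlonglongrightarrow> 0"
    proof (rule tendsto_sandwich[OF always_eventually always_eventually tendsto_const, OF allI allI])
      fix n
      have le: "ennreal (norm (differential (V n) x - D x) powr p) * indicator (cball 0 r) x \<le>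
        ennreal (real CARD('n) powr p) * (\<Sum>i\<in>UNIV. ennreal (\<bar>conv (F i) (\<rho> (q n)) x - F i x\<bar> powr p))" for x
      proof (cases "norm x \<le> r")
        case True
        have e: "(differential (V n) x - D x) $ i = conv (F i) (\<rho> (q n)) x - F i x" for i
        proof -
          have "F i x = D x $ i" using True by (simp add: F_def Q_def)
          moreover have "conv (F i) (\<rho> (q n)) x = conv (\<lambda>x. D x $ i) (\<rho> (q n)) x"
            by (rule conv_cong[OF m], drule near[OF _ True]) (simp add: F_def)
          ultimately show ?thesis by (simp add: dV)
        qed
        have "norm (differential (V n) x - D x) \<le> (\<Sum>i\<in>UNIV. \<bar>conv (F i) (\<rho> (q n)) x - F i x\<bar>)"
          using norm_le_l1_cart[of "differential (V n) x - D x"] unfolding e .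
        then have "norm (differential (V n) x - D x) powr p \<le> (\<Sum>i\<in>UNIV. \<bar>conv (F i) (\<rho> (q n)) x - F i x\<bar>) powr p"
          using p by (intro powr_mono2) auto
        also have "\<dots> \<le> real CARD('n) powr p * (\<Sum>i\<in>UNIV. \<bar>conv (F i) (\<rho> (q n)) x - F i x\<bar> powr p)"
          using p by (intro powr_sum_le) auto
        finally show ?thesis using True
          by (auto simp: ennreal_mult[symmetric] sum_nonneg intro!: ennreal_leI)
      qed simp
      have "(\<integral>\<^sup>+x\<in>cball 0 r. ennreal (norm (differential (V n) x - D x) powr p) \<partial>lborel) \<le>
        (\<integral>\<^sup>+x. ennreal (real CARD('n) powr p) * (\<Sum>i\<in>UNIV. ennreal (\<bar>conv (F i) (\<rho> (q n)) x - F i x\<bar> powr p)) \<partial>lborel)"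
        by (intro nn_integral_mono le)
      also have "\<dots> = ennreal (real CARD('n) powr p) * (\<Sum>i\<in>UNIV. ?J n i)"
        by (simp add: nn_integral_cmult nn_integral_sum del: sum_ennreal)
      finally show "(\<integral>\<^sup>+x\<in>cball 0 r. ennreal (norm (differential (V n) x - D x) powr p) \<partial>lborel) \<le>
         ennreal (real CARD('n) powr p) * (\<Sum>i\<in>UNIV. ?J n i)" .
    next
      have J: "(\<lambda>n. ?J n i) \<longlonglongrightarrow> 0" for i
        using LIMSEQ_subseq_LIMSEQ[OF lim_F[of i] q] by (simp add: comp_def)
      have "(\<lambda>n. \<Sum>i\<in>UNIV. ?J n i) \<longlonglongrightarrow> (\<Sum>i\<in>(UNIV::'n set). 0)"
        by (intro tendsto_sum J)
      then have "(\<lambda>n. ennreal (real CARD('n) powr p) * (\<Sum>i\<in>UNIV. ?J n i)) \<longlonglongrightarrow> ennreal (real CARD('n) powr p) * (\<Sum>i\<in>(UNIV::'n set). 0)"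
        by (intro ennreal_tendsto_cmult) auto
      then show "(\<lambda>n. ennreal (real CARD('n) powr p) * (\<Sum>i\<in>UNIV. ?J n i)) \<longlonglongrightarrow> 0"
        by simp
    qed auto
  qed
qed

section \<open>Convergence in the p-norm\<close>

text \<open>The p-th power of the distance, kept as an extended nonnegative integral. Membership in
  L^p is not built in, so finiteness of the limit appears as a separate hypothesis where it is
  used.\<close>

definition tendsto_Lp :: "real \<Rightarrow> 'a measure \<Rightarrow> (nat \<Rightarrow> 'a \<Rightarrow> 'b::real_normed_vector) \<Rightarrow> ('a \<Rightarrow> 'b) \<Rightarrow> bool" where
  "tendsto_Lp p M X Y \<longleftrightarrow> (\<lambda>n. \<integral>\<^sup>+x. ennreal (norm (X n x - Y x) powr p) \<partial>M) \<longlonglongrightarrow> 0"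

lemma tendsto_0_le_ennreal:
  fixes f g :: "nat \<Rightarrow> ennreal"
  assumes "g \<longlonglongrightarrow> 0" "\<And>n. f n \<le> g n"
  shows "f \<longlonglongrightarrow> 0"
  by (rule tendsto_sandwich[OF _ _ tendsto_const assms(1)]) (use assms(2) in auto)

lemma tendsto_Lp_add:
  fixes X X' :: "nat \<Rightarrow> 'a \<Rightarrow> 'b::{real_normed_vector,second_countable_topology}"
  assumes [measurable]: "\<And>n. X n \<in> borel_measurable M" "\<And>n. X' n \<in> borel_measurable M"
    "Y \<in> borel_measurable M" "Y' \<in> borel_measurable M"
    and "p \<ge> 0" "tendsto_Lp p M X Y" "tendsto_Lp p M X' Y'"
  shows "tendsto_Lp p M (\<lambda>n x. X n x + X' n x) (\<lambda>x. Y x + Y' x)"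
  unfolding tendsto_Lp_def
proof (rule tendsto_0_le_ennreal)
  show "(\<lambda>n. ennreal (2 powr p) * ((\<integral>\<^sup>+x. ennreal (norm (X n x - Y x) powr p) \<partial>M) +
     (\<integral>\<^sup>+x. ennreal (norm (X' n x - Y' x) powr p) \<partial>M))) \<longlonglongrightarrow> 0"
    using ennreal_tendsto_cmult[OF _ tendsto_add[OF assms(6,7)[unfolded tendsto_Lp_def]], of "ennreal (2 powr p)"]
    by simp
  show "(\<integral>\<^sup>+x. ennreal (norm (X n x + X' n x - (Y x + Y' x)) powr p) \<partial>M) \<le>
    ennreal (2 powr p) * ((\<integral>\<^sup>+x. ennreal (norm (X n x - Y x) powr p) \<partial>M) +
     (\<integral>\<^sup>+x. ennreal (norm (X' n x - Y' x) powr p) \<partial>M))" for n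
    using nn_integral_powr_add_le[of "\<lambda>x. X n x - Y x" M "\<lambda>x. X' n x - Y' x" p] assms(5)
    by (simp add: add_diff_add)
qed

text \<open>Split as a_n (X_n - Y) + (a_n - b) Y: uniform boundedness handles the first term,
  dominated convergence with majorant (2|C|)^p |Y|^p the second.\<close>

lemma tendsto_Lp_scaleR:
  fixes X :: "nat \<Rightarrow> 'a \<Rightarrow> 'b::{real_normed_vector,second_countable_topology}"
    and a :: "nat \<Rightarrow> 'a \<Rightarrow> real"
  assumes [measurable]: "\<And>n. X n \<in> borel_measurable M" "Y \<in> borel_measurable M"
    "\<And>n. a n \<in> borel_measurable M" "b \<in> borel_measurable M"
    and p: "p > 0" and lim: "tendsto_Lp p M X Y"
    and fin: "(\<integral>\<^sup>+x. ennreal (norm (Y x) powr p) \<partial>M) < \<infinity>"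
    and C: "AE x in M. \<forall>n. \<bar>a n x\<bar> \<le> C" and ab: "AE x in M. (\<lambda>n. a n x) \<longlonglongrightarrow> b x"
  shows "tendsto_Lp p M (\<lambda>n x. a n x *\<^sub>R X n x) (\<lambda>x. b x *\<^sub>R Y x)"
  unfolding tendsto_Lp_def
proof (rule tendsto_0_le_ennreal)
  let ?A = "\<lambda>n. \<integral>\<^sup>+x. ennreal (norm (X n x - Y x) powr p) \<partial>M"
  let ?B = "\<lambda>n. \<integral>\<^sup>+x. ennreal (norm ((a n x - b x) *\<^sub>R Y x) powr p) \<partial>M"
  have B: "?B \<longlonglongrightarrow> (\<integral>\<^sup>+x. 0 \<partial>M)"
  proof (rule nn_integral_dominated_convergence[where w="\<lambda>x. ennreal ((2 * \<bar>C\<bar>) powr p) * ennreal (norm (Y x) powr p)"])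
    show "AE x in M. ennreal (norm ((a n x - b x) *\<^sub>R Y x) powr p) \<le>
      ennreal ((2 * \<bar>C\<bar>) powr p) * ennreal (norm (Y x) powr p)" for n
      using C ab
    proof eventually_elim
      case (elim x)
      then have "\<bar>b x\<bar> \<le> C" using tendsto_rabs LIMSEQ_le_const2 by blast
      then have "\<bar>a n x - b x\<bar> \<le> 2 * \<bar>C\<bar>" using elim(1)[rule_format, of n] by linarith
      then have "(\<bar>a n x - b x\<bar> * norm (Y x)) powr p \<le> (2 * \<bar>C\<bar> * norm (Y x)) powr p"
        using p by (intro powr_mono2 mult_right_mono) auto
      then show ?case by (auto simp: powr_mult ennreal_mult[symmetric] intro!: ennreal_leI)
    qed
    show "AE x in M. (\<lambda>n. ennreal (norm ((a n x - b x) *\<^sub>R Y x) powr p)) \<longlonglongrightarrow> 0"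
      using ab
    proof eventually_elim
      case (elim x)
      have "(\<lambda>n. norm ((a n x - b x) *\<^sub>R Y x) powr p) \<longlonglongrightarrow> norm ((b x - b x) *\<^sub>R Y x) powr p"
        using p by (intro tendsto_powr2 tendsto_intros elim) auto
      then show ?case using p by (auto intro!: tendsto_ennrealI[of _ 0, simplified])
    qed
    show "(\<integral>\<^sup>+ x. ennreal ((2 * \<bar>C\<bar>) powr p) * ennreal (norm (Y x) powr p) \<partial>M) < \<infinity>"
      using fin by (simp add: nn_integral_cmult ennreal_mult_less_top)
  qed auto
  have A: "?A \<longlonglongrightarrow> 0" using lim by (simp add: tendsto_Lp_def)
  have "(\<lambda>n. ennreal (\<bar>C\<bar> powr p) * ?A n) \<longlonglongrightarrow> ennreal (\<bar>C\<bar> powr p) * 0"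
    by (rule ennreal_tendsto_cmult[OF _ A]) simp
  then show "(\<lambda>n. ennreal (2 powr p) * (ennreal (\<bar>C\<bar> powr p) * ?A n + ?B n)) \<longlonglongrightarrow> 0"
    using ennreal_tendsto_cmult[OF _ tendsto_add[OF _ B], of "ennreal (2 powr p)" "\<lambda>n. ennreal (\<bar>C\<bar> powr p) * ?A n" 0] by simp
  show "(\<integral>\<^sup>+x. ennreal (norm (a n x *\<^sub>R X n x - b x *\<^sub>R Y x) powr p) \<partial>M)
     \<le> ennreal (2 powr p) * (ennreal (\<bar>C\<bar> powr p) * ?A n + ?B n)" for n
  proof -
    have "(\<integral>\<^sup>+x. ennreal (norm (a n x *\<^sub>R X n x - b x *\<^sub>R Y x) powr p) \<partial>M)
      = (\<integral>\<^sup>+x. ennreal (norm (a n x *\<^sub>R (X n x - Y x) + (a n x - b x) *\<^sub>R Y x) powr p) \<partial>M)"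
      by (simp add: algebra_simps)
    also have "\<dots> \<le> ennreal (2 powr p) * ((\<integral>\<^sup>+x. ennreal (norm (a n x *\<^sub>R (X n x - Y x)) powr p) \<partial>M) + ?B n)"
      using p by (intro nn_integral_powr_add_le) auto
    also have "(\<integral>\<^sup>+x. ennreal (norm (a n x *\<^sub>R (X n x - Y x)) powr p) \<partial>M) \<le>
       (\<integral>\<^sup>+x. ennreal (\<bar>C\<bar> powr p) * ennreal (norm (X n x - Y x) powr p) \<partial>M)"
    proof (rule nn_integral_mono_AE)
      show "AE x in M. ennreal (norm (a n x *\<^sub>R (X n x - Y x)) powr p) \<le> ennreal (\<bar>C\<bar> powr p) * ennreal (norm (X n x - Y x) powr p)"
        using C
      proof eventually_elim
        case (elim x)
        have "\<bar>a n x\<bar> powr p \<le> \<bar>C\<bar> powr p" using p elim[rule_format, of n] by (intro powr_mono2) auto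
        then show ?case
          by (auto simp: powr_mult ennreal_mult[symmetric] intro!: ennreal_leI mult_right_mono)
      qed
    qed
    finally show ?thesis by (simp add: nn_integral_cmult mult_left_mono add_right_mono)
  qed
qed

text \<open>In each of the cases \<open>a \<le> s * d\<close> and \<open>s * d < a\<close> one of
  the two terms on the right suffices alone. The free scale \<open>s\<close> allows the terms to be
  balanced afterwards.\<close>

lemma young_scaled:
  fixes d a s p :: real
  assumes "d \<ge> 0" "a \<ge> 0" "s > 0" "p \<ge> 1"
  shows "d powr (p - 1) * a \<le> s * d powr p + s powr (1 - p) * a powr p"
proof (cases "a \<le> s * d")
  case True
  have "d powr (p - 1) * a \<le> d powr (p - 1) * (s * d)" using True by (intro mult_left_mono) auto
  also have "\<dots> = s * d powr p" using assms by (cases "d = 0") (auto simp: powr_diff)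
  finally show ?thesis by (simp add: add_increasing2)
next
  case False
  then have a: "a > 0" using assms by (smt (verit) mult_nonneg_nonneg)
  have "d powr (p - 1) \<le> (a / s) powr (p - 1)"
    using False assms by (intro powr_mono2) (auto simp: field_simps)
  then have "d powr (p - 1) * a \<le> (a / s) powr (p - 1) * a" using a by (intro mult_right_mono) auto
  also have "\<dots> = s powr (1 - p) * a powr p"
    using a assms by (simp add: powr_divide powr_diff field_simps)
  finally show ?thesis using assms by (simp add: add_increasing)
qed

text \<open>The pairing with a field of growth \<open>d\<^bsup>p-1\<^esup>\<close> is continuous for convergence in the p-norm; the scaled
  Young inequality replaces Hoelder's inequality.\<close>

lemma pairing_eq_0:
  fixes X :: "nat \<Rightarrow> 'a \<Rightarrow> 'b::euclidean_space" and d :: "'a \<Rightarrow> real"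
  assumes [measurable]: "\<And>n. X n \<in> borel_measurable M" "Y \<in> borel_measurable M" "F \<in> borel_measurable M"
    "d \<in> borel_measurable M"
    and p: "p \<ge> 1" and lim: "tendsto_Lp p M X Y"
    and fin: "(\<integral>\<^sup>+x. ennreal (norm (Y x) powr p) \<partial>M) < \<infinity>" "(\<integral>\<^sup>+x. ennreal (d x powr p) \<partial>M) < \<infinity>"
    and d: "\<And>x. d x \<ge> 0" "AE x in M. norm (F x) \<le> c * d x powr (p - 1)"
    and zero: "\<And>n. (\<integral>x. F x \<bullet> X n x \<partial>M) = 0"
  shows "integrable M (\<lambda>x. F x \<bullet> Y x)" "(\<integral>x. F x \<bullet> Y x \<partial>M) = 0"
proof -
  define c' where "c' = max c 0"
  have "c * d x powr (p - 1) \<le> c' * d x powr (p - 1)" for x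
    by (rule mult_right_mono) (auto simp: c'_def)
  then have c': "c' \<ge> 0" "AE x in M. norm (F x) \<le> c' * d x powr (p - 1)"
    using d(2) by (auto simp: c'_def elim!: eventually_mono intro: order_trans)
  have bound: "(\<integral>\<^sup>+x. ennreal (norm (F x \<bullet> Z x)) \<partial>M) \<le>
      ennreal (c' * s) * (\<integral>\<^sup>+x. ennreal (d x powr p) \<partial>M) + ennreal (c' * s powr (1 - p)) * (\<integral>\<^sup>+x. ennreal (norm (Z x) powr p) \<partial>M)"
    if [measurable]: "Z \<in> borel_measurable M" and s: "s > 0" for Z s
  proof -
    have "(\<integral>\<^sup>+x. ennreal (norm (F x \<bullet> Z x)) \<partial>M) \<le>
       (\<integral>\<^sup>+x. ennreal (c' * s) * ennreal (d x powr p) + ennreal (c' * s powr (1 - p)) * ennreal (norm (Z x) powr p) \<partial>M)"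
    proof (rule nn_integral_mono_AE)
      show "AE x in M. ennreal (norm (F x \<bullet> Z x)) \<le> ennreal (c' * s) * ennreal (d x powr p) + ennreal (c' * s powr (1 - p)) * ennreal (norm (Z x) powr p)"
        using c'(2)
      proof eventually_elim
        case (elim x)
        have "norm (F x \<bullet> Z x) \<le> norm (F x) * norm (Z x)" by (simp add: Cauchy_Schwarz_ineq2)
        also have "\<dots> \<le> c' * (d x powr (p - 1) * norm (Z x))"
          using elim by (simp add: mult_right_mono flip: mult.assoc)
        also have "\<dots> \<le> c' * (s * d x powr p + s powr (1 - p) * norm (Z x) powr p)"
          using s p c' by (intro mult_left_mono young_scaled d) auto
        finally show ?case
          using s c' by (auto simp: algebra_simps simp flip: ennreal_mult ennreal_plus intro!: ennreal_leI)
      qed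
    qed
    then show ?thesis by (simp add: nn_integral_cmult nn_integral_add)
  qed
  have int: "integrable M (\<lambda>x. F x \<bullet> Z x)" if [measurable]: "Z \<in> borel_measurable M"
     and Z: "(\<integral>\<^sup>+x. ennreal (norm (Z x) powr p) \<partial>M) < \<infinity>" for Z
    using fin(2) Z by (intro integrableI_bounded le_less_trans[OF bound[OF that(1), of 1]])
      (auto simp: ennreal_mult_less_top)
  show intY: "integrable M (\<lambda>x. F x \<bullet> Y x)" by (rule int[OF _ fin(1)]) simp
  let ?d = "\<integral>\<^sup>+x. ennreal (d x powr p) \<partial>M"
  let ?A = "\<lambda>n. \<integral>\<^sup>+x. ennreal (norm (X n x - Y x) powr p) \<partial>M"
  have A: "?A \<longlonglongrightarrow> 0" using lim by (simp add: tendsto_Lp_def)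
  have "\<bar>\<integral>x. F x \<bullet> Y x \<partial>M\<bar> \<le> e" if e: "e > 0" for e :: real
  proof -
    obtain \<delta> where \<delta>: "?d = ennreal \<delta>" "\<delta> \<ge> 0" using fin(2) by (cases ?d) auto
    have frac: "t / (t + 1) \<le> 1" if "t \<ge> 0" for t :: real using that by simp
    \<comment> \<open>The scale \<open>s\<close> makes the energy term at most e/2; only then, with
      \<open>s\<close> fixed, does \<open>k\<close> bound the tolerated distance between
      \<open>X n\<close> and \<open>Y\<close>.\<close>
    define s where "s = e / (2 * (c' * \<delta> + 1))"
    have s: "s > 0" using e \<delta> c' by (auto simp: s_def intro!: divide_pos_pos add_nonneg_pos)
    have sd: "c' * s * \<delta> \<le> e / 2"
    proof -
      have "c' * s * \<delta> = (c' * \<delta>) / (c' * \<delta> + 1) * (e / 2)" by (simp add: s_def mult_ac)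
      also have "\<dots> \<le> 1 * (e / 2)" using \<delta> c' e by (intro mult_right_mono frac) auto
      finally show ?thesis by simp
    qed
    define k where "k = e / (2 * (c' * s powr (1 - p) + 1))"
    have k: "k > 0" using e c' by (auto simp: k_def intro!: divide_pos_pos add_nonneg_pos)
    have kd: "c' * s powr (1 - p) * k \<le> e / 2"
    proof -
      have "c' * s powr (1 - p) * k = (c' * s powr (1 - p)) / (c' * s powr (1 - p) + 1) * (e / 2)" by (simp add: k_def mult_ac)
      also have "\<dots> \<le> 1 * (e / 2)"
        using c' e by (intro mult_right_mono frac) auto
      finally show ?thesis by simp
    qed
    have "\<forall>\<^sub>F n in sequentially. ?A n < ennreal k" using order_tendstoD(2)[OF A, of "ennreal k"] k by simp
    then obtain n where n: "?A n < ennreal k" using eventually_happens by force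
    have intD: "integrable M (\<lambda>x. F x \<bullet> (X n x - Y x))"
      using n by (intro int) (auto intro: less_trans)
    have "integrable M (\<lambda>x. F x \<bullet> (X n x - Y x) + F x \<bullet> Y x)"
      using intD intY by (rule Bochner_Integration.integrable_add)
    then have intX: "integrable M (\<lambda>x. F x \<bullet> X n x)" by (simp add: inner_diff_right)
    have "ennreal \<bar>\<integral>x. F x \<bullet> Y x \<partial>M\<bar> = ennreal \<bar>\<integral>x. F x \<bullet> (X n x - Y x) \<partial>M\<bar>"
      using zero[of n] intX intY by (simp add: inner_diff_right)
    also have "\<dots> \<le> (\<integral>\<^sup>+x. ennreal (norm (F x \<bullet> (X n x - Y x))) \<partial>M)"
      using integral_norm_bound_ennreal[OF intD] by simp
    also have "\<dots> \<le> ennreal (c' * s) * ?d + ennreal (c' * s powr (1 - p)) * ?A n"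
      by (rule bound[OF _ s]) simp
    also have "\<dots> \<le> ennreal (c' * s) * ennreal \<delta> + ennreal (c' * s powr (1 - p)) * ennreal k"
      using n \<delta> by (intro add_mono mult_left_mono) auto
    also have "\<dots> = ennreal (c' * s * \<delta> + c' * s powr (1 - p) * k)"
      using c' s k \<delta> by (simp flip: ennreal_mult ennreal_plus)
    also have "\<dots> \<le> ennreal e" using sd kd by (intro ennreal_leI) linarith
    finally show ?thesis using e by simp
  qed
  from field_le_epsilon[of "\<bar>\<integral>x. F x \<bullet> Y x \<partial>M\<bar>" 0] this show "(\<integral>x. F x \<bullet> Y x \<partial>M) = 0" by simp
qed

section \<open>Morrey's oscillation estimate\<close>

lemma line_integral_bound:
  fixes U :: "real^'n::finite \<Rightarrow> real"
  assumes U: "smooth U" and d: "norm (z - x) \<le> d"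
  shows "ennreal \<bar>U z - U x\<bar> \<le>
    (\<integral>\<^sup>+t. ennreal (d * norm (differential U (x + t *\<^sub>R (z - x)))) * indicator {0..1} t \<partial>lborel)"
proof -
  define g where "g t = differential U (x + t *\<^sub>R (z - x)) \<bullet> (z - x)" for t :: real
  have cd: "continuous_on UNIV (\<lambda>t::real. differential U (x + t *\<^sub>R (z - x)))"
    by (rule continuous_on_compose2[OF smooth_differential_continuous[OF U]]) (auto intro!: continuous_intros)
  then have cg: "isCont g t" for t
    unfolding g_def by (intro continuous_intros) (simp add: continuous_on_eq_continuous_at)
  have "DERIV (\<lambda>t. U (x + t *\<^sub>R (z - x))) t :> g t" for t :: real
  proof -
    have "((\<lambda>t. U (x + t *\<^sub>R (z - x))) has_derivative
      (\<lambda>s. differential U (x + t *\<^sub>R (z - x)) \<bullet> (s *\<^sub>R (z - x)))) (at t)"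
      by (rule has_derivative_compose[of "\<lambda>t. x + t *\<^sub>R (z - x)", OF _ smooth_has_derivative[OF U]])
         (auto intro!: derivative_eq_intros)
    then show ?thesis by (simp add: has_field_derivative_def g_def mult_commute_abs)
  qed
  then have "(\<integral>t. g t * indicator {0..1} t \<partial>lborel) = U (x + 1 *\<^sub>R (z - x)) - U (x + 0 *\<^sub>R (z - x))"
    by (intro integral_FTC_Icc_real) (auto intro: cg)
  then have "ennreal \<bar>U z - U x\<bar> = ennreal \<bar>\<integral>t. g t * indicator {0..1} t \<partial>lborel\<bar>" by simp
  also have "\<dots> \<le> (\<integral>\<^sup>+t. ennreal (norm (g t * indicator {0..1} t)) \<partial>lborel)"
    using integral_norm_bound_ennreal[OF borel_integrable_atLeastAtMost[of 0 1 g]] cg by simp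
  also have "\<dots> \<le> (\<integral>\<^sup>+t. ennreal (d * norm (differential U (x + t *\<^sub>R (z - x)))) * indicator {0..1} t \<partial>lborel)"
  proof (intro nn_integral_mono)
    fix t :: real
    have "\<bar>g t\<bar> \<le> norm (differential U (x + t *\<^sub>R (z - x))) * norm (z - x)"
      unfolding g_def by (rule Cauchy_Schwarz_ineq2)
    also have "\<dots> \<le> norm (differential U (x + t *\<^sub>R (z - x))) * d"
      using d by (intro mult_left_mono) auto
    finally show "ennreal (norm (g t * indicator {0..1} t)) \<le>
      ennreal (d * norm (differential U (x + t *\<^sub>R (z - x)))) * indicator {0..1} t"
      by (auto simp: indicator_def mult.commute intro: ennreal_leI)
  qed
  finally show ?thesis .
qed

text \<open>The bound along segments is integrated over z in \<open>Q\<close>, the order of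
  integration is exchanged, and for each t Young's inequality a \<le> s + s^(1-p) a^p is used with s
  = t^(-\<alpha>). For \<alpha> = n/(p-1) the factor s^(1-p) is t^n, the Jacobian of z \<mapsto> x +
  t(z - x), which maps the convex set \<open>Q\<close> into itself; so the second term stays below
  the integral over \<open>Q\<close>. The first is integrable on [0,1] exactly when \<alpha> < 1,
  that is p > n + 1, with integral (p-1)/(p-1-n).\<close>

lemma morrey_mean:
  fixes U :: "real^'n::finite \<Rightarrow> real"
  assumes U: "smooth U" and Q: "convex Q" "Q \<in> sets borel" and x: "x \<in> Q"
    and d: "d \<ge> 0" "\<And>z. z \<in> Q \<Longrightarrow> norm (z - x) \<le> d" and p: "p > real CARD('n) + 1"
    and I: "(\<integral>\<^sup>+z\<in>Q. ennreal (norm (differential U z) powr p) \<partial>lborel) \<le> ennreal I" "I \<ge> 0"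
  shows "(\<integral>\<^sup>+z\<in>Q. ennreal \<bar>U z - U x\<bar> \<partial>lborel) \<le>
    ennreal ((p - 1) / (p - 1 - real CARD('n))) * emeasure lborel Q + ennreal (d powr p * I)"
proof -
  define g where "g = differential U"
  have [measurable]: "g \<in> borel_measurable borel"
    unfolding g_def by (rule smooth_differential_borel[OF U])
  note [measurable] = Q(2)
  define \<alpha> where "\<alpha> = real CARD('n) / (p - 1)"
  have \<alpha>: "\<alpha> < 1" "\<alpha> > 0" using p by (auto simp: \<alpha>_def)
  have 1: "1 / (- \<alpha> + 1) = (p - 1) / (p - 1 - real CARD('n))"
    using p by (simp add: \<alpha>_def divide_simps)
  define h where "h w = ennreal ((d * norm (g w)) powr p) * indicator Q w" for w
  have [measurable]: "h \<in> borel_measurable borel" unfolding h_def[abs_def] by measurable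
  have hI: "(\<integral>\<^sup>+w. h w \<partial>lborel) \<le> ennreal (d powr p * I)"
  proof -
    have "(\<integral>\<^sup>+w. h w \<partial>lborel) = (\<integral>\<^sup>+w. ennreal (d powr p) * (ennreal (norm (g w) powr p) * indicator Q w) \<partial>lborel)"
      using d(1) by (intro nn_integral_cong) (simp add: h_def powr_mult ennreal_mult mult.assoc)
    also have "\<dots> = ennreal (d powr p) * (\<integral>\<^sup>+w\<in>Q. ennreal (norm (g w) powr p) \<partial>lborel)"
      by (simp add: nn_integral_cmult)
    also have "\<dots> \<le> ennreal (d powr p) * ennreal I"
      using I by (intro mult_left_mono) (auto simp: g_def)
    finally show ?thesis using I by (simp add: ennreal_mult)
  qed
  have inner: "(\<integral>\<^sup>+z. ennreal (d * norm (g (x + t *\<^sub>R (z - x)))) * indicator {0..1} t * indicator Q z \<partial>lborel)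
     \<le> ennreal (t powr (- \<alpha>)) * indicator {0..1} t * emeasure lborel Q + ennreal (d powr p * I) * indicator {0..1} t"
    if t0: "t \<noteq> 0" for t
  proof (cases "t \<in> {0..1}")
    case True
    then have t: "t > 0" "t \<le> 1" using t0 by auto
    have "(\<integral>\<^sup>+z. ennreal (d * norm (g (x + t *\<^sub>R (z - x)))) * indicator {0..1} t * indicator Q z \<partial>lborel)
      \<le> (\<integral>\<^sup>+z. ennreal (t powr (- \<alpha>)) * indicator Q z + ennreal (\<bar>t\<bar> ^ CARD('n)) * h ((x - t *\<^sub>R x) + t *\<^sub>R z) \<partial>lborel)"
    proof (rule nn_integral_mono)
      fix z
      show "ennreal (d * norm (g (x + t *\<^sub>R (z - x)))) * indicator {0..1} t * indicator Q z \<le>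
        ennreal (t powr (- \<alpha>)) * indicator Q z + ennreal (\<bar>t\<bar> ^ CARD('n)) * h ((x - t *\<^sub>R x) + t *\<^sub>R z)"
      proof (cases "z \<in> Q")
        case z: True
        have e: "(x - t *\<^sub>R x) + t *\<^sub>R z = x + t *\<^sub>R (z - x)" by (simp add: algebra_simps)
        have "(1 - t) *\<^sub>R x + t *\<^sub>R z \<in> Q" using t by (intro convexD_alt[OF Q(1) x z]) auto
        then have inQ: "x + t *\<^sub>R (z - x) \<in> Q" by (simp add: algebra_simps)
        have tn: "(t powr (- \<alpha>)) powr (1 - p) = t ^ CARD('n)"
        proof -
          have "- \<alpha> * (1 - p) = real CARD('n) * ((p - 1) / (p - 1))" unfolding \<alpha>_def by argo
          also have "\<dots> = real CARD('n)" using p by simp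
          finally show ?thesis using t by (simp only: powr_powr powr_realpow)
        qed
        have "d * norm (g (x + t *\<^sub>R (z - x))) \<le> t powr (- \<alpha>) + t ^ CARD('n) * (d * norm (g (x + t *\<^sub>R (z - x)))) powr p"
          using young_scaled[of 1 "d * norm (g (x + t *\<^sub>R (z - x)))" "t powr (- \<alpha>)" p] t p d by (simp add: tn)
        then show ?thesis unfolding e using z inQ t True
          by (auto simp: h_def ennreal_mult[symmetric] ennreal_plus[symmetric] simp del: ennreal_plus intro!: ennreal_leI)
      qed simp
    qed
    also have "\<dots> = ennreal (t powr (- \<alpha>)) * emeasure lborel Q +
        ennreal (\<bar>t\<bar> ^ CARD('n)) * (\<integral>\<^sup>+z. h ((x - t *\<^sub>R x) + t *\<^sub>R z) \<partial>lborel)"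
      by (simp add: nn_integral_add nn_integral_cmult)
    also have "ennreal (\<bar>t\<bar> ^ CARD('n)) * (\<integral>\<^sup>+z. h ((x - t *\<^sub>R x) + t *\<^sub>R z) \<partial>lborel) = (\<integral>\<^sup>+w. h w \<partial>lborel)"
      using nn_integral_lborel_affine[of h t "x - t *\<^sub>R x"] t by simp
    also have "ennreal (t powr (- \<alpha>)) * emeasure lborel Q + (\<integral>\<^sup>+w. h w \<partial>lborel)
      \<le> ennreal (t powr (- \<alpha>)) * emeasure lborel Q + ennreal (d powr p * I)"
      by (intro add_left_mono hI)
    finally show ?thesis using True by simp
  qed simp
  have pw: "(\<integral>\<^sup>+t. ennreal (t powr (- \<alpha>)) * indicator {0..1} t \<partial>lborel) = ennreal ((p - 1) / (p - 1 - real CARD('n)))"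
  proof -
    have "((\<lambda>t. t powr (- \<alpha>)) has_integral (1 / (- \<alpha> + 1))) {0..1}"
      using has_integral_powr_from_0[of "- \<alpha>" 1] \<alpha> by simp
    then have "((\<lambda>t. if t \<in> {0..1} then t powr (- \<alpha>) else 0) has_integral (1 / (- \<alpha> + 1))) UNIV"
      by (simp only: has_integral_restrict_UNIV)
    from nn_integral_has_integral_lborel[OF _ _ this]
    have "(\<integral>\<^sup>+t. ennreal (if t \<in> {0..1} then t powr (- \<alpha>) else 0) \<partial>lborel) = ennreal (1 / (- \<alpha> + 1))"
      by simp
    moreover have "(\<integral>\<^sup>+t. ennreal (t powr (- \<alpha>)) * indicator {0..1} t \<partial>lborel)
      = (\<integral>\<^sup>+t. ennreal (if t \<in> {0..1} then t powr (- \<alpha>) else 0) \<partial>lborel)"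
      by (intro nn_integral_cong) (simp add: indicator_def)
    ultimately show ?thesis by (simp only: 1)
  qed
  have "(\<integral>\<^sup>+z\<in>Q. ennreal \<bar>U z - U x\<bar> \<partial>lborel) \<le>
     (\<integral>\<^sup>+z. (\<integral>\<^sup>+t. ennreal (d * norm (g (x + t *\<^sub>R (z - x)))) * indicator {0..1} t * indicator Q z \<partial>lborel) \<partial>lborel)"
  proof (rule nn_integral_mono)
    fix z
    show "ennreal \<bar>U z - U x\<bar> * indicator Q z \<le>
      (\<integral>\<^sup>+t. ennreal (d * norm (g (x + t *\<^sub>R (z - x)))) * indicator {0..1} t * indicator Q z \<partial>lborel)"
      using line_integral_bound[OF U d(2), of z] by (cases "z \<in> Q") (auto simp: g_def)
  qed
  also have "\<dots> = (\<integral>\<^sup>+t. (\<integral>\<^sup>+z. ennreal (d * norm (g (x + t *\<^sub>R (z - x)))) * indicator {0..1} t * indicator Q z \<partial>lborel) \<partial>lborel)"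
    by (rule lborel_pair.Fubini') measurable
  also have "\<dots> \<le> (\<integral>\<^sup>+t. ennreal (t powr (- \<alpha>)) * indicator {0..1} t * emeasure lborel Q + ennreal (d powr p * I) * indicator {0..1} t \<partial>lborel)"
    \<comment> \<open>At t = 0 the term \<open>t powr (- \<alpha>)\<close> is 0 by convention, so
      the bound is claimed only off this null set.\<close>
    using AE_lborel_singleton[of "0::real"] by (intro nn_integral_mono_AE) (auto elim!: eventually_mono intro!: inner)
  also have "\<dots> = ennreal ((p - 1) / (p - 1 - real CARD('n))) * emeasure lborel Q + ennreal (d powr p * I)"
    using pw by (simp add: nn_integral_add nn_integral_multc nn_integral_cmult)
  finally show ?thesis .
qed

text \<open>The triangle inequality through z, averaged over z in \<open>Q\<close>. The
  inhomogeneous form, a constant plus an energy term, suits the logarithm, whose energy is bounded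
  at its natural scale.\<close>

lemma morrey:
  fixes U :: "real^'n::finite \<Rightarrow> real"
  assumes U: "smooth U" and Q: "convex Q" "Q \<in> sets borel" and xy: "x \<in> Q" "y \<in> Q"
    and d: "d \<ge> 0" "\<And>z w. z \<in> Q \<Longrightarrow> w \<in> Q \<Longrightarrow> norm (z - w) \<le> d" and p: "p > real CARD('n) + 1"
    and I: "(\<integral>\<^sup>+z\<in>Q. ennreal (norm (differential U z) powr p) \<partial>lborel) \<le> ennreal I" "I \<ge> 0"
    and m: "emeasure lborel Q = ennreal m" "m > 0"
  shows "\<bar>U x - U y\<bar> \<le> 2 * ((p - 1) / (p - 1 - real CARD('n)) + d powr p * I / m)"
proof -
  define K where "K = (p - 1) / (p - 1 - real CARD('n))"
  have K: "K \<ge> 0" using p by (simp add: K_def)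
  note [measurable] = smooth_borel[OF U] Q(2)
  have mean: "(\<integral>\<^sup>+z\<in>Q. ennreal \<bar>U z - U a\<bar> \<partial>lborel) \<le> ennreal (K * m + d powr p * I)" if "a \<in> Q" for a
  proof -
    have "ennreal K * emeasure lborel Q + ennreal (d powr p * I) = ennreal (K * m + d powr p * I)"
      unfolding m(1) using K m I by (simp flip: ennreal_mult ennreal_plus)
    then show ?thesis using morrey_mean[OF U Q that d(1) d(2)[OF _ that] p I] by (simp add: K_def)
  qed
  have "ennreal (\<bar>U x - U y\<bar> * m) = (\<integral>\<^sup>+z. ennreal \<bar>U x - U y\<bar> * indicator Q z \<partial>lborel)"
    using m by (simp add: nn_integral_cmult_indicator ennreal_mult)
  also have "\<dots> \<le> (\<integral>\<^sup>+z. ennreal \<bar>U z - U x\<bar> * indicator Q z + ennreal \<bar>U z - U y\<bar> * indicator Q z \<partial>lborel)"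
    by (intro nn_integral_mono) (auto simp: indicator_def simp flip: ennreal_plus intro!: ennreal_leI)
  also have "\<dots> = (\<integral>\<^sup>+z\<in>Q. ennreal \<bar>U z - U x\<bar> \<partial>lborel) + (\<integral>\<^sup>+z\<in>Q. ennreal \<bar>U z - U y\<bar> \<partial>lborel)"
    by (rule nn_integral_add) measurable
  also have "\<dots> \<le> ennreal (K * m + d powr p * I) + ennreal (K * m + d powr p * I)"
    by (intro add_mono mean xy)
  also have "\<dots> = ennreal (2 * (K * m + d powr p * I))"
    using K m I by (simp flip: ennreal_plus)
  finally have "\<bar>U x - U y\<bar> * m \<le> 2 * (K * m + d powr p * I)"
    using K m I by (subst (asm) ennreal_le_iff) auto
  then have "\<bar>U x - U y\<bar> \<le> 2 * (K * m + d powr p * I) / m"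
    using m by (simp add: pos_le_divide_eq)
  also have "\<dots> = 2 * (K + d powr p * I / m)" using m by (simp add: field_simps)
  finally show ?thesis by (simp add: K_def)
qed

section \<open>Oscillation on planar annuli\<close>

lemma norm_le_sum_2: "norm (x :: real^2) \<le> \<bar>x $ 1\<bar> + \<bar>x $ 2\<bar>"
  using norm_le_l1_cart[of x] by (simp add: sum_2)

lemma norm_squared_2: "(norm (x :: real^2))\<^sup>2 = (x $ 1)\<^sup>2 + (x $ 2)\<^sup>2"
  unfolding power2_norm_eq_inner by (simp add: inner_vec_def sum_2 power2_eq_square)

text \<open>With s * t = 4 and s + t = 5 the sides are R and 4R in either order: area 4R^2 and
  diameter at most 5R. The symmetric form treats upright and lying boxes at once.\<close>

lemma morrey_box_2:
  fixes U :: "real^2 \<Rightarrow> real"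
  assumes U: "smooth U" and R: "R > 0" and xy: "x \<in> cbox a b" "y \<in> cbox a b"
    and ab: "b $ 1 - a $ 1 = s * R" "b $ 2 - a $ 2 = t * R" "s * t = 4" "s > 0" "t > 0" "s + t = 5"
    and p: "p > 3" and sub: "cbox a b \<subseteq> T" and T: "T \<in> sets borel"
    and I: "(\<integral>\<^sup>+z\<in>T. ennreal (norm (differential U z) powr p) \<partial>lborel) \<le> ennreal I" "I \<ge> 0"
  shows "\<bar>U x - U y\<bar> \<le> 2 * ((p - 1) / (p - 3) + (5 * R) powr p * I / (4 * R\<^sup>2))"
proof -
  have "\<bar>U x - U y\<bar> \<le> 2 * ((p - 1) / (p - 1 - real CARD(2)) + (5 * R) powr p * I / (4 * R\<^sup>2))"
  proof (rule morrey[OF U _ _ xy])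
    show "norm (z - w) \<le> 5 * R" if "z \<in> cbox a b" "w \<in> cbox a b" for z w
    proof -
      have "\<bar>(z - w) $ 1\<bar> \<le> s * R" "\<bar>(z - w) $ 2\<bar> \<le> t * R"
        using that ab(1,2) by (auto simp: mem_box_cart abs_le_iff forall_2)
      then have "norm (z - w) \<le> (s + t) * R"
        using norm_le_sum_2[of "z - w"] by (simp add: distrib_right)
      then show ?thesis by (simp add: ab)
    qed
    have "(\<integral>\<^sup>+z\<in>cbox a b. ennreal (norm (differential U z) powr p) \<partial>lborel) \<le>
       (\<integral>\<^sup>+z\<in>T. ennreal (norm (differential U z) powr p) \<partial>lborel)"
      using sub by (intro nn_integral_mono) (auto simp: indicator_def)
    then show "(\<integral>\<^sup>+z\<in>cbox a b. ennreal (norm (differential U z) powr p) \<partial>lborel) \<le> ennreal I"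
      using I(1) by (rule order_trans)
    have "cbox a b \<noteq> {}" using xy by auto
    then have "measure lborel (cbox a b) = (\<Prod>i\<in>UNIV. b $ i - a $ i)"
      by (rule content_cbox_cart)
    also have "\<dots> = (s * t) * R\<^sup>2" using ab(1,2) by (simp add: UNIV_2 power2_eq_square)
    finally show "emeasure lborel (cbox a b) = ennreal (4 * R\<^sup>2)"
      using emeasure_eq_ennreal_measure[of lborel "cbox a b"] emeasure_lborel_cbox_finite[of a b]
      by (simp add: ab)
  qed (use R p I in auto)
  then show ?thesis by simp
qed

text \<open>An annulus is not convex, so four boxes of sides R and 4R are used, which make up the
  frame between the squares of half-side R and 2R. The thin annulus lies in the frame since 3/2 >
  sqrt 2, and the frame lies in the wide annulus since 2 sqrt 2 < 3. Every point reaches the corner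
  (2R, 2R) through at most two boxes, so two points are at most four box estimates apart, whence the
  factor 8 = 4 * 2.\<close>

lemma annulus_oscillation:
  fixes U :: "real^2 \<Rightarrow> real"
  assumes U: "smooth U" and R: "R > 0" and p: "p > 3"
    and I: "(\<integral>\<^sup>+z\<in>{z. R \<le> norm z \<and> norm z \<le> 3 * R}. ennreal (norm (differential U z) powr p) \<partial>lborel) \<le> ennreal I" "I \<ge> 0"
    and x: "3/2 * R \<le> norm x" "norm x \<le> 2 * R" and y: "3/2 * R \<le> norm y" "norm y \<le> 2 * R"
  shows "\<bar>U x - U y\<bar> \<le> 8 * ((p - 1) / (p - 3) + (5 * R) powr p * I / (4 * R\<^sup>2))"
proof -
  define B where "B = 2 * ((p - 1) / (p - 3) + (5 * R) powr p * I / (4 * R\<^sup>2))"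
  define T where "T = {z :: real^2. R \<le> norm z \<and> norm z \<le> 3 * R}"
  have T: "T \<in> sets borel" unfolding T_def by measurable
  have IT: "(\<integral>\<^sup>+z\<in>T. ennreal (norm (differential U z) powr p) \<partial>lborel) \<le> ennreal I"
    using I(1) by (simp add: T_def)
  have inT: "z \<in> T" if "\<bar>z$1\<bar> \<le> 2 * R" "\<bar>z$2\<bar> \<le> 2 * R" "R \<le> \<bar>z$1\<bar> \<or> R \<le> \<bar>z$2\<bar>" for z :: "real^2"
  proof -
    have "R \<le> norm z" using that(3) component_le_norm_cart[of z 1] component_le_norm_cart[of z 2] by linarith
    moreover have "(z$1)\<^sup>2 \<le> (2 * R)\<^sup>2" "(z$2)\<^sup>2 \<le> (2 * R)\<^sup>2"
      using that R by (auto simp only: power2_le_iff_abs_le)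
    then have "(z$1)\<^sup>2 \<le> 4 * R\<^sup>2" "(z$2)\<^sup>2 \<le> 4 * R\<^sup>2" by (simp_all add: power_mult_distrib)
    with zero_le_power2[of R] have "(z$1)\<^sup>2 + (z$2)\<^sup>2 \<le> 9 * R\<^sup>2" by linarith
    then have "(norm z)\<^sup>2 \<le> (3 * R)\<^sup>2" by (simp add: norm_squared_2 power_mult_distrib)
    then have "norm z \<le> 3 * R" by (rule power2_le_imp_le) (use R in simp)
    ultimately show ?thesis by (simp add: T_def)
  qed
  define c :: "real \<Rightarrow> real \<Rightarrow> real^2" where "c a b = vector [a * R, b * R]" for a b
  have c_nth [simp]: "c a b $ 1 = a * R" "c a b $ 2 = b * R" for a b by (simp_all add: c_def)
  have box: "\<bar>U u - U w\<bar> \<le> B"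
    if "b1 - a1 = s" "b2 - a2 = t" "s * t = 4" "s > 0" "t > 0" "s + t = 5"
      "cbox (c a1 a2) (c b1 b2) \<subseteq> T" "u \<in> cbox (c a1 a2) (c b1 b2)" "w \<in> cbox (c a1 a2) (c b1 b2)"
    for a1 a2 b1 b2 s t u w
    unfolding B_def using that(1,2)
    by (intro morrey_box_2[OF U R that(8,9) _ _ that(3-6) p that(7) T IT I(2)]) (auto simp flip: left_diff_distrib)
  have mem: "z \<in> cbox (c a1 a2) (c b1 b2) \<longleftrightarrow> a1 * R \<le> z$1 \<and> z$1 \<le> b1 * R \<and> a2 * R \<le> z$2 \<and> z$2 \<le> b2 * R"
    for z a1 a2 b1 b2 by (auto simp: mem_box_cart forall_2)
  have right: "\<bar>U u - U w\<bar> \<le> B" if "u \<in> cbox (c 1 (-2)) (c 2 2)" "w \<in> cbox (c 1 (-2)) (c 2 2)" for u w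
    by (rule box[of 2 1 1 2 "-2" 4, OF _ _ _ _ _ _ _ that]) (use R in \<open>auto simp: mem intro!: inT\<close>)
  have left: "\<bar>U u - U w\<bar> \<le> B" if "u \<in> cbox (c (-2) (-2)) (c (-1) 2)" "w \<in> cbox (c (-2) (-2)) (c (-1) 2)" for u w
    by (rule box[of "-1" "-2" 1 2 "-2" 4, OF _ _ _ _ _ _ _ that]) (use R in \<open>auto simp: mem intro!: inT\<close>)
  have top: "\<bar>U u - U w\<bar> \<le> B" if "u \<in> cbox (c (-2) 1) (c 2 2)" "w \<in> cbox (c (-2) 1) (c 2 2)" for u w
    by (rule box[of 2 "-2" 4 2 1 1, OF _ _ _ _ _ _ _ that]) (use R in \<open>auto simp: mem intro!: inT\<close>)
  have bottom: "\<bar>U u - U w\<bar> \<le> B" if "u \<in> cbox (c (-2) (-2)) (c 2 (-1))" "w \<in> cbox (c (-2) (-2)) (c 2 (-1))" for u w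
    by (rule box[of 2 "-2" 4 "-1" "-2" 1, OF _ _ _ _ _ _ _ that]) (use R in \<open>auto simp: mem intro!: inT\<close>)
  have base: "\<bar>U u - U (c 2 2)\<bar> \<le> 2 * B" if u: "3/2 * R \<le> norm u" "norm u \<le> 2 * R" for u
  proof -
    have u12: "\<bar>u$1\<bar> \<le> 2 * R" "\<bar>u$2\<bar> \<le> 2 * R"
      using u(2) component_le_norm_cart[of u 1] component_le_norm_cart[of u 2] by linarith+
    have "\<not> (\<bar>u$1\<bar> < R \<and> \<bar>u$2\<bar> < R)"
    proof
      assume "\<bar>u$1\<bar> < R \<and> \<bar>u$2\<bar> < R"
      then have "(u$1)\<^sup>2 \<le> R\<^sup>2" "(u$2)\<^sup>2 \<le> R\<^sup>2"
        using R by (auto simp: power2_le_iff_abs_le)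
      then have "(norm u)\<^sup>2 \<le> 2 * R\<^sup>2" by (simp add: norm_squared_2)
      moreover have "(3/2 * R)\<^sup>2 \<le> (norm u)\<^sup>2" using u R by (intro power_mono) auto
      then have "9/4 * R\<^sup>2 \<le> (norm u)\<^sup>2" by (simp add: power_mult_distrib power_divide)
      moreover have "R\<^sup>2 > 0" using R by simp
      ultimately show False by linarith
    qed
    then consider "R \<le> u$1" | "u$1 \<le> -R" | "R \<le> u$2" | "u$2 \<le> -R" by linarith
    then show ?thesis
    proof cases
      case 1
      have "\<bar>U u - U (c 2 2)\<bar> \<le> B" by (rule right) (use 1 u12 R in \<open>auto simp: mem\<close>)
      then show ?thesis by linarith
    next
      case 2
      have "\<bar>U u - U (c (-2) 2)\<bar> \<le> B" by (rule left) (use 2 u12 R in \<open>auto simp: mem\<close>)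
      moreover have "\<bar>U (c (-2) 2) - U (c 2 2)\<bar> \<le> B" by (rule top) (use R in \<open>auto simp: mem\<close>)
      ultimately show ?thesis by linarith
    next
      case 3
      have "\<bar>U u - U (c 2 2)\<bar> \<le> B" by (rule top) (use 3 u12 R in \<open>auto simp: mem\<close>)
      then show ?thesis by linarith
    next
      case 4
      have "\<bar>U u - U (c 2 (-2))\<bar> \<le> B" by (rule bottom) (use 4 u12 R in \<open>auto simp: mem\<close>)
      moreover have "\<bar>U (c 2 (-2)) - U (c 2 2)\<bar> \<le> B" by (rule right) (use R in \<open>auto simp: mem\<close>)
      ultimately show ?thesis by linarith
    qed
  qed
  show ?thesis using base[OF x] base[OF y] unfolding B_def by linarith
qed

section \<open>Weighted p-harmonic functions\<close>

text \<open>The indicator of the ball of radius 7/8 is mollified at radius 1/8; 3/4 and 1 are 7/8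
  minus and plus 1/8.\<close>

lemma cutoff_profile_exists:
  obtains \<kappa> :: "real^'n::finite \<Rightarrow> real" where "smooth \<kappa>" "\<And>x. 0 \<le> \<kappa> x" "\<And>x. \<kappa> x \<le> 1"
    "\<And>x. norm x \<le> 3/4 \<Longrightarrow> \<kappa> x = 1" "\<And>x. norm x \<ge> 1 \<Longrightarrow> \<kappa> x = 0"
proof -
  define f :: "real^'n \<Rightarrow> real" where "f = indicator (cball 0 (7/8))"
  obtain \<rho> :: "real^'n \<Rightarrow> real" where \<rho>: "mollifier (1/8) \<rho>"
    by (rule mollifier_exists[of "1/8"]) auto
  have f: "loc_int f"
    unfolding loc_int_def set_integrable_def f_def
    by (auto simp: indicator_inter_arith[symmetric] emeasure_bounded_finite[unfolded infinity_ennreal_def] bounded_Int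
        intro!: integrable_real_indicator)
  have *: "AE y in lborel. norm (x - y) < 1/8 \<longrightarrow> 0 \<le> f y \<and> f y \<le> 1" for x
    by (auto simp: f_def indicator_def)
  have 1: "AE y in lborel. norm (x - y) < 1/8 \<longrightarrow> 1 \<le> f y \<and> f y \<le> 1" if "norm x \<le> 3/4" for x
  proof (rule AE_I2, intro impI)
    fix y assume "norm (x - y) < 1/8"
    then have "norm y \<le> 7/8" using that norm_triangle_ineq2[of y x] by (simp add: norm_minus_commute)
    then show "1 \<le> f y \<and> f y \<le> 1" by (simp add: f_def)
  qed
  have 2: "AE y in lborel. norm (x - y) < 1/8 \<longrightarrow> 0 \<le> f y \<and> f y \<le> 0" if "norm x \<ge> 1" for x
  proof (rule AE_I2, intro impI)
    fix y assume "norm (x - y) < 1/8"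
    then have "norm y > 7/8" using that norm_triangle_ineq2[of x y] by simp
    then show "0 \<le> f y \<and> f y \<le> 0" by (simp add: f_def)
  qed
  show ?thesis
  proof (rule that[of "conv f \<rho>"])
    show "smooth (conv f \<rho>)" using \<rho> f by (intro smooth_conv) (auto simp: mollifier_def)
    show "0 \<le> conv f \<rho> x" "conv f \<rho> x \<le> 1" for x using conv_bounds[OF \<rho> f *] by auto
    show "conv f \<rho> x = 1" if "norm x \<le> 3/4" for x using conv_bounds[OF \<rho> f 1[OF that]] by simp
    show "conv f \<rho> x = 0" if "norm x \<ge> 1" for x using conv_bounds[OF \<rho> f 2[OF that]] by simp
  qed
qed

text \<open>Raising the profile to a power \<open>k \<ge> p\<close> makes its gradient small where the cutoff is small.\<close>

lemma cutoff_exists: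
  assumes p: "p > 1"
  obtains C where "C > 0"
    "\<And>R. R > 0 \<Longrightarrow> \<exists>\<zeta> :: real^'n::finite \<Rightarrow> real. test_function \<zeta> \<and> (\<forall>x. 0 \<le> \<zeta> x \<and> \<zeta> x \<le> 1) \<and>
       (\<forall>x. norm x \<le> 3/4 * R \<longrightarrow> \<zeta> x = 1) \<and> (\<forall>x. norm x \<ge> R \<longrightarrow> \<zeta> x = 0) \<and>
       (\<forall>x. norm (differential \<zeta> x) \<le> C / R * \<zeta> x powr ((p - 1) / p))"
proof -
  obtain \<kappa> :: "real^'n \<Rightarrow> real" where \<kappa>: "smooth \<kappa>" "\<And>x. 0 \<le> \<kappa> x" "\<And>x. \<kappa> x \<le> 1"
    "\<And>x. norm x \<le> 3/4 \<Longrightarrow> \<kappa> x = 1" "\<And>x. norm x \<ge> 1 \<Longrightarrow> \<kappa> x = 0"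
    using cutoff_profile_exists by blast
  have d0: "differential \<kappa> x = 0" if "norm x > 1" for x
    by (rule differential_outside[OF _ that]) (simp add: \<kappa>(5))
  have "continuous_on UNIV (\<lambda>x. norm (differential \<kappa> x))"
    by (intro continuous_intros smooth_differential_continuous \<kappa>)
  then obtain B where B: "B > 0" "\<And>x. \<bar>norm (differential \<kappa> x)\<bar> \<le> B"
    by (rule continuous_bounded_support[of "\<lambda>x. norm (differential \<kappa> x)" 1]) (simp_all add: d0)
  define k where "k = nat \<lceil>p\<rceil>"
  have k: "real k \<ge> p" "k \<ge> 2" using p by (auto simp: k_def le_nat_iff)
  have main: "\<exists>\<zeta> :: real^'n \<Rightarrow> real. test_function \<zeta> \<and> (\<forall>x. 0 \<le> \<zeta> x \<and> \<zeta> x \<le> 1) \<and>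
       (\<forall>x. norm x \<le> 3/4 * R \<longrightarrow> \<zeta> x = 1) \<and> (\<forall>x. norm x \<ge> R \<longrightarrow> \<zeta> x = 0) \<and>
       (\<forall>x. norm (differential \<zeta> x) \<le> (real k * B) / R * \<zeta> x powr ((p - 1) / p))" if R: "R > 0" for R
  proof (intro exI[of _ "\<lambda>x. \<kappa> (inverse R *\<^sub>R x) ^ k"] conjI allI impI)
    have nu: "norm (inverse R *\<^sub>R x) = norm x / R" for x :: "real^'n"
      using R by (simp add: divide_inverse mult.commute)
    have s: "smooth (\<lambda>x. \<kappa> (inverse R *\<^sub>R x))" using smooth_affine[OF \<kappa>(1), of 0 "inverse R"] by simp
    show "test_function (\<lambda>x. \<kappa> (inverse R *\<^sub>R x) ^ k)"
      by (rule test_functionI[of _ R, OF smooth_power[OF s]]) (use k R in \<open>auto simp: \<kappa>(5) nu simp del: norm_scaleR\<close>)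
    show "0 \<le> \<kappa> (inverse R *\<^sub>R x) ^ k" "\<kappa> (inverse R *\<^sub>R x) ^ k \<le> 1" for x
      by (auto intro: \<kappa> power_le_one zero_le_power)
    show "\<kappa> (inverse R *\<^sub>R x) ^ k = 1" if "norm x \<le> 3/4 * R" for x
    proof -
      have "norm (inverse R *\<^sub>R x) \<le> 3/4" unfolding nu using that R by (simp add: pos_divide_le_eq)
      then show ?thesis by (simp add: \<kappa>(4))
    qed
    show "\<kappa> (inverse R *\<^sub>R x) ^ k = 0" if "norm x \<ge> R" for x
    proof -
      have "norm (inverse R *\<^sub>R x) \<ge> 1" unfolding nu using that R by simp
      then show ?thesis using k by (simp add: \<kappa>(5))
    qed
    show "norm (differential (\<lambda>x. \<kappa> (inverse R *\<^sub>R x) ^ k) x) \<le> (real k * B) / R * (\<kappa> (inverse R *\<^sub>R x) ^ k) powr ((p - 1) / p)" for x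
    proof -
      define w where "w = \<kappa> (inverse R *\<^sub>R x)"
      have w: "0 \<le> w" "w \<le> 1" by (auto simp: w_def \<kappa>)
      have "((\<lambda>x. \<kappa> (inverse R *\<^sub>R x)) has_derivative (\<lambda>h. differential \<kappa> (inverse R *\<^sub>R x) \<bullet> (inverse R *\<^sub>R h))) (at x)"
        by (rule has_derivative_compose[OF _ smooth_has_derivative[OF \<kappa>(1)]]) (auto intro!: derivative_eq_intros)
      from has_derivative_power[OF this, of k]
      have "differential (\<lambda>x. \<kappa> (inverse R *\<^sub>R x) ^ k) x =
          (real k * w ^ (k - 1) * inverse R) *\<^sub>R differential \<kappa> (inverse R *\<^sub>R x)"
        by (intro differential_eq) (simp add: w_def mult_ac)
      then have "norm (differential (\<lambda>x. \<kappa> (inverse R *\<^sub>R x) ^ k) x) =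
          (real k * w ^ (k - 1) * inverse R) * norm (differential \<kappa> (inverse R *\<^sub>R x))"
        using w R by simp
      also have "\<dots> \<le> (real k * w ^ (k - 1) * inverse R) * B"
        using w R B(2)[of "inverse R *\<^sub>R x"] by (intro mult_left_mono) auto
      also have "\<dots> = (real k * B) / R * w ^ (k - 1)" by (simp add: divide_inverse mult_ac)
      also have "\<dots> \<le> (real k * B) / R * (w ^ k) powr ((p - 1) / p)"
      proof (intro mult_left_mono)
        show "w ^ (k - 1) \<le> (w ^ k) powr ((p - 1) / p)"
        proof (cases "w = 0")
          case True
          then show ?thesis using k by (simp add: power_0_left)
        next
          case False
          then have w0: "w > 0" using w by simp
          \<comment> \<open>Equivalent to k/p \<ge> 1. As 0 < w \<le> 1, the smaller exponent gives
            the larger power.\<close>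
          have "real k * ((p - 1) / p) \<le> real (k - 1)"
            using k p by (simp add: divide_simps of_nat_diff algebra_simps)
          then have "w powr real (k - 1) \<le> w powr (real k * ((p - 1) / p))"
            using w w0 by (intro powr_mono') auto
          then show ?thesis using w0 by (simp add: powr_realpow[symmetric] powr_powr)
        qed
        show "(real k * B) / R \<ge> 0" using R B by simp
      qed
      finally show ?thesis by (simp add: w_def)
    qed
  qed
  show ?thesis by (rule that[of "real k * B", OF _ main]) (use k B in auto)
qed

text \<open>Restriction to a ball by a density rather than by a smaller space: the measure is
  finite, and Borel functions on the whole space stay measurable for it.\<close>

definition leb :: "real \<Rightarrow> (real^'n::finite) measure" where
  "leb r = density lborel (\<lambda>x. ennreal (indicator (cball 0 r) x))"

lemma sets_leb [simp, measurable_cong]: "sets (leb r) = sets borel"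
  by (simp add: leb_def)

lemma AE_leb: "(AE x in leb r. P x) \<longleftrightarrow> (AE x in lborel. norm x \<le> r \<longrightarrow> P x)"
  unfolding leb_def by (subst AE_density) (auto simp: indicator_def)

lemma nn_integral_leb:
  "f \<in> borel_measurable borel \<Longrightarrow> (\<integral>\<^sup>+x. f x \<partial>leb r) = (\<integral>\<^sup>+x\<in>cball 0 r. f x \<partial>lborel)"
  unfolding leb_def by (simp add: nn_integral_density mult.commute ennreal_indicator)

lemma integral_leb:
  fixes f :: "real^'n::finite \<Rightarrow> real"
  assumes "f \<in> borel_measurable borel" "\<And>x. norm x > r \<Longrightarrow> f x = 0"
  shows "(\<integral>x. f x \<partial>leb r) = (\<integral>x. f x \<partial>lborel)"
  unfolding leb_def using assms
  by (subst integral_density) (auto simp: indicator_def not_le intro!: Bochner_Integration.integral_cong)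

lemma finite_measure_leb: "finite_measure (leb r :: (real^'n::finite) measure)"
proof
  have "emeasure (leb r) (space (leb r :: (real^'n) measure)) = (\<integral>\<^sup>+x. 1 \<partial>(leb r :: (real^'n) measure))" by simp
  also have "\<dots> = emeasure lborel (cball (0::real^'n) r)"
    by (subst nn_integral_leb) auto
  also have "\<dots> < \<infinity>" by (rule emeasure_bounded_finite) simp
  finally show "emeasure (leb r) (space (leb r :: (real^'n) measure)) \<noteq> \<infinity>" by simp
qed

lemma continuous_bounded_cball:
  fixes f :: "'a::euclidean_space \<Rightarrow> 'b::real_normed_vector"
  assumes "continuous_on UNIV f"
  obtains C where "C \<ge> 0" "\<And>x. norm x \<le> r \<Longrightarrow> norm (f x) \<le> C"
proof -
  have "compact (f ` cball 0 r)"
    using assms by (intro compact_continuous_image) (auto intro: continuous_on_subset)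
  then obtain C where "C > 0" "\<forall>y\<in>f ` cball 0 r. norm y \<le> C"
    using bounded_pos compact_imp_bounded by blast
  then show ?thesis using that[of C] by auto
qed

lemma nn_integral_leb_bounded:
  fixes f :: "real^'n::finite \<Rightarrow> real"
  assumes "AE x in leb r. f x \<le> C"
  shows "(\<integral>\<^sup>+x. ennreal (f x) \<partial>leb r) < \<infinity>"
proof -
  interpret finite_measure "leb r :: (real^'n) measure" by (rule finite_measure_leb)
  have "(\<integral>\<^sup>+x. ennreal (f x) \<partial>leb r) \<le> (\<integral>\<^sup>+x. ennreal C \<partial>(leb r :: (real^'n) measure))"
    using assms by (intro nn_integral_mono_AE, eventually_elim) (auto intro: ennreal_leI)
  also have "\<dots> < \<infinity>" by (simp add: less_top[symmetric] ennreal_mult_eq_top_iff emeasure_finite)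
  finally show ?thesis .
qed

text \<open>In dimension two the p-energy density of \<open>v\<close> for a conformal metric \<open>\<phi> (dx\<^sup>2 + dy\<^sup>2)\<close> is
  \<open>\<phi>\<^bsup>1-p/2\<^esup> |dv|\<^sup>p dx dy\<close>.  For \<open>\<phi> = (1 + |x|\<^sup>2)\<^bsup>p/(2-p)\<^esup>\<close> this is the weight \<open>(1 + |x|\<^sup>2)\<^bsup>p/2\<^esup>\<close>.\<close>

locale weighted_solution =
  fixes p :: real and v :: "real^2 \<Rightarrow> real" and D :: "real^2 \<Rightarrow> real^2"
  assumes p: "p > 3"
    and v_borel [measurable]: "v \<in> borel_measurable borel"
    and D_borel [measurable]: "D \<in> borel_measurable borel"
    and v_bdd: "\<And>r. \<exists>C. AE x in lborel. norm x \<le> r \<longrightarrow> v x \<le> C"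
    and D_fin: "\<And>r. (\<integral>\<^sup>+x\<in>cball 0 r. ennreal (norm (D x) powr p) \<partial>lborel) < \<infinity>"
    and weak: "\<And>\<psi> i. test_function \<psi> \<Longrightarrow>
      (\<integral>x. v x * partial_deriv i \<psi> x \<partial>lborel) = - (\<integral>x. D x $ i * \<psi> x \<partial>lborel)"
    and weak_eq: "\<And>\<psi>. test_function \<psi> \<Longrightarrow>
      (\<integral>x. (1 + (norm x)\<^sup>2) powr (p / 2) * norm (D x) powr (p - 2) * (D x \<bullet> differential \<psi> x) \<partial>lborel) = 0"
begin

definition weight :: "real^2 \<Rightarrow> real" where "weight x = (1 + (norm x)\<^sup>2) powr (p / 2)"

definition flux :: "real^2 \<Rightarrow> real^2" where "flux x = (weight x * norm (D x) powr (p - 2)) *\<^sub>R D x"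

lemma weight_pos: "weight x > 0"
  using add_pos_nonneg[of 1 "(norm x)\<^sup>2"] by (simp add: weight_def)

lemma weight_borel [measurable]: "weight \<in> borel_measurable borel"
  unfolding weight_def[abs_def] by measurable

lemma flux_borel [measurable]: "flux \<in> borel_measurable borel"
  unfolding flux_def[abs_def] by measurable

lemma weight_le: "norm x \<le> r \<Longrightarrow> weight x \<le> (1 + r\<^sup>2) powr (p / 2)"
  using p unfolding weight_def by (intro powr_mono2 add_left_mono power_mono) auto

lemma weight_ge: "0 \<le> r \<Longrightarrow> r \<le> norm x \<Longrightarrow> r powr p \<le> weight x"
proof -
  assume r: "0 \<le> r" "r \<le> norm x"
  have "r powr p = (r powr 2) powr (p / 2)" by (simp only: powr_powr) simp
  also have "r powr 2 = r\<^sup>2" using r by simp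
  also have "(r\<^sup>2) powr (p / 2) \<le> weight x"
    unfolding weight_def using p r by (intro powr_mono2) (auto intro: order_trans[OF power_mono])
  finally show ?thesis .
qed

lemma norm_flux: "norm (flux x) = weight x * norm (D x) powr (p - 1)"
proof (cases "D x = 0")
  case False
  then have "norm (D x) powr (p - 1) = norm (D x) powr (p - 2) * norm (D x)"
    using powr_add[of "norm (D x)" "p - 2" 1] by simp
  then show ?thesis using weight_pos[of x] by (simp add: flux_def)
qed (simp add: flux_def)

lemma flux_inner_D: "flux x \<bullet> D x = weight x * norm (D x) powr p"
proof (cases "D x = 0")
  case False
  then have "norm (D x) powr p = norm (D x) powr (p - 2) * (norm (D x))\<^sup>2"
    using powr_add[of "norm (D x)" "p - 2" 2] by simp
  then show ?thesis by (simp add: flux_def power2_norm_eq_inner)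
qed (simp add: flux_def)

lemma flux_test: "test_function \<psi> \<Longrightarrow> (\<integral>x. flux x \<bullet> differential \<psi> x \<partial>lborel) = 0"
  using weak_eq[of \<psi>] by (simp add: flux_def weight_def)

lemma D_fin_leb: "(\<integral>\<^sup>+x. ennreal (norm (D x) powr p) \<partial>leb r) < \<infinity>"
  using D_fin[of r] by (simp add: nn_integral_leb)

lemma chain_approximation:
  assumes L: "AE x in lborel. L \<le> v x"
    and hs: "\<And>u. smooth u \<Longrightarrow> (\<And>x. L \<le> u x) \<Longrightarrow> smooth (\<lambda>x::real^2. h (u x))"
    and hd: "\<And>t. t \<ge> L \<Longrightarrow> (h has_real_derivative h' t) (at t)"
    and h'c: "continuous_on {L..} h'"
    and [measurable]: "h \<in> borel_measurable borel" "h' \<in> borel_measurable borel"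
    and \<zeta>: "smooth \<zeta>"
  obtains U where "\<And>n::nat. smooth (U n)" "\<And>n x. \<zeta> x = 0 \<Longrightarrow> U n x = 0"
    "AE x in leb r. (\<lambda>n. U n x) \<longlonglongrightarrow> \<zeta> x * h (v x)"
    "tendsto_Lp p (leb r) (\<lambda>n. differential (U n)) (\<lambda>x. h (v x) *\<^sub>R differential \<zeta> x + (\<zeta> x * h' (v x)) *\<^sub>R D x)"
    "(\<integral>\<^sup>+x. ennreal (norm (h (v x) *\<^sub>R differential \<zeta> x + (\<zeta> x * h' (v x)) *\<^sub>R D x) powr p) \<partial>leb r) < \<infinity>"
proof -
  have p1: "p \<ge> 1" "p > 0" using p by auto
  obtain V M where V: "\<And>n::nat. smooth (V n)" "\<And>n x. L \<le> V n x"
    "\<And>n x. norm x \<le> r \<Longrightarrow> V n x \<le> M"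
    "AE x in lborel. norm x \<le> r \<longrightarrow> (\<lambda>n. V n x) \<longlonglongrightarrow> v x"
    "(\<lambda>n. \<integral>\<^sup>+x\<in>cball 0 r. ennreal (norm (differential (V n) x - D x) powr p) \<partial>lborel) \<longlonglongrightarrow> 0"
    using smooth_approximation[OF v_borel D_borel p1(1) L v_bdd D_fin weak] by blast
  note [measurable] = smooth_borel[OF V(1)] smooth_differential_borel[OF V(1)]
    smooth_borel[OF \<zeta>] smooth_differential_borel[OF \<zeta>]
  have hc: "continuous_on {L..} h"
    by (intro continuous_at_imp_continuous_on ballI DERIV_isCont[OF hd]) simp
  have bnd: "\<exists>C. \<forall>t. L \<le> t \<and> t \<le> M \<longrightarrow> \<bar>g t\<bar> \<le> C" if "continuous_on {L..} g" for g :: "real \<Rightarrow> real"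
  proof -
    have "compact (g ` {L..M})"
      using that by (intro compact_continuous_image) (auto intro: continuous_on_subset)
    then obtain C where "\<forall>y\<in>g ` {L..M}. norm y \<le> C"
      using compact_imp_bounded bounded_iff by blast
    then show ?thesis by (auto intro!: exI[of _ C])
  qed
  obtain C0 where C0: "\<And>t. L \<le> t \<Longrightarrow> t \<le> M \<Longrightarrow> \<bar>h t\<bar> \<le> C0" using bnd[OF hc] by blast
  obtain C1 where C1: "\<And>t. L \<le> t \<Longrightarrow> t \<le> M \<Longrightarrow> \<bar>h' t\<bar> \<le> C1" using bnd[OF h'c] by blast
  obtain Z0 where Z0: "Z0 \<ge> 0" "\<And>x. norm x \<le> r \<Longrightarrow> norm (\<zeta> x) \<le> Z0"
    using continuous_bounded_cball[OF smooth_continuous[OF \<zeta>]] by blast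
  obtain Z1 where Z1: "Z1 \<ge> 0" "\<And>x. norm x \<le> r \<Longrightarrow> norm (differential \<zeta> x) \<le> Z1"
    using continuous_bounded_cball[OF smooth_differential_continuous[OF \<zeta>]] by blast
  have lim: "AE x in leb r. (\<lambda>n. V n x) \<longlonglongrightarrow> v x" using V(4) by (simp add: AE_leb)
  have vb: "AE x in leb r. norm x \<le> r \<and> L \<le> v x \<and> v x \<le> M \<and> (\<lambda>n. V n x) \<longlonglongrightarrow> v x"
  proof -
    have "AE x in leb r. norm x \<le> r" by (simp add: AE_leb)
    with lim show ?thesis
      by eventually_elim (use V(2,3) in \<open>auto intro: LIMSEQ_le_const LIMSEQ_le_const2\<close>)
  qed
  have hlim: "(\<lambda>n. g (V n x)) \<longlonglongrightarrow> g (v x)"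
    if "continuous_on {L..} g" "L \<le> v x" "(\<lambda>n. V n x) \<longlonglongrightarrow> v x" for g :: "real \<Rightarrow> real" and x
    by (rule continuous_on_tendsto_compose[OF that(1,3)]) (use that(2) V(2) in auto)
  define U where "U n x = \<zeta> x * h (V n x)" for n x
  define G where "G x = h (v x) *\<^sub>R differential \<zeta> x + (\<zeta> x * h' (v x)) *\<^sub>R D x" for x
  have hV: "((\<lambda>x. h (V n x)) has_derivative (\<lambda>k. (h' (V n x) *\<^sub>R differential (V n) x) \<bullet> k)) (at x)" for n x
    using has_derivative_compose[OF smooth_has_derivative[OF V(1)[of n]] hd[OF V(2), unfolded has_field_derivative_def]]
    by simp
  have dU: "differential (U n) x = h (V n x) *\<^sub>R differential \<zeta> x + (\<zeta> x * h' (V n x)) *\<^sub>R differential (V n) x" for n x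
    unfolding U_def
    using has_derivative_mult[OF smooth_has_derivative[OF \<zeta>] hV]
    by (intro differential_eq) (simp add: inner_add_left algebra_simps)
  have Vt: "tendsto_Lp p (leb r) (\<lambda>n. differential (V n)) D"
    using V(5) by (simp add: tendsto_Lp_def nn_integral_leb)
  have fin\<zeta>: "(\<integral>\<^sup>+x. ennreal (norm (differential \<zeta> x) powr p) \<partial>leb r) < \<infinity>"
    by (rule nn_integral_leb_bounded[where C="Z1 powr p"])
       (use Z1 p in \<open>auto simp: AE_leb intro!: powr_mono2\<close>)
  have t1: "tendsto_Lp p (leb r) (\<lambda>n x. h (V n x) *\<^sub>R differential \<zeta> x) (\<lambda>x. h (v x) *\<^sub>R differential \<zeta> x)"
  proof (rule tendsto_Lp_scaleR)
    show "tendsto_Lp p (leb r) (\<lambda>n. differential \<zeta>) (differential \<zeta>)" by (simp add: tendsto_Lp_def)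
    show "AE x in leb r. \<forall>n. \<bar>h (V n x)\<bar> \<le> C0"
      using C0 V(2,3) by (auto simp: AE_leb)
    show "AE x in leb r. (\<lambda>n. h (V n x)) \<longlonglongrightarrow> h (v x)"
      using vb by eventually_elim (use hlim[OF hc] in blast)
  qed (use p1 fin\<zeta> in auto)
  have b2: "\<bar>\<zeta> x * h' t\<bar> \<le> Z0 * C1" if "norm x \<le> r" "L \<le> t" "t \<le> M" for x t
    using that Z0 C1[of t] by (auto simp: abs_mult intro!: mult_mono)
  have t2: "tendsto_Lp p (leb r) (\<lambda>n x. (\<zeta> x * h' (V n x)) *\<^sub>R differential (V n) x) (\<lambda>x. (\<zeta> x * h' (v x)) *\<^sub>R D x)"
  proof (rule tendsto_Lp_scaleR[OF _ _ _ _ p1(2) Vt D_fin_leb])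
    show "AE x in leb r. \<forall>n. \<bar>\<zeta> x * h' (V n x)\<bar> \<le> Z0 * C1"
      using b2 V(2,3) by (auto simp: AE_leb)
    show "AE x in leb r. (\<lambda>n. \<zeta> x * h' (V n x)) \<longlonglongrightarrow> \<zeta> x * h' (v x)"
      using vb by eventually_elim (auto intro!: tendsto_mult hlim[OF h'c])
  qed auto
  show ?thesis
  proof (rule that[of U])
    show "smooth (U n)" for n unfolding U_def by (intro smooth_mult \<zeta> hs V)
    show "U n x = 0" if "\<zeta> x = 0" for n x using that by (simp add: U_def)
    show "AE x in leb r. (\<lambda>n. U n x) \<longlonglongrightarrow> \<zeta> x * h (v x)"
      unfolding U_def using vb by eventually_elim (auto intro!: tendsto_mult hlim[OF hc])
    have "tendsto_Lp p (leb r) (\<lambda>n x. h (V n x) *\<^sub>R differential \<zeta> x + (\<zeta> x * h' (V n x)) *\<^sub>R differential (V n) x)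
      (\<lambda>x. h (v x) *\<^sub>R differential \<zeta> x + (\<zeta> x * h' (v x)) *\<^sub>R D x)"
      using p by (intro tendsto_Lp_add t1 t2) auto
    then show "tendsto_Lp p (leb r) (\<lambda>n. differential (U n)) (\<lambda>x. h (v x) *\<^sub>R differential \<zeta> x + (\<zeta> x * h' (v x)) *\<^sub>R D x)"
      by (simp add: dU[abs_def])
    have "(\<integral>\<^sup>+x. ennreal (norm (h (v x) *\<^sub>R differential \<zeta> x + (\<zeta> x * h' (v x)) *\<^sub>R D x) powr p) \<partial>leb r) \<le>
      ennreal (2 powr p) * ((\<integral>\<^sup>+x. ennreal (norm (h (v x) *\<^sub>R differential \<zeta> x) powr p) \<partial>leb r)
        + (\<integral>\<^sup>+x. ennreal (norm ((\<zeta> x * h' (v x)) *\<^sub>R D x) powr p) \<partial>leb r))"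
      using p by (intro nn_integral_powr_add_le) auto
    also have "\<dots> < \<infinity>"
    proof -
      have 1: "(\<integral>\<^sup>+x. ennreal (norm (h (v x) *\<^sub>R differential \<zeta> x) powr p) \<partial>leb r) < \<infinity>"
      proof (rule nn_integral_leb_bounded[where C="(C0 * Z1) powr p"])
        show "AE x in leb r. norm (h (v x) *\<^sub>R differential \<zeta> x) powr p \<le> (C0 * Z1) powr p"
          using vb
        proof eventually_elim
          case (elim x)
          then have "\<bar>h (v x)\<bar> * norm (differential \<zeta> x) \<le> C0 * Z1"
            using C0[of "v x"] Z1(2)[of x] by (intro mult_mono) auto
          then show ?case using p by (auto intro!: powr_mono2)
        qed
      qed
      have "(\<integral>\<^sup>+x. ennreal (norm ((\<zeta> x * h' (v x)) *\<^sub>R D x) powr p) \<partial>leb r) \<le>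
        (\<integral>\<^sup>+x. ennreal (\<bar>Z0 * C1\<bar> powr p) * ennreal (norm (D x) powr p) \<partial>leb r)"
      proof (rule nn_integral_mono_AE)
        show "AE x in leb r. ennreal (norm ((\<zeta> x * h' (v x)) *\<^sub>R D x) powr p) \<le> ennreal (\<bar>Z0 * C1\<bar> powr p) * ennreal (norm (D x) powr p)"
          using vb
        proof eventually_elim
          case (elim x)
          then have "\<bar>\<zeta> x * h' (v x)\<bar> \<le> \<bar>Z0 * C1\<bar>" using b2[of x "v x"] by linarith
          then have "(\<bar>\<zeta> x * h' (v x)\<bar> * norm (D x)) powr p \<le> (\<bar>Z0 * C1\<bar> * norm (D x)) powr p"
            using p by (intro powr_mono2 mult_right_mono) auto
          also have "\<dots> = \<bar>Z0 * C1\<bar> powr p * norm (D x) powr p" by (simp add: powr_mult)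
          finally show ?case by (auto simp: ennreal_mult[symmetric] intro!: ennreal_leI)
        qed
      qed
      also have "\<dots> < \<infinity>" using D_fin_leb[of r] by (simp add: nn_integral_cmult ennreal_mult_less_top)
      finally show ?thesis using 1 by (simp add: ennreal_mult_less_top)
    qed
    finally show "(\<integral>\<^sup>+x. ennreal (norm (h (v x) *\<^sub>R differential \<zeta> x + (\<zeta> x * h' (v x)) *\<^sub>R D x) powr p) \<partial>leb r) < \<infinity>" .
  qed
qed

text \<open>The smooth approximants of \<zeta> h(v) vanish outside the ball, hence are admissible in
  the weak equation. The weight is bounded on the ball, so the flux has growth |D|^(p-1) and
  \<open>pairing_eq_0\<close> passes to the limit. Integrability is stated as well, since the value
  0 alone could be the default of the integral.\<close>

lemma nonlinear_test:
  assumes L: "AE x in lborel. L \<le> v x"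
    and hs: "\<And>u. smooth u \<Longrightarrow> (\<And>x. L \<le> u x) \<Longrightarrow> smooth (\<lambda>x::real^2. h (u x))"
    and hd: "\<And>t. t \<ge> L \<Longrightarrow> (h has_real_derivative h' t) (at t)"
    and h'c: "continuous_on {L..} h'"
    and [measurable]: "h \<in> borel_measurable borel" "h' \<in> borel_measurable borel"
    and \<zeta>: "smooth \<zeta>" "\<And>x. norm x \<ge> r \<Longrightarrow> \<zeta> x = 0"
  shows "integrable (leb r) (\<lambda>x. flux x \<bullet> (h (v x) *\<^sub>R differential \<zeta> x + (\<zeta> x * h' (v x)) *\<^sub>R D x))"
    "(\<integral>x. flux x \<bullet> (h (v x) *\<^sub>R differential \<zeta> x + (\<zeta> x * h' (v x)) *\<^sub>R D x) \<partial>leb r) = 0"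
proof -
  let ?G = "\<lambda>x. h (v x) *\<^sub>R differential \<zeta> x + (\<zeta> x * h' (v x)) *\<^sub>R D x"
  obtain U where U: "\<And>n::nat. smooth (U n)" "\<And>n x. \<zeta> x = 0 \<Longrightarrow> U n x = 0"
    "tendsto_Lp p (leb r) (\<lambda>n. differential (U n)) ?G"
    "(\<integral>\<^sup>+x. ennreal (norm (?G x) powr p) \<partial>leb r) < \<infinity>"
    by (rule chain_approximation[OF L hs hd h'c assms(5,6) \<zeta>(1), of r]) blast+
  have U0: "U n x = 0" if "norm x > r" for n x using that by (intro U(2) \<zeta>(2)) simp
  have zero: "(\<integral>x. flux x \<bullet> differential (U n) x \<partial>leb r) = 0" for n
  proof -
    note [measurable] = smooth_differential_borel[OF U(1)]
    have "(\<integral>x. flux x \<bullet> differential (U n) x \<partial>leb r) = (\<integral>x. flux x \<bullet> differential (U n) x \<partial>lborel)"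
    proof (rule integral_leb)
      show "flux x \<bullet> differential (U n) x = 0" if "norm x > r" for x
        using differential_outside[of r "U n", OF U0 that] by simp
    qed measurable
    also have "\<dots> = 0" by (intro flux_test test_functionI[OF U(1) U0])
    finally show ?thesis .
  qed
  note [measurable] = smooth_borel[OF \<zeta>(1)] smooth_differential_borel[OF \<zeta>(1)] smooth_differential_borel[OF U(1)]
  have fl: "AE x in leb r. norm (flux x) \<le> (1 + r\<^sup>2) powr (p / 2) * norm (D x) powr (p - 1)"
    unfolding norm_flux by (auto simp: AE_leb intro!: mult_right_mono weight_le)
  have meas: "\<And>n. differential (U n) \<in> borel_measurable (leb r)" "?G \<in> borel_measurable (leb r)"
    "flux \<in> borel_measurable (leb r)" "(\<lambda>x. norm (D x)) \<in> borel_measurable (leb r)"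
    by measurable
  have p1: "p \<ge> 1" using p by simp
  show "integrable (leb r) (\<lambda>x. flux x \<bullet> ?G x)" "(\<integral>x. flux x \<bullet> ?G x \<partial>leb r) = 0"
    by (rule pairing_eq_0[OF meas p1 U(3,4) D_fin_leb norm_ge_zero fl zero])+
qed

end

section \<open>Comparison principle\<close>

lemma emeasure_cball_finite: "emeasure lborel (cball (c::'a::euclidean_space) r) = ennreal (measure lborel (cball c r))"
  using emeasure_bounded_finite[of "cball c r"] by (intro emeasure_eq_ennreal_measure) auto

lemma AE_ex_in_cball:
  assumes "AE x in lborel. P x" "r > 0"
  obtains x :: "'a::euclidean_space" where "norm x \<le> r" "P x"
proof (rule ccontr)
  note ex = that
  assume "\<not> thesis"
  then have "\<not> P x" if "norm x \<le> r" for x using ex[OF that] by blast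
  with assms(1) have "AE x in lborel. x \<notin> cball (0::'a) r" by (auto elim!: eventually_mono)
  then have "emeasure lborel (cball (0::'a) r) = 0"
    by (subst (asm) AE_iff_measurable[of "cball (0::'a) r"]) auto
  then show False
    using content_cball_pos[OF assms(2), of "0::'a"] by (simp add: emeasure_cball_finite)
qed

text \<open>Morrey's estimate as stated is not homogeneous in \<open>U\<close>; applying it to large multiples of \<open>U\<close> gives smallness.\<close>

lemma gradient_tendsto_0_imp_tendsto_0:
  fixes U :: "nat \<Rightarrow> real^'n::finite \<Rightarrow> real"
  assumes U: "\<And>n. smooth (U n)" "\<And>n x. norm x \<ge> R \<Longrightarrow> U n x = 0" and R: "R > 0"
    and p: "p > real CARD('n) + 1"
    and lim: "(\<lambda>n. \<integral>\<^sup>+x\<in>cball 0 R. ennreal (norm (differential (U n) x) powr p) \<partial>lborel) \<longlonglongrightarrow> 0"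
    and x: "norm x \<le> R"
  shows "(\<lambda>n. U n x) \<longlonglongrightarrow> 0"
proof (rule tendstoI)
  fix e :: real assume e: "e > 0"
  define K where "K = (p - 1) / (p - 1 - real CARD('n))"
  have K: "K > 0" using p by (simp add: K_def)
  \<comment> \<open>The multiple \<open>l\<close> is chosen so that 2(K + 1)/l < e. Below,
    \<open>I\<close> is the energy for which the second Morrey term equals 1, and \<open>k\<close>
    the energy of \<open>U n\<close> for which l times \<open>U n\<close> has energy at most
    \<open>I\<close>.\<close>
  define l where "l = (2 * (K + 1) + 1) / e"
  have l: "l > 0" using K e by (simp add: l_def)
  define m where "m = measure lborel (cball (0::real^'n) R)"
  have m: "m > 0" using content_cball_pos[OF R, of "0::real^'n"] by (simp add: m_def)
  define I where "I = m / ((2 * R) powr p)"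
  have I: "I > 0" using m R by (simp add: I_def)
  define k where "k = I / l powr p"
  have k: "k > 0" using I l by (simp add: k_def)
  \<comment> \<open>A boundary point, where every \<open>U n\<close> vanishes.\<close>
  define y where "y = R *\<^sub>R axis (undefined :: 'n) (1::real)"
  have y: "norm y = R" using R by (simp add: y_def)
  have "\<forall>\<^sub>F n in sequentially. (\<integral>\<^sup>+x\<in>cball 0 R. ennreal (norm (differential (U n) x) powr p) \<partial>lborel) < ennreal k"
    using order_tendstoD(2)[OF lim, of "ennreal k"] k by simp
  then show "\<forall>\<^sub>F n in sequentially. dist (U n x) 0 < e"
  proof eventually_elim
    case (elim n)
    define W where "W z = l * U n z" for z
    have sW: "smooth W" unfolding W_def by (intro smooth_mult U) simp
    have dW: "differential W z = l *\<^sub>R differential (U n) z" for z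
      unfolding W_def
      using has_derivative_mult_right[OF smooth_has_derivative[OF U(1)], of l n z]
      by (intro differential_eq) simp
    note [measurable] = smooth_differential_borel[OF U(1)]
    have "(\<integral>\<^sup>+z\<in>cball 0 R. ennreal (norm (differential W z) powr p) \<partial>lborel)
      = (\<integral>\<^sup>+z. ennreal (l powr p) * (ennreal (norm (differential (U n) z) powr p) * indicator (cball 0 R) z) \<partial>lborel)"
      using l by (intro nn_integral_cong) (simp add: dW powr_mult ennreal_mult mult.assoc)
    also have "\<dots> = ennreal (l powr p) * (\<integral>\<^sup>+z\<in>cball 0 R. ennreal (norm (differential (U n) z) powr p) \<partial>lborel)"
      by (rule nn_integral_cmult) measurable
    also have "\<dots> \<le> ennreal (l powr p) * ennreal k"
      using elim by (intro mult_left_mono) auto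
    also have "\<dots> = ennreal I" using l k by (simp add: k_def flip: ennreal_mult)
    finally have IW: "(\<integral>\<^sup>+z\<in>cball 0 R. ennreal (norm (differential W z) powr p) \<partial>lborel) \<le> ennreal I" .
    have "\<bar>W x - W y\<bar> \<le> 2 * ((p - 1) / (p - 1 - real CARD('n)) + (2 * R) powr p * I / m)"
    proof (rule morrey[OF sW _ _ _ _ _ _ p IW])
      show "norm (z - w) \<le> 2 * R" if "z \<in> cball 0 R" "w \<in> cball 0 R" for z w :: "real^'n"
        using that norm_triangle_ineq4[of z w] by simp
    qed (use R x y I m in \<open>auto simp: emeasure_cball_finite m_def\<close>)
    also have "\<dots> = 2 * (K + 1)" using m R by (simp add: I_def K_def)
    finally have "l * \<bar>U n x\<bar> \<le> 2 * (K + 1)" using l y U(2)[of y n] by (simp add: W_def abs_mult)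
    then have "\<bar>U n x\<bar> \<le> 2 * (K + 1) / l" using l by (simp add: pos_le_divide_eq mult.commute)
    also have "\<dots> < e" using e K by (simp add: l_def field_simps add_pos_pos)
    finally show ?case by simp
  qed
qed

context weighted_solution
begin

text \<open>The test function is the cutoff times a smooth increasing function of the positive part of \<open>\<sigma> (v - m)\<close>,
  which by assumption vanishes wherever the cutoff is not locally constant.\<close>

lemma comparison_principle:
  assumes L: "AE x in lborel. L \<le> v x" and \<sigma>: "\<sigma> = 1 \<or> \<sigma> = -1" and R: "R > 0"
    and ann: "AE x in lborel. 3/4 * R \<le> norm x \<and> norm x \<le> R \<longrightarrow> \<sigma> * (v x - m) \<le> 0"
  shows "AE x in lborel. norm x \<le> R \<longrightarrow> \<sigma> * (v x - m) \<le> 0"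
proof -
  have p1: "p > 1" using p by simp
  obtain \<zeta> :: "real^2 \<Rightarrow> real" where \<zeta>: "test_function \<zeta>" "\<And>x. 0 \<le> \<zeta> x" 
     "\<And>x. norm x \<le> 3/4 * R \<Longrightarrow> \<zeta> x = 1" "\<And>x. norm x \<ge> R \<Longrightarrow> \<zeta> x = 0"
    using cutoff_exists[OF p1, where 'n=2] R by metis
  have s\<zeta>: "smooth \<zeta>" by (rule test_function_smooth[OF \<zeta>(1)])
  have d\<zeta>: "differential \<zeta> x = 0" if "norm x < 3/4 * R" for x
  proof (rule differential_eq)
    have "((\<lambda>x. 1) has_derivative (\<lambda>h. 0 \<bullet> h)) (at x)" by simp
    then show "(\<zeta> has_derivative (\<lambda>h. 0 \<bullet> h)) (at x)"
      by (rule has_derivative_transform_within_open[where s="ball 0 (3/4 * R)"])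
         (use that \<zeta>(3) in auto)
  qed
  define h where "h t = bump 0 (- \<sigma> * m + \<sigma> * t)" for t
  \<comment> \<open>The derivative of \<open>bump 0\<close> is \<open>bump 2\<close>. The inner
    derivative \<sigma> will be multiplied by another \<sigma>, which makes the tested expression
    nonnegative for both signs.\<close>
  define h' where "h' t = \<sigma> * bump 2 (- \<sigma> * m + \<sigma> * t)" for t
  have hs: "smooth (\<lambda>x::real^2. h (u x))" if "smooth u" for u
    unfolding h_def by (rule smooth_compose[OF Dk_affine[OF Dk_bump] that, where S=UNIV]) auto
  have hd: "(h has_real_derivative h' t) (at t)" for t
    unfolding h_def h'_def
    by (rule DERIV_chain2[OF has_real_derivative_bump, THEN DERIV_cong])
       (auto intro!: derivative_eq_intros simp: numeral_2_eq_2)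
  have cb: "continuous_on UNIV (bump j)" for j using Dk_bump[of 0 j] by simp
  have h'c: "continuous_on S h'" for S
    unfolding h'_def by (intro continuous_intros continuous_on_compose2[OF cb]) auto
  have [measurable]: "h \<in> borel_measurable borel" "h' \<in> borel_measurable borel"
    using DERIV_isCont[OF hd]
    by (auto intro!: borel_measurable_continuous_onI[OF h'c]
        borel_measurable_continuous_onI[of h] continuous_at_imp_continuous_on)
  note [measurable] = smooth_borel[OF s\<zeta>] smooth_differential_borel[OF s\<zeta>]
  define G where "G x = h (v x) *\<^sub>R differential \<zeta> x + (\<zeta> x * h' (v x)) *\<^sub>R D x" for x
  have [measurable]: "G \<in> borel_measurable borel" unfolding G_def[abs_def] by measurable
  have hv: "AE x in leb R. h (v x) *\<^sub>R differential \<zeta> x = 0"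
    unfolding AE_leb using ann
  proof eventually_elim
    case (elim x)
    show ?case
    proof
      assume x: "norm x \<le> R"
      show "h (v x) *\<^sub>R differential \<zeta> x = 0"
      proof (cases "norm x < 3/4 * R")
        case False
        then have "\<sigma> * (v x - m) \<le> 0" using elim x by auto
        then show ?thesis by (simp add: h_def algebra_simps)
      qed (simp add: d\<zeta>)
    qed
  qed
  have I: "integrable (leb R) (\<lambda>x. flux x \<bullet> G x)" "(\<integral>x. flux x \<bullet> G x \<partial>leb R) = 0"
    unfolding G_def using nonlinear_test[OF L hs hd h'c _ _ s\<zeta> \<zeta>(4)] by auto
  have E: "AE x in leb R. \<sigma> * (flux x \<bullet> G x) = \<zeta> x * bump 2 (- \<sigma> * m + \<sigma> * v x) * (weight x * norm (D x) powr p)"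
    using hv
  proof eventually_elim
    case (elim x)
    have "\<sigma> * \<sigma> = 1" using \<sigma> by auto
    then have *: "\<sigma> * (c * (\<sigma> * d) * e) = c * d * e" for c d e by (metis mult.assoc mult.commute mult.left_neutral)
    have "G x = (\<zeta> x * h' (v x)) *\<^sub>R D x" using elim by (simp add: G_def del: scaleR_eq_0_iff)
    then show ?case by (simp only: inner_scaleR_right flux_inner_D h'_def *)
  qed
  have "(\<integral>x. \<sigma> * (flux x \<bullet> G x) \<partial>leb R) = 0" using I(2) by simp
  moreover have "integrable (leb R) (\<lambda>x. \<sigma> * (flux x \<bullet> G x))" using I(1) by simp
  moreover have "AE x in leb R. 0 \<le> \<sigma> * (flux x \<bullet> G x)"
    using E by eventually_elim (use weight_pos \<zeta>(2) bump_nonneg in \<open>auto intro!: mult_nonneg_nonneg less_imp_le[OF weight_pos]\<close>)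
  ultimately have "AE x in leb R. \<sigma> * (flux x \<bullet> G x) = 0"
    using integral_nonneg_eq_0_iff_AE by blast
  \<comment> \<open>A vanishing energy density forces one of \<zeta>, h'(v) and D to be 0, and each
    of them removes the remaining term of \<open>G\<close>. So the weak differential of \<zeta> h(v)
    vanishes.\<close>
  with E hv have G0: "AE x in leb R. G x = 0"
  proof eventually_elim
    case (elim x)
    then have "\<zeta> x = 0 \<or> h' (v x) = 0 \<or> D x = 0"
      using weight_pos[of x] by (auto simp: h'_def)
    then show ?case using elim(2) by (auto simp: G_def)
  qed
  obtain U where U: "\<And>n::nat. smooth (U n)" "\<And>n x. \<zeta> x = 0 \<Longrightarrow> U n x = 0"
    "AE x in leb R. (\<lambda>n. U n x) \<longlonglongrightarrow> \<zeta> x * h (v x)"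
    "tendsto_Lp p (leb R) (\<lambda>n. differential (U n)) G"
    unfolding G_def[abs_def]
    by (rule chain_approximation[OF L hs hd h'c _ _ s\<zeta>, of R]) (measurable, blast)
  note [measurable] = smooth_differential_borel[OF U(1)]
  have "(\<integral>\<^sup>+x. ennreal (norm (differential (U n) x - G x) powr p) \<partial>leb R) =
    (\<integral>\<^sup>+x\<in>cball 0 R. ennreal (norm (differential (U n) x) powr p) \<partial>lborel)" for n
  proof -
    have "(\<integral>\<^sup>+x. ennreal (norm (differential (U n) x - G x) powr p) \<partial>leb R) =
       (\<integral>\<^sup>+x. ennreal (norm (differential (U n) x) powr p) \<partial>leb R)"
      using G0 by (intro nn_integral_cong_AE) (auto elim!: eventually_mono)
    then show ?thesis by (simp add: nn_integral_leb)
  qed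
  then have lim: "(\<lambda>n. \<integral>\<^sup>+x\<in>cball 0 R. ennreal (norm (differential (U n) x) powr p) \<partial>lborel) \<longlonglongrightarrow> 0"
    using U(4) by (simp add: tendsto_Lp_def)
  \<comment> \<open>The approximants vanish on the boundary and their gradients tend to 0 in the
    p-norm, so Morrey's estimate sends them to 0 at every point. Their almost everywhere limit
    \<zeta> h(v) is therefore 0.\<close>
  have U0: "(\<lambda>n. U n x) \<longlonglongrightarrow> 0" if "norm x \<le> R" for x
    by (rule gradient_tendsto_0_imp_tendsto_0[OF U(1) _ R _ lim that]) (use U(2) \<zeta>(4) p in auto)
  have "AE x in leb R. \<zeta> x * h (v x) = 0"
    using U(3) unfolding AE_leb
  proof eventually_elim
    case (elim x)
    show ?case
    proof
      assume x: "norm x \<le> R"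
      with elim have "(\<lambda>n. U n x) \<longlonglongrightarrow> \<zeta> x * h (v x)" by simp
      from LIMSEQ_unique[OF this U0[OF x]] show "\<zeta> x * h (v x) = 0" .
    qed
  qed
  with ann show ?thesis
    unfolding AE_leb
  proof eventually_elim
    case (elim x)
    show ?case
    proof
      assume x: "norm x \<le> R"
      show "\<sigma> * (v x - m) \<le> 0"
      proof (cases "norm x \<le> 3/4 * R")
        case True
        then have "h (v x) = 0" using elim x \<zeta>(3) by simp
        then show ?thesis using bump_pos[of "- \<sigma> * m + \<sigma> * v x" 0]
          by (force simp: h_def algebra_simps not_le[symmetric])
      qed (use elim x in auto)
    qed
  qed
qed

section \<open>Energy of the logarithm and Harnack inequality\<close>

lemma weight_integrable: "integrable (leb r) weight"
  using nn_integral_leb_bounded[where r=r and f=weight and C="(1 + r\<^sup>2) powr (p / 2)"] weight_pos weight_le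
  by (intro integrableI_nonneg) (auto simp: AE_leb less_imp_le)

lemma weight_integral_le:
  "(\<integral>x. weight x \<partial>leb r) \<le> (1 + r\<^sup>2) powr (p / 2) * measure lborel (cball (0::real^2) r)"
proof -
  interpret finite_measure "leb r :: (real^2) measure" by (rule finite_measure_leb)
  have "(\<integral>x. weight x \<partial>leb r) \<le> (\<integral>x. (1 + r\<^sup>2) powr (p / 2) \<partial>(leb r :: (real^2) measure))"
    using weight_le[of _ r] by (intro integral_mono_AE weight_integrable) (auto simp: AE_leb)
  also have "\<dots> = (1 + r\<^sup>2) powr (p / 2) * measure (leb r) (space (leb r :: (real^2) measure))" by simp
  also have "measure (leb r) (space (leb r :: (real^2) measure)) = measure lborel (cball (0::real^2) r)"
  proof -
    have "emeasure (leb r) (space (leb r :: (real^2) measure)) = (\<integral>\<^sup>+x. 1 \<partial>(leb r :: (real^2) measure))" by simp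
    also have "\<dots> = emeasure lborel (cball (0::real^2) r)" by (subst nn_integral_leb) auto
    finally show ?thesis by (simp add: measure_def)
  qed
  finally show ?thesis .
qed

text \<open>The test function is \<open>\<zeta> (v - L + \<delta>)\<^bsup>1-p\<^esup>\<close>.\<close>

lemma log_energy:
  assumes L: "AE x in lborel. L \<le> v x" and \<delta>: "\<delta> > 0"
    and \<zeta>: "smooth \<zeta>" "\<And>x. norm x \<ge> r \<Longrightarrow> \<zeta> x = 0" "\<And>x. 0 \<le> \<zeta> x"
    and c: "c \<ge> 0" "\<And>x. norm (differential \<zeta> x) \<le> c * \<zeta> x powr ((p - 1) / p)"
  shows "(\<integral>\<^sup>+x. ennreal (weight x * (\<zeta> x * (norm (D x) / (v x - L + \<delta>)) powr p)) \<partial>leb r) \<le>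
    ennreal (c powr p * (\<integral>x. weight x \<partial>leb r) / (p - 2))"
proof -
  define h where "h t = ((\<delta> - L) + 1 * t) powr (1 - p)" for t
  define h' where "h' t = (1 - p) * ((\<delta> - L) + 1 * t) powr (- p)" for t
  have hs: "smooth (\<lambda>x::real^2. h (u x))" if "smooth u" "\<And>x. L \<le> u x" for u
    unfolding h_def by (rule smooth_compose[OF Dk_affine[OF Dk_powr] that(1), where S="{L..}"]) (use that \<delta> in auto)
  have hd: "(h has_real_derivative h' t) (at t)" if "t \<ge> L" for t
  proof -
    have "((\<lambda>s. s powr (1 - p)) has_real_derivative (1 - p) * ((\<delta> - L) + 1 * t) powr (1 - p - 1)) (at ((\<delta> - L) + 1 * t))"
      using that \<delta> by (intro has_real_derivative_powr) simp
    moreover have "((\<lambda>t. (\<delta> - L) + 1 * t) has_real_derivative 1) (at t)"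
      by (auto intro!: derivative_eq_intros)
    ultimately show ?thesis
      unfolding h_def h'_def by (rule DERIV_chain2[THEN DERIV_cong]) simp
  qed
  have h'c: "continuous_on {L..} h'"
    unfolding h'_def using \<delta> by (intro continuous_intros) auto
  have [measurable]: "h \<in> borel_measurable borel" "h' \<in> borel_measurable borel"
    unfolding h_def[abs_def] h'_def[abs_def] by measurable
  note [measurable] = smooth_borel[OF \<zeta>(1)] smooth_differential_borel[OF \<zeta>(1)]
  define E where "E x = flux x \<bullet> (h (v x) *\<^sub>R differential \<zeta> x + (\<zeta> x * h' (v x)) *\<^sub>R D x)" for x
  have I: "integrable (leb r) E" "(\<integral>x. E x \<partial>leb r) = 0"
    unfolding E_def[abs_def] using nonlinear_test[OF L hs hd h'c _ _ \<zeta>(1,2)] by auto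
  define X where "X x = weight x * (\<zeta> x * (norm (D x) / (v x - L + \<delta>)) powr p)" for x
  have [measurable]: "X \<in> borel_measurable borel" unfolding X_def[abs_def] by measurable
  have X0: "X x \<ge> 0" for x unfolding X_def using weight_pos[of x] \<zeta>(3) by simp
  have key: "AE x in lborel. (p - 2) * X x \<le> c powr p * weight x - E x"
    using L
  proof eventually_elim
    case (elim x)
    define w where "w = v x - L + \<delta>"
    have w: "w > 0" using elim \<delta> by (simp add: w_def)
    have we: "(\<delta> - L) + 1 * v x = w" by (simp add: w_def)
    \<comment> \<open>The cutoff enters as \<zeta>^(1/p): then a^p is the density of
      \<open>X\<close> without the weight, and a^(p-1) contains exactly the power \<zeta>^((p-1)/p)
      of the gradient bound.\<close>
    define a where "a = \<zeta> x powr (1 / p) * (norm (D x) / w)"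
    have a0: "a \<ge> 0" using w by (simp add: a_def)
    have ap: "a powr p = \<zeta> x * (norm (D x) / w) powr p"
    proof -
      have "a powr p = (\<zeta> x powr (1 / p)) powr p * (norm (D x) / w) powr p"
        unfolding a_def by (rule powr_mult)
      then show ?thesis using p \<zeta>(3)[of x] by (simp add: powr_powr)
    qed
    have Xa: "X x = weight x * a powr p" by (simp add: X_def ap w_def)
    have ap1: "a powr (p - 1) = \<zeta> x powr ((p - 1) / p) * norm (D x) powr (p - 1) * w powr (1 - p)"
    proof -
      have "a powr (p - 1) = \<zeta> x powr ((p - 1) / p) * (norm (D x) powr (p - 1) / w powr (p - 1))"
      proof -
        have "a powr (p - 1) = (\<zeta> x powr (1 / p)) powr (p - 1) * (norm (D x) / w) powr (p - 1)"
          unfolding a_def by (rule powr_mult)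
        then show ?thesis using w by (simp add: powr_powr powr_divide)
      qed
      also have "1 / w powr (p - 1) = w powr (1 - p)" using w powr_minus_divide[of w "p - 1"] by simp
      then have "norm (D x) powr (p - 1) / w powr (p - 1) = norm (D x) powr (p - 1) * w powr (1 - p)"
        by (simp add: divide_inverse)
      finally show ?thesis by (simp add: mult.assoc)
    qed
    have "flux x \<bullet> differential \<zeta> x \<le> norm (flux x) * norm (differential \<zeta> x)"
      using Cauchy_Schwarz_ineq2[of "flux x" "differential \<zeta> x"] by linarith
    also have "\<dots> \<le> norm (flux x) * (c * \<zeta> x powr ((p - 1) / p))"
      by (intro mult_left_mono c) auto
    finally have "w powr (1 - p) * (flux x \<bullet> differential \<zeta> x) \<le> w powr (1 - p) * (norm (flux x) * (c * \<zeta> x powr ((p - 1) / p)))"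
      by (rule mult_left_mono) simp
    also have "\<dots> = weight x * (a powr (p - 1) * c)" by (simp add: norm_flux ap1 mult_ac)
    also have "\<dots> \<le> weight x * (a powr p + c powr p)"
      using young_scaled[OF a0 c(1), of 1 p] p weight_pos[of x] by (intro mult_left_mono) auto
    finally have 1: "w powr (1 - p) * (flux x \<bullet> differential \<zeta> x) \<le> X x + c powr p * weight x"
      by (simp add: Xa algebra_simps)
    have 2: "\<zeta> x * w powr (- p) * (weight x * norm (D x) powr p) = X x"
      using w by (simp add: Xa ap powr_divide powr_minus_divide)
    have "E x = w powr (1 - p) * (flux x \<bullet> differential \<zeta> x) + (1 - p) * (\<zeta> x * w powr (- p) * (weight x * norm (D x) powr p))"
      unfolding E_def h_def h'_def we by (simp add: inner_add_right flux_inner_D algebra_simps)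
    \<comment> \<open>Differentiating the power gives (1 - p) X, and Young's inequality with s = 1
      gives back one X. What survives is -(p - 2) X, the source of the denominator p - 2.\<close>
    then have "E x \<le> X x + c powr p * weight x + (1 - p) * X x" using 1 2 by simp
    then show ?case by (simp add: algebra_simps)
  qed
  have "(\<integral>\<^sup>+x. ennreal (X x) \<partial>leb r) \<le> (\<integral>\<^sup>+x. ennreal ((c powr p * weight x - E x) / (p - 2)) \<partial>leb r)"
    using key p by (intro nn_integral_mono_AE) (auto simp: AE_leb pos_le_divide_eq mult.commute elim!: eventually_mono intro!: ennreal_leI)
  also have "\<dots> = ennreal (\<integral>x. (c powr p * weight x - E x) / (p - 2) \<partial>leb r)"
  proof (rule nn_integral_eq_integral)
    show "integrable (leb r) (\<lambda>x. (c powr p * weight x - E x) / (p - 2))"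
      using I(1) weight_integrable by auto
    show "AE x in leb r. 0 \<le> (c powr p * weight x - E x) / (p - 2)"
      unfolding AE_leb using key
    proof eventually_elim
      case (elim x)
      have "0 \<le> (p - 2) * X x" using p X0 by simp
      then show ?case using elim p by simp
    qed
  qed
  also have "(\<integral>x. (c powr p * weight x - E x) / (p - 2) \<partial>leb r) = c powr p * (\<integral>x. weight x \<partial>leb r) / (p - 2)"
    using I weight_integrable by simp
  finally show ?thesis by (simp add: X_def)
qed

end

lemma measure_cball_2_le:
  assumes "r \<ge> 0"
  shows "measure lborel (cball (0::real^2) r) \<le> 4 * r\<^sup>2"
proof -
  define a b :: "real^2" where "a = vector [- r, - r]" and "b = vector [r, r]"
  have "cball 0 r \<subseteq> cbox a b"
  proof
    fix x :: "real^2" assume "x \<in> cball 0 r"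
    then show "x \<in> cbox a b"
      using component_le_norm_cart[of x 1] component_le_norm_cart[of x 2]
      by (auto simp: mem_box_cart forall_2 a_def b_def)
  qed
  then have "measure lborel (cball (0::real^2) r) \<le> measure lborel (cbox a b)"
    by (intro measure_mono_fmeasurable) auto
  also have "cbox a b \<noteq> {}" using \<open>cball 0 r \<subseteq> cbox a b\<close> assms by force
  then have "measure lborel (cbox a b) = 4 * r\<^sup>2"
    by (simp add: content_cbox_cart UNIV_2 a_def b_def power2_eq_square)
  finally show ?thesis .
qed

context weighted_solution
begin

text \<open>\<open>H\<close> is quantified before \<open>L\<close>, \<open>\<delta>\<close> and
  \<open>R\<close>, on which the limit argument relies. The predicate \<open>P\<close>, true almost
  everywhere, gives a two-point inequality a meaning for a class of functions: at such points of the
  annulus the smooth approximants of the logarithm converge.\<close>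

lemma harnack:
  "\<exists>H. \<forall>L \<delta> R. (AE x in lborel. L \<le> v x) \<longrightarrow> \<delta> > 0 \<longrightarrow> R \<ge> 1 \<longrightarrow>
    (\<exists>P. (AE x in lborel. P x) \<and> (\<forall>x y. P x \<longrightarrow> P y \<longrightarrow> 3/2 * R \<le> norm x \<longrightarrow> norm x \<le> 2 * R \<longrightarrow>
       3/2 * R \<le> norm y \<longrightarrow> norm y \<le> 2 * R \<longrightarrow> v x - L + \<delta> \<le> exp H * (v y - L + \<delta>)))"
proof -
  have p1: "p > 1" using p by simp
  obtain C where C: "C > 0" 
    "\<And>R. R > 0 \<Longrightarrow> \<exists>\<zeta> :: real^2 \<Rightarrow> real. test_function \<zeta> \<and> (\<forall>x. 0 \<le> \<zeta> x \<and> \<zeta> x \<le> 1) \<and>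
       (\<forall>x. norm x \<le> 3/4 * R \<longrightarrow> \<zeta> x = 1) \<and> (\<forall>x. norm x \<ge> R \<longrightarrow> \<zeta> x = 0) \<and>
       (\<forall>x. norm (differential \<zeta> x) \<le> C / R * \<zeta> x powr ((p - 1) / p))"
    using cutoff_exists[OF p1, where 'n=2] by metis
  \<comment> \<open>C / 4 comes from a cutoff of radius 4R, 17 from 1 + (4R)^2 \<le> 17 R^2 for R
    \<ge> 1, 64 from the area bound 4 (4R)^2, and p - 2 from \<open>log_energy\<close>.\<close>
  define C1 where "C1 = (C / 4) powr p * 17 powr (p / 2) * 64 / (p - 2)"
  have C1: "C1 \<ge> 0" using p by (simp add: C1_def)
  \<comment> \<open>The annulus estimate at energy 2^p (C1 + 1) R^(2-p): the powers of R cancel, and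
    5^p 2^p = 10^p.\<close>
  define H where "H = 8 * ((p - 1) / (p - 3) + 10 powr p * (C1 + 1) / 4)"
  show ?thesis
  proof (intro exI[of _ H] allI impI)
    fix L \<delta> R :: real
    assume L: "AE x in lborel. L \<le> v x" and \<delta>: "\<delta> > 0" and R: "R \<ge> 1"
    have R0: "R > 0" "4 * R > 0" using R by auto
    define w where "w x = v x - L + \<delta>" for x
    have [measurable]: "w \<in> borel_measurable borel" unfolding w_def[abs_def] by measurable
    \<comment> \<open>Radius 4R makes the cutoff equal to 1 up to 3/4 * 4R = 3R, the outer radius of
      the wide annulus.\<close>
    obtain \<zeta> :: "real^2 \<Rightarrow> real" where \<zeta>: "test_function \<zeta>" "\<And>x. 0 \<le> \<zeta> x"
      "\<And>x. norm x \<le> 3/4 * (4 * R) \<Longrightarrow> \<zeta> x = 1" "\<And>x. norm x \<ge> 4 * R \<Longrightarrow> \<zeta> x = 0"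
      "\<And>x. norm (differential \<zeta> x) \<le> C / (4 * R) * \<zeta> x powr ((p - 1) / p)"
      using C(2)[OF R0(2)] by blast
    note s\<zeta> = test_function_smooth[OF \<zeta>(1)]
    note [measurable] = smooth_borel[OF s\<zeta>]
    have Rp: "(R\<^sup>2) powr (p / 2) = R powr p"
    proof -
      have "R\<^sup>2 = R powr 2" using R0 by simp
      then show ?thesis by (simp only: powr_powr) simp
    qed
    have J: "(\<integral>x. weight x \<partial>leb (4 * R)) \<le> 17 powr (p / 2) * R powr p * (64 * R\<^sup>2)"
    proof -
      have "1 \<le> R\<^sup>2" using R by (simp add: one_le_power)
      then have "(1 + (4 * R)\<^sup>2) powr (p / 2) \<le> (17 * R\<^sup>2) powr (p / 2)"
        using p by (intro powr_mono2) (auto simp: power_mult_distrib)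
      also have "\<dots> = 17 powr (p / 2) * (R\<^sup>2) powr (p / 2)" by (rule powr_mult)
      finally have 1: "(1 + (4 * R)\<^sup>2) powr (p / 2) \<le> 17 powr (p / 2) * R powr p" by (simp only: Rp)
      have 2: "measure lborel (cball (0::real^2) (4 * R)) \<le> 64 * R\<^sup>2"
        using measure_cball_2_le[of "4 * R"] R0 by (simp add: power_mult_distrib)
      show ?thesis
        using weight_integral_le[of "4 * R"] mult_mono[OF 1 2] by (simp add: measure_nonneg)
    qed
    have cp: "(C / (4 * R)) powr p = (C / 4) powr p / R powr p"
      using C(1) R0 powr_divide[of "C / 4" R p] by simp
    have E: "(\<integral>\<^sup>+x. ennreal (weight x * (\<zeta> x * (norm (D x) / w x) powr p)) \<partial>leb (4 * R)) \<le> ennreal (C1 * R\<^sup>2)"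
    proof -
      have "(\<integral>\<^sup>+x. ennreal (weight x * (\<zeta> x * (norm (D x) / w x) powr p)) \<partial>leb (4 * R))
        \<le> ennreal ((C / (4 * R)) powr p * (\<integral>x. weight x \<partial>leb (4 * R)) / (p - 2))"
        unfolding w_def by (rule log_energy[OF L \<delta> s\<zeta> \<zeta>(4,2) _ \<zeta>(5)]) (use C R0 in auto)
      also have "\<dots> \<le> ennreal (C1 * R\<^sup>2)"
      proof (rule ennreal_leI)
        have "(C / (4 * R)) powr p * (\<integral>x. weight x \<partial>leb (4 * R)) / (p - 2)
          \<le> (C / (4 * R)) powr p * (17 powr (p / 2) * R powr p * (64 * R\<^sup>2)) / (p - 2)"
          using p J by (intro divide_right_mono mult_left_mono) auto
        also have "\<dots> = C1 * R\<^sup>2" using R0 by (simp add: cp C1_def)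
        finally show "(C / (4 * R)) powr p * (\<integral>x. weight x \<partial>leb (4 * R)) / (p - 2) \<le> C1 * R\<^sup>2" .
      qed
      finally show ?thesis .
    qed
    define T where "T = {z :: real^2. R \<le> norm z \<and> norm z \<le> 3 * R}"
    have [measurable]: "T \<in> sets borel" unfolding T_def by measurable
    have ET: "(\<integral>\<^sup>+x\<in>T. ennreal ((norm (D x) / w x) powr p) \<partial>lborel) \<le> ennreal (C1 * R\<^sup>2 / R powr p)"
    proof -
      have "(\<integral>\<^sup>+x\<in>T. ennreal ((norm (D x) / w x) powr p) \<partial>lborel) \<le>
        (\<integral>\<^sup>+x. ennreal (1 / R powr p) * (ennreal (weight x * (\<zeta> x * (norm (D x) / w x) powr p)) * indicator (cball 0 (4 * R)) x) \<partial>lborel)"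
      proof (intro nn_integral_mono)
        fix x :: "real^2"
        show "ennreal ((norm (D x) / w x) powr p) * indicator T x \<le>
          ennreal (1 / R powr p) * (ennreal (weight x * (\<zeta> x * (norm (D x) / w x) powr p)) * indicator (cball 0 (4 * R)) x)"
        proof (cases "x \<in> T")
          case True
          then have x: "R \<le> norm x" "norm x \<le> 3 * R" by (auto simp: T_def)
          then have "\<zeta> x = 1" using \<zeta>(3)[of x] by simp
          moreover have "R powr p \<le> weight x" using weight_ge[of R x] R0 x by simp
          then have "(norm (D x) / w x) powr p \<le> 1 / R powr p * (weight x * (norm (D x) / w x) powr p)"
            using R0 mult_right_mono[of "R powr p" "weight x" "(norm (D x) / w x) powr p"]
            by (simp add: pos_le_divide_eq mult.commute)
          ultimately show ?thesis using True x R0 weight_pos[of x]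
            by (simp add: ennreal_mult[symmetric] ennreal_leI)
        qed simp
      qed
      also have "\<dots> = ennreal (1 / R powr p) * (\<integral>\<^sup>+x. ennreal (weight x * (\<zeta> x * (norm (D x) / w x) powr p)) \<partial>leb (4 * R))"
        by (simp add: nn_integral_leb nn_integral_cmult)
      also have "\<dots> \<le> ennreal (1 / R powr p) * ennreal (C1 * R\<^sup>2)"
        by (intro mult_left_mono E) simp
      also have "\<dots> = ennreal (C1 * R\<^sup>2 / R powr p)" using C1 by (simp flip: ennreal_mult)
      finally show ?thesis .
    qed
    define h where "h t = ln ((\<delta> - L) + 1 * t)" for t
    define h' where "h' t = inverse ((\<delta> - L) + 1 * t)" for t
    have hs: "smooth (\<lambda>x::real^2. h (u x))" if "smooth u" "\<And>x. L \<le> u x" for u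
      unfolding h_def by (rule smooth_compose[OF Dk_affine[OF Dk_ln] that(1), where S="{L..}"]) (use that \<delta> in auto)
    have hd: "(h has_real_derivative h' t) (at t)" if "t \<ge> L" for t
      unfolding h_def h'_def using that \<delta>
      by (auto intro!: derivative_eq_intros simp: divide_inverse)
    have h'c: "continuous_on {L..} h'"
      unfolding h'_def using \<delta> by (intro continuous_intros) auto
    have hm: "h \<in> borel_measurable borel" "h' \<in> borel_measurable borel"
      unfolding h_def[abs_def] h'_def[abs_def] by measurable
    note [measurable] = hm
    have d1: "differential (\<lambda>x::real^2. 1) x = 0" for x
      by (rule differential_eq) simp
    define G where "G x = h' (v x) *\<^sub>R D x" for x
    have [measurable]: "G \<in> borel_measurable borel" unfolding G_def[abs_def] by measurable
    obtain U where U: "\<And>n::nat. smooth (U n)"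
      "AE x in leb (3 * R). (\<lambda>n. U n x) \<longlonglongrightarrow> h (v x)"
      "tendsto_Lp p (leb (3 * R)) (\<lambda>n. differential (U n)) G"
      \<comment> \<open>With the constant cutoff 1 the approximants are those of the logarithm
        itself, and the term with the differential of the cutoff drops out.\<close>
      using chain_approximation[OF L hs hd h'c hm smooth_const[of 1], of "3 * R"]
      unfolding G_def[abs_def] d1 by auto
    note [measurable] = smooth_differential_borel[OF U(1)]
    have "AE x in lborel. (norm x \<le> 3 * R \<longrightarrow> (\<lambda>n. U n x) \<longlonglongrightarrow> ln (w x)) \<and> w x > 0"
      using L U(2) unfolding AE_leb
      by eventually_elim (use \<delta> in \<open>auto simp: h_def w_def algebra_simps\<close>)
    moreover define P where "P x \<longleftrightarrow> (norm x \<le> 3 * R \<longrightarrow> (\<lambda>n. U n x) \<longlonglongrightarrow> ln (w x)) \<and> w x > 0" for x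
    ultimately have AEP: "AE x in lborel. P x" by simp
    have GT: "(\<integral>\<^sup>+x\<in>T. ennreal (norm (G x) powr p) \<partial>lborel) \<le> ennreal (C1 * R\<^sup>2 / R powr p)"
    proof -
      have "(\<integral>\<^sup>+x\<in>T. ennreal (norm (G x) powr p) \<partial>lborel) = (\<integral>\<^sup>+x\<in>T. ennreal ((norm (D x) / w x) powr p) \<partial>lborel)"
        using L
      proof (intro nn_integral_cong_AE, eventually_elim)
        case (elim x)
        have "(\<delta> - L) + 1 * v x = w x" by (simp add: w_def)
        then have "norm (G x) = norm (D x) / w x"
          using elim \<delta> unfolding G_def h'_def by (simp add: w_def divide_inverse mult.commute)
        then show ?case by simp
      qed
      then show ?thesis using ET by simp
    qed
    define I where "I = 2 powr p * ((C1 + 1) * R\<^sup>2 / R powr p)"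
    have I0: "I \<ge> 0" using C1 by (simp add: I_def)
    let ?A = "\<lambda>n. \<integral>\<^sup>+x. ennreal (norm (differential (U n) x - G x) powr p) \<partial>leb (3 * R)"
    have "?A \<longlonglongrightarrow> 0" using U(3) by (simp add: tendsto_Lp_def)
    \<comment> \<open>The approximation error is allowed the same scale R^(2-p) as the energy; this
      is the 1 in C1 + 1.\<close>
    then have evA: "\<forall>\<^sub>F n in sequentially. ?A n < ennreal (R\<^sup>2 / R powr p)"
      using order_tendstoD(2)[of ?A 0 sequentially "ennreal (R\<^sup>2 / R powr p)"] R0 by simp
    have osc: "\<forall>\<^sub>F n in sequentially. \<bar>U n x - U n y\<bar> \<le> H"
      if x: "3/2 * R \<le> norm x" "norm x \<le> 2 * R" and y: "3/2 * R \<le> norm y" "norm y \<le> 2 * R" for x y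
      using evA
    proof eventually_elim
      case (elim n)
      have "(\<integral>\<^sup>+x\<in>T. ennreal (norm (differential (U n) x) powr p) \<partial>lborel) \<le>
        (\<integral>\<^sup>+x. ennreal (2 powr p) * (ennreal (norm (differential (U n) x - G x) powr p) * indicator (cball 0 (3 * R)) x
           + ennreal (norm (G x) powr p) * indicator T x) \<partial>lborel)"
      proof (intro nn_integral_mono)
        fix x :: "real^2"
        have "norm (differential (U n) x) powr p \<le> 2 powr p * (norm (differential (U n) x - G x) powr p + norm (G x) powr p)"
          using powr_norm_add_le[of p "differential (U n) x - G x" "G x"] p by simp
        then show "ennreal (norm (differential (U n) x) powr p) * indicator T x \<le>
          ennreal (2 powr p) * (ennreal (norm (differential (U n) x - G x) powr p) * indicator (cball 0 (3 * R)) x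
           + ennreal (norm (G x) powr p) * indicator T x)"
          by (cases "x \<in> T") (auto simp: T_def simp flip: ennreal_plus ennreal_mult intro!: ennreal_leI)
      qed
      also have "\<dots> = ennreal (2 powr p) * (?A n + (\<integral>\<^sup>+x\<in>T. ennreal (norm (G x) powr p) \<partial>lborel))"
        by (simp add: nn_integral_cmult nn_integral_add nn_integral_leb)
      also have "\<dots> \<le> ennreal (2 powr p) * (ennreal (R\<^sup>2 / R powr p) + ennreal (C1 * R\<^sup>2 / R powr p))"
        using elim GT by (intro mult_left_mono add_mono) auto
      also have "\<dots> = ennreal I"
        using C1 by (simp add: I_def algebra_simps add_divide_distrib flip: ennreal_plus ennreal_mult)
      finally have "(\<integral>\<^sup>+x\<in>T. ennreal (norm (differential (U n) x) powr p) \<partial>lborel) \<le> ennreal I" .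
      from annulus_oscillation[OF U(1) R0(1) p this[unfolded T_def] I0 x y]
      have "\<bar>U n x - U n y\<bar> \<le> 8 * ((p - 1) / (p - 3) + (5 * R) powr p * I / (4 * R\<^sup>2))" .
      also have "(5 * R) powr p * I / (4 * R\<^sup>2) = 10 powr p * (C1 + 1) / 4"
      proof -
        have "(5 * R) powr p = 5 powr p * R powr p" by (rule powr_mult)
        moreover have "(10::real) powr p = 5 powr p * 2 powr p" using powr_mult[of 5 2 p] by simp
        ultimately show ?thesis using R0 by (simp add: I_def field_simps)
      qed
      finally show ?case by (simp add: H_def)
    qed
    show "\<exists>P. (AE x in lborel. P x) \<and> (\<forall>x y. P x \<longrightarrow> P y \<longrightarrow> 3/2 * R \<le> norm x \<longrightarrow> norm x \<le> 2 * R \<longrightarrow>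
       3/2 * R \<le> norm y \<longrightarrow> norm y \<le> 2 * R \<longrightarrow> v x - L + \<delta> \<le> exp H * (v y - L + \<delta>))"
    proof (intro exI[of _ P] conjI allI impI AEP)
      fix x y assume xy: "P x" "P y" and x: "3/2 * R \<le> norm x" "norm x \<le> 2 * R" and y: "3/2 * R \<le> norm y" "norm y \<le> 2 * R"
      have "(\<lambda>n. \<bar>U n x - U n y\<bar>) \<longlonglongrightarrow> \<bar>ln (w x) - ln (w y)\<bar>"
        using xy x y R0 by (intro tendsto_intros) (auto simp: P_def)
      then have "\<bar>ln (w x) - ln (w y)\<bar> \<le> H"
        by (rule tendsto_upperbound) (use osc[OF x y] in auto)
      then have "ln (w x) \<le> H + ln (w y)" by linarith
      then have "exp (ln (w x)) \<le> exp (H + ln (w y))" by simp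
      then show "v x - L + \<delta> \<le> exp H * (v y - L + \<delta>)"
        using xy by (simp add: P_def exp_add w_def)
    qed
  qed
qed

text \<open>\<open>m\<close> is the essential infimum, obtained as the supremum of all almost
  everywhere lower bounds. Harnack with L = m and \<delta> = e gives v \<le> m + 2 exp(H) e on an
  annulus as soon as one good point there has v < m + e, and e is arbitrary since \<open>H\<close>
  does not depend on it.\<close>

lemma liouville:
  assumes pos: "AE x in lborel. 0 \<le> v x"
  shows "\<exists>c. AE x in lborel. v x = c"
proof -
  obtain H where H: "\<forall>L \<delta> R. (AE x in lborel. L \<le> v x) \<longrightarrow> \<delta> > 0 \<longrightarrow> R \<ge> 1 \<longrightarrow>
    (\<exists>P. (AE x in lborel. P x) \<and> (\<forall>x y. P x \<longrightarrow> P y \<longrightarrow> 3/2 * R \<le> norm x \<longrightarrow> norm x \<le> 2 * R \<longrightarrow>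
       3/2 * R \<le> norm y \<longrightarrow> norm y \<le> 2 * R \<longrightarrow> v x - L + \<delta> \<le> exp H * (v y - L + \<delta>)))"
    using harnack ..
  define S where "S = {c. AE x in lborel. c \<le> v x}"
  define m where "m = Sup S"
  have S0: "0 \<in> S" using pos by (simp add: S_def)
  obtain C where C: "AE x in lborel. norm x \<le> 1 \<longrightarrow> v x \<le> C" using v_bdd by blast
  have "c \<le> C" if "c \<in> S" for c
  proof -
    have "AE x in lborel. norm (x::real^2) \<le> 1 \<longrightarrow> c \<le> C"
      using C that[unfolded S_def mem_Collect_eq] by eventually_elim auto
    then show ?thesis using AE_ex_in_cball[of "\<lambda>x::real^2. norm x \<le> 1 \<longrightarrow> c \<le> C" 1] by auto
  qed
  then have bdd: "bdd_above S" by (rule bdd_aboveI)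
  have mS: "AE x in lborel. m \<le> v x"
  proof -
    have "AE x in lborel. m - inverse (real (Suc n)) \<le> v x" for n
    proof -
      have "m - inverse (real (Suc n)) < m" by simp
      then obtain c where "c \<in> S" "m - inverse (real (Suc n)) < c"
        unfolding m_def using less_cSupD S0 by (metis empty_iff)
      then show ?thesis unfolding S_def by (auto elim!: eventually_mono)
    qed
    then have "AE x in lborel. \<forall>n. m - inverse (real (Suc n)) \<le> v x" by (simp add: AE_all_countable)
    then show ?thesis
    proof eventually_elim
      case (elim x)
      have "(\<lambda>n. m - inverse (real (Suc n))) \<longlonglongrightarrow> m - 0"
        by (intro tendsto_diff tendsto_const LIMSEQ_inverse_real_of_nat)
      then show ?case using elim by (intro LIMSEQ_le_const2[of _ m]) auto
    qed
  qed
  have upper: "AE x in lborel. v x \<le> m + 2 * exp H * e" if e: "e > 0" for e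
  proof -
    have "m + e \<notin> S" using cSup_upper[OF _ bdd, of "m + e"] e by (auto simp: m_def)
    then have nS: "\<not> (AE x in lborel. m + e \<le> v x)" by (simp add: S_def)
    \<comment> \<open>The failure of the lower bound m + e is visible on a ball of finite radius,
      which all discs considered later contain.\<close>
    have "\<exists>n::nat. \<not> (AE x in lborel. norm x \<le> real n \<longrightarrow> m + e \<le> v x)"
    proof (rule ccontr)
      assume "\<not> ?thesis"
      then have "AE x in lborel. \<forall>n::nat. norm x \<le> real n \<longrightarrow> m + e \<le> v x"
        unfolding AE_all_countable by blast
      then have "AE x in lborel. m + e \<le> v x"
        by eventually_elim (meson real_arch_simple)
      then show False using nS by simp
    qed
    then obtain n0 :: nat where n0: "\<not> (AE x in lborel. norm x \<le> real n0 \<longrightarrow> m + e \<le> v x)" by blast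
    have ball: "AE x in lborel. norm x \<le> 2 * R \<longrightarrow> v x \<le> m + 2 * exp H * e" if R: "R \<ge> 1" "R \<ge> real n0" for R
    proof -
      obtain P where P: "AE x in lborel. P x"
        "\<And>x y. P x \<Longrightarrow> P y \<Longrightarrow> 3/2 * R \<le> norm x \<Longrightarrow> norm x \<le> 2 * R \<Longrightarrow>
           3/2 * R \<le> norm y \<Longrightarrow> norm y \<le> 2 * R \<Longrightarrow> v x - m + e \<le> exp H * (v y - m + e)"
        using H[rule_format, OF mS e R(1)] by blast
      \<comment> \<open>Otherwise the comparison principle with \<sigma> = -1 on radius 2R, whose
        outer ring starts at 3/4 * 2R = 3/2 R, would carry v \<ge> m + e into the disc and
        contradict the choice of n0.\<close>
      have "\<exists>y. P y \<and> 3/2 * R \<le> norm y \<and> norm y \<le> 2 * R \<and> v y < m + e"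
      proof (rule ccontr)
        assume neg: "\<not> ?thesis"
        have "AE x in lborel. 3/4 * (2 * R) \<le> norm x \<and> norm x \<le> 2 * R \<longrightarrow> -1 * (v x - (m + e)) \<le> 0"
          using P(1) by eventually_elim (use neg in \<open>auto simp: not_less\<close>)
        from comparison_principle[OF mS _ _ this] R
        have "AE x in lborel. norm x \<le> 2 * R \<longrightarrow> -1 * (v x - (m + e)) \<le> 0" by simp
        then have "AE x in lborel. norm x \<le> real n0 \<longrightarrow> m + e \<le> v x"
          by eventually_elim (use R in auto)
        then show False using n0 by simp
      qed
      then obtain y where y: "P y" "3/2 * R \<le> norm y" "norm y \<le> 2 * R" "v y < m + e" by blast
      have "AE x in lborel. 3/4 * (2 * R) \<le> norm x \<and> norm x \<le> 2 * R \<longrightarrow> 1 * (v x - (m + 2 * exp H * e)) \<le> 0"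
        using P(1)
      proof eventually_elim
        case (elim x)
        have "exp H * (v y - m + e) \<le> exp H * (2 * e)" using y(4) by (intro mult_left_mono) auto
        then have y': "exp H * (v y - m + e) \<le> 2 * exp H * e" by (simp only: mult_ac)
        show ?case
        proof
          assume "3/4 * (2 * R) \<le> norm x \<and> norm x \<le> 2 * R"
          then have "v x - m + e \<le> exp H * (v y - m + e)" by (intro P(2) elim y) auto
          then have "v x - m + e \<le> 2 * exp H * e" using y' by (rule order_trans)
          then have "v x - m \<le> 2 * exp H * e" by (rule order_trans[rotated]) (use e in simp)
          then show "1 * (v x - (m + 2 * exp H * e)) \<le> 0" by simp
        qed
      qed
      from comparison_principle[OF mS _ _ this] R
      have "AE x in lborel. norm x \<le> 2 * R \<longrightarrow> 1 * (v x - (m + 2 * exp H * e)) \<le> 0" by simp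
      then show ?thesis by eventually_elim auto
    qed
    have "AE x in lborel. norm x \<le> 2 * (max 1 (real n0) + real n) \<longrightarrow> v x \<le> m + 2 * exp H * e" for n :: nat
      by (rule ball) auto
    then have "AE x in lborel. \<forall>n::nat. norm x \<le> 2 * (max 1 (real n0) + real n) \<longrightarrow> v x \<le> m + 2 * exp H * e"
      unfolding AE_all_countable by blast
    then show ?thesis
    proof eventually_elim
      case (elim x)
      obtain n :: nat where "norm x \<le> real n" using real_arch_simple by blast
      then have "norm x \<le> 2 * (max 1 (real n0) + real n)" by simp
      then show ?case using elim by blast
    qed
  qed
  have "AE x in lborel. \<forall>n. v x \<le> m + 2 * exp H * inverse (real (Suc n))"
    unfolding AE_all_countable by (intro allI upper) simp
  with mS have "AE x in lborel. v x = m"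
  proof eventually_elim
    case (elim x)
    have "(\<lambda>n. m + 2 * exp H * inverse (real (Suc n))) \<longlonglongrightarrow> m + 2 * exp H * 0"
      by (intro tendsto_intros LIMSEQ_inverse_real_of_nat)
    then have "v x \<le> m" using elim(2) by (intro LIMSEQ_le_const[of _ m]) auto
    with elim(1) show ?case by simp
  qed
  then show ?thesis by blast
qed

end

section \<open>The cigar soliton\<close>

lemma mat_mult_vec: "mat (k::real) *v (x::real^'n::finite) = k *\<^sub>R x"
proof -
  have "(\<Sum>j\<in>UNIV. (if i = j then k else 0) * x $ j) = k * x $ i" for i
    by (simp add: if_distrib[of "\<lambda>c. c * _"] cong: if_cong)
  then show ?thesis by (simp add: vec_eq_iff matrix_vector_mult_def mat_def)
qed

text \<open>\<open>matrix_inv\<close> is a choice: the scalar inverse witnesses that the chosen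
  matrix is a right inverse, and multiplication from the left then identifies it.\<close>

lemma matrix_inv_mat:
  assumes "k \<noteq> (0::real)"
  shows "matrix_inv (mat k :: real^'n^'n::finite) = mat (inverse k)"
proof -
  have *: "mat a ** mat b = (mat 1 :: real^'n^'n)" if "a * b = (1::real)" for a b
    unfolding matrix_eq matrix_vector_mul_assoc[symmetric] mat_mult_vec using that by simp
  have "mat k ** mat (inverse k) = (mat 1 :: real^'n^'n)" "mat (inverse k) ** mat k = (mat 1 :: real^'n^'n)"
    using assms by (auto intro: *)
  then have "mat k ** matrix_inv (mat k) = (mat 1 :: real^'n^'n)"
    unfolding matrix_inv_def by - (rule someI2[of _ "mat (inverse k)"], auto)
  then have "mat (inverse k) ** (mat k ** matrix_inv (mat k)) = (mat (inverse k) :: real^'n^'n)" by simp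
  then show ?thesis
    using \<open>mat (inverse k) ** mat k = mat 1\<close> by (simp add: matrix_mul_assoc)
qed

text \<open>The definitions admit Lebesgue measurable representatives, while the analysis above is
  carried out for Borel functions. The passage is made in each component.\<close>

lemma lebesgue_borel_version:
  fixes f :: "'a::euclidean_space \<Rightarrow> real^'n::finite"
  assumes "f \<in> borel_measurable lebesgue"
  obtains g where "g \<in> borel_measurable borel" "AE x in lebesgue. f x = g x"
proof -
  have "\<exists>g \<in> borel_measurable lborel. AE x in lborel. f x $ i = g x" for i
    using assms by (intro completion_ex_borel_measurable_real) measurable
  then obtain g where g: "\<And>i. g i \<in> borel_measurable borel" "\<And>i. AE x in lborel. f x $ i = g i x"
    by (metis measurable_lborel2)
  have "(\<lambda>x. \<chi> i. g i x) \<in> borel_measurable borel"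
  proof (rule borel_measurable_euclidean_space[THEN iffD2], intro ballI)
    fix b :: "real^'n" assume "b \<in> Basis"
    then obtain i where "b = axis i 1" by (auto simp: Basis_vec_def)
    then show "(\<lambda>x. (\<chi> i. g i x) \<bullet> b) \<in> borel_measurable borel" using g(1) by (simp add: inner_axis)
  qed
  moreover have "AE x in lborel. \<forall>i\<in>UNIV. f x $ i = g i x" using g(2) by (intro AE_finite_allI) auto
  then have "AE x in lebesgue. \<forall>i\<in>UNIV. f x $ i = g i x" by (rule AE_completion)
  then have "AE x in lebesgue. f x = (\<chi> i. g i x)" by eventually_elim (simp add: vec_eq_iff)
  ultimately show ?thesis using that by blast
qed

text \<open>The field is the pointwise limit of its restrictions to growing balls. This recovers
  measurability of a weak differential, which is only assumed integrable on compact sets.\<close>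

lemma borel_measurable_locally_integrable:
  fixes f :: "'a::euclidean_space \<Rightarrow> 'b::euclidean_space"
  assumes "\<And>K. compact K \<Longrightarrow> set_integrable lebesgue K f"
  shows "f \<in> borel_measurable lebesgue"
proof (rule borel_measurable_LIMSEQ_metric)
  show "(\<lambda>x. indicator (cball 0 (real n)) x *\<^sub>R f x) \<in> borel_measurable lebesgue" for n
    using assms[of "cball 0 (real n)"] unfolding set_integrable_def by auto
  fix x :: 'a
  obtain m :: nat where m: "norm x \<le> real m" using real_arch_simple by blast
  have "\<forall>\<^sub>F n in sequentially. indicator (cball 0 (real n)) x *\<^sub>R f x = f x"
    using eventually_ge_at_top[of m] by eventually_elim (use m in \<open>auto simp: indicator_def\<close>)
  then show "(\<lambda>n. indicator (cball 0 (real n)) x *\<^sub>R f x) \<longlonglongrightarrow> f x"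
    by (rule tendsto_eventually)
qed

text \<open>The equality also covers the case in which both integrals take the default
  value.\<close>

lemma integral_lebesgue_cong_lborel:
  fixes f g :: "'a::euclidean_space \<Rightarrow> real"
  assumes "f \<in> borel_measurable lebesgue" "g \<in> borel_measurable borel" "AE x in lebesgue. f x = g x"
  shows "(\<integral>x. f x \<partial>lebesgue) = (\<integral>x. g x \<partial>lborel)"
proof -
  have "g \<in> borel_measurable lebesgue" using assms(2) by (intro measurable_completion) simp
  then have "(\<integral>x. f x \<partial>lebesgue) = (\<integral>x. g x \<partial>lebesgue)"
    using assms by (intro integral_cong_AE)
  also have "\<dots> = (\<integral>x. g x \<partial>lborel)" using assms(2) by (intro integral_completion) simp
  finally show ?thesis .
qed

section \<open>The conformal metric in coordinates\<close>

definition cigar_factor :: "real \<Rightarrow> real^2 \<Rightarrow> real" where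
  "cigar_factor p x = (1 + (norm x)\<^sup>2) powr (p / (2 - p))"

lemma cigar_factor_pos: "cigar_factor p x > 0"
  using add_pos_nonneg[of 1 "(norm x)\<^sup>2"] by (simp add: cigar_factor_def)

lemma cigar_factor_borel [measurable]: "cigar_factor p \<in> borel_measurable borel"
  unfolding cigar_factor_def[abs_def] by measurable

lemma conformal_cigar_eq_mat:
  "p \<noteq> 2 \<Longrightarrow> conformal_metric p cigar_metric cigar_potential = (\<lambda>x. mat (cigar_factor p x))"
  by (rule ext) (simp add: conformal_cigar_metric cigar_factor_def norm_squared_2 add.assoc)

text \<open>The exponent (2 - p)/2 = 1 - p/2 is that of the conformal factor in the planar p-energy:
  1 from the area element, -p/2 from the length of the gradient.\<close>

lemma cigar_factor_powr:
  assumes "p \<noteq> 2"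
  shows "cigar_factor p x powr ((2 - p) / 2) = (1 + (norm x)\<^sup>2) powr (p / 2)"
  using assms by (simp add: cigar_factor_def powr_powr)

lemma g_inner_mat: "g_inner (\<lambda>x. mat (\<phi> x)) x a b = \<phi> x * (a \<bullet> b)"
  by (simp add: g_inner_def mat_mult_vec)

lemma g_grad_mat: "\<phi> x \<noteq> 0 \<Longrightarrow> g_grad (\<lambda>x. mat (\<phi> x)) D x = inverse (\<phi> x) *\<^sub>R D x"
  by (simp add: g_grad_def matrix_inv_mat mat_mult_vec)

text \<open>Raising the index contributes \<phi>^(-1), and measuring the length contributes
  \<phi>^(1/2).\<close>

lemma g_norm_mat:
  assumes "\<phi> x > 0"
  shows "g_norm (\<lambda>x. mat (\<phi> x)) x (g_grad (\<lambda>x. mat (\<phi> x)) D x) = norm (D x) * \<phi> x powr (- 1 / 2)"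
proof -
  have "g_norm (\<lambda>x. mat (\<phi> x)) x (g_grad (\<lambda>x. mat (\<phi> x)) D x) = sqrt (inverse (\<phi> x) * (norm (D x))\<^sup>2)"
    using assms by (simp add: g_norm_def g_inner_mat g_grad_mat power2_norm_eq_inner)
  also have "\<dots> = sqrt (inverse (\<phi> x)) * norm (D x)" by (simp add: real_sqrt_mult)
  also have "sqrt (inverse (\<phi> x)) = \<phi> x powr (- 1 / 2)"
    using assms by (simp add: real_sqrt_inverse powr_minus powr_half_sqrt)
  finally show ?thesis by simp
qed

lemma g_volume_mat_2:
  fixes \<phi> :: "real^2 \<Rightarrow> real"
  assumes "\<And>x. \<phi> x > 0"
  shows "g_volume (\<lambda>x. mat (\<phi> x)) = density lebesgue (\<lambda>x. ennreal (\<phi> x))"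
proof -
  have "sqrt (det (mat (\<phi> x) :: real^2^2)) = \<phi> x" for x
    using assms[of x] by (simp add: det_2 mat_def)
  then show ?thesis by (simp add: g_volume_def)
qed

theorem theorem1p2:
  fixes p :: real
  assumes "p \<ge> 4"
  shows "\<not> (\<exists>v :: real^2 \<Rightarrow> real.
            p_harmonic p (conformal_metric p cigar_metric cigar_potential) v \<and>
            positive_ae (conformal_metric p cigar_metric cigar_potential) v \<and>
            \<not> constant_ae (conformal_metric p cigar_metric cigar_potential) v)"
proof -
  define g :: "2 metric_field" where "g = (\<lambda>x. mat (cigar_factor p x))"
  let ?\<phi> = "cigar_factor p"
  have p2: "p \<noteq> 2" using assms by simp
  have geq: "conformal_metric p cigar_metric cigar_potential = g"
    unfolding g_def by (rule conformal_cigar_eq_mat[OF p2])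
  have \<phi>m [measurable]: "?\<phi> \<in> borel_measurable lebesgue"
    by (intro measurable_completion) simp
  have vol: "g_volume g = density lebesgue (\<lambda>x. ennreal (?\<phi> x))"
    unfolding g_def by (rule g_volume_mat_2[OF cigar_factor_pos])
  \<comment> \<open>The density is positive everywhere, so both measures have the same null
    sets.\<close>
  have AEv: "(AE x in g_volume g. P x) \<longleftrightarrow> (AE x in lebesgue. P x)" for P
    unfolding vol using cigar_factor_pos[of p] by (subst AE_density) auto
  have "constant_ae g v" if ph: "p_harmonic p g v" and pos: "positive_ae g v" for v
  proof -
    obtain D where Linf: "Linf_loc g v" and W: "W1p_loc p g v D"
      and eq: "\<And>\<psi>. test_function \<psi> \<Longrightarrow>
        (\<integral>x. g_norm g x (g_grad g D x) powr (p - 2) *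
           g_inner g x (g_grad g D x) (g_grad g (differential \<psi>) x) \<partial>g_volume g) = 0"
      using ph unfolding p_harmonic_def by blast
    have vm [measurable]: "v \<in> borel_measurable lebesgue" using Linf by (simp add: Linf_loc_def)
    have "set_integrable lebesgue K D" if "compact K" for K
      using W that by (simp add: W1p_loc_def weak_differential_def)
    then have Dm [measurable]: "D \<in> borel_measurable lebesgue" by (rule borel_measurable_locally_integrable)
    \<comment> \<open>Borel representatives replace \<open>v\<close> and \<open>D\<close>; the
      integrals in the weak formulation do not see the null set on which they differ.\<close>
    obtain v' where v': "v' \<in> borel_measurable borel" "AE x in lborel. v x = v' x"
      using completion_ex_borel_measurable_real[OF vm] by auto
    then have vv': "AE x in lebesgue. v x = v' x" by (intro AE_completion)
    obtain D' where D': "D' \<in> borel_measurable borel" "AE x in lebesgue. D x = D' x"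
      using lebesgue_borel_version[OF Dm] by blast
    have leb: "(AE x in lebesgue. P x) \<longleftrightarrow> (AE x in lborel. P x)" for P :: "real^2 \<Rightarrow> bool"
      by (rule AE_completion_iff)
    note [measurable] = v'(1) D'(1)
    interpret weighted_solution p v' D'
    proof
      show "3 < p" using assms by simp
      show "\<exists>C. AE x in lborel. norm x \<le> r \<longrightarrow> v' x \<le> C" for r
      proof -
        obtain C where "AE x in g_volume g. x \<in> cball 0 r \<longrightarrow> \<bar>v x\<bar> \<le> C"
          using Linf compact_cball unfolding Linf_loc_def by blast
        then have "AE x in lebesgue. x \<in> cball 0 r \<longrightarrow> \<bar>v x\<bar> \<le> C" by (simp only: AEv)
        with vv' have "AE x in lebesgue. norm x \<le> r \<longrightarrow> v' x \<le> C" by eventually_elim auto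
        then show ?thesis unfolding leb by blast
      qed
      show "(\<integral>\<^sup>+x\<in>cball 0 r. ennreal (norm (D' x) powr p) \<partial>lborel) < \<infinity>" for r
      proof -
        have "set_integrable (g_volume g) (cball 0 r) (\<lambda>x. g_norm g x (g_grad g D x) powr p)"
          using W by (simp add: W1p_loc_def)
        moreover have [measurable]: "cball (0::real^2) r \<in> sets lebesgue" by simp
        ultimately have "integrable (density lebesgue (\<lambda>x. ennreal (?\<phi> x)))
            (\<lambda>x. indicator (cball 0 r) x *\<^sub>R (norm (D x) * ?\<phi> x powr (- 1 / 2)) powr p)"
          unfolding set_integrable_def vol unfolding g_def by (simp add: g_norm_mat cigar_factor_pos)
        then have int: "integrable lebesgue (\<lambda>x. ?\<phi> x *\<^sub>R (indicator (cball 0 r) x *\<^sub>R (norm (D x) * ?\<phi> x powr (- 1 / 2)) powr p))"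
          by (subst (asm) integrable_density) (auto simp: cigar_factor_pos less_imp_le)
        have "(\<integral>\<^sup>+x\<in>cball 0 r. ennreal (norm (D' x) powr p) \<partial>lborel) = (\<integral>\<^sup>+x\<in>cball 0 r. ennreal (norm (D' x) powr p) \<partial>lebesgue)"
          by (simp add: nn_integral_completion)
        also have "\<dots> \<le> (\<integral>\<^sup>+x. ennreal (norm (?\<phi> x *\<^sub>R (indicator (cball 0 r) x *\<^sub>R (norm (D x) * ?\<phi> x powr (- 1 / 2)) powr p))) \<partial>lebesgue)"
        proof (rule nn_integral_mono_AE)
          show "AE x in lebesgue. ennreal (norm (D' x) powr p) * indicator (cball 0 r) x \<le>
            ennreal (norm (?\<phi> x *\<^sub>R (indicator (cball 0 r) x *\<^sub>R (norm (D x) * ?\<phi> x powr (- 1 / 2)) powr p)))"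
            using D'(2)
          proof eventually_elim
            case (elim x)
            have "?\<phi> x * (norm (D x) * ?\<phi> x powr (- 1 / 2)) powr p = ?\<phi> x powr 1 * ?\<phi> x powr (- p / 2) * norm (D x) powr p"
              using cigar_factor_pos[of p x] by (simp add: powr_mult powr_powr)
            also have "?\<phi> x powr 1 * ?\<phi> x powr (- p / 2) = ?\<phi> x powr ((2 - p) / 2)"
              unfolding powr_add[symmetric] by (simp add: field_simps)
            also have "\<dots> = (1 + (norm x)\<^sup>2) powr (p / 2)" by (rule cigar_factor_powr[OF p2])
            finally have "?\<phi> x * (norm (D x) * ?\<phi> x powr (- 1 / 2)) powr p = (1 + (norm x)\<^sup>2) powr (p / 2) * norm (D x) powr p" .
            \<comment> \<open>The weight is at least 1, so local finiteness of the energy for the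
              metric implies that of the Euclidean one.\<close>
            moreover have "1 \<le> (1 + (norm x)\<^sup>2) powr (p / 2)" using assms by (intro ge_one_powr_ge_zero) auto
            ultimately have "norm (D' x) powr p \<le> ?\<phi> x * (norm (D x) * ?\<phi> x powr (- 1 / 2)) powr p"
              using elim mult_right_mono[of 1 "(1 + (norm x)\<^sup>2) powr (p / 2)" "norm (D x) powr p"] by simp
            then show ?case using cigar_factor_pos[of p x] by (auto simp: indicator_def intro!: ennreal_leI)
          qed
        qed
        also have "\<dots> < \<infinity>" using int by (simp add: integrable_iff_bounded)
        finally show ?thesis .
      qed
      show "(\<integral>x. v' x * partial_deriv i \<psi> x \<partial>lborel) = - (\<integral>x. D' x $ i * \<psi> x \<partial>lborel)"
        if t: "test_function \<psi>" for \<psi> i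
      proof -
        have [measurable]: "\<psi> \<in> borel_measurable borel" "partial_deriv i \<psi> \<in> borel_measurable borel"
          using t by (auto intro: smooth_borel smooth_partial test_function_smooth)
        have [measurable]: "\<psi> \<in> borel_measurable lebesgue" "partial_deriv i \<psi> \<in> borel_measurable lebesgue"
          by (auto intro!: measurable_completion)
        have "(\<integral>x. v x * partial_deriv i \<psi> x \<partial>lebesgue) = (\<integral>x. v' x * partial_deriv i \<psi> x \<partial>lborel)"
          using vv' by (intro integral_lebesgue_cong_lborel) (measurable, auto elim!: eventually_mono)
        moreover have "(\<integral>x. D x $ i * \<psi> x \<partial>lebesgue) = (\<integral>x. D' x $ i * \<psi> x \<partial>lborel)"
          using D'(2) by (intro integral_lebesgue_cong_lborel) (measurable, auto elim!: eventually_mono)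
        ultimately show ?thesis
          using W t by (simp add: W1p_loc_def weak_differential_def)
      qed
      show "(\<integral>x. (1 + (norm x)\<^sup>2) powr (p / 2) * norm (D' x) powr (p - 2) * (D' x \<bullet> differential \<psi> x) \<partial>lborel) = 0"
        if t: "test_function \<psi>" for \<psi>
      proof -
        have dm [measurable]: "differential \<psi> \<in> borel_measurable borel"
          using t by (intro smooth_differential_borel test_function_smooth)
        have [measurable]: "differential \<psi> \<in> borel_measurable lebesgue"
          using dm by (intro measurable_completion) simp
        define F where "F x = (norm (D x) * ?\<phi> x powr (- 1 / 2)) powr (p - 2) * (inverse (?\<phi> x) * (D x \<bullet> differential \<psi> x))" for x
        have [measurable]: "F \<in> borel_measurable lebesgue" unfolding F_def[abs_def] by measurable
        have "g_norm g x (g_grad g D x) powr (p - 2) * g_inner g x (g_grad g D x) (g_grad g (differential \<psi>) x) = F x" for x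
          unfolding g_def F_def using cigar_factor_pos[of p x]
          by (subst g_norm_mat) (auto simp: g_inner_mat g_grad_mat)
        then have "0 = (\<integral>x. F x \<partial>density lebesgue (\<lambda>x. ennreal (?\<phi> x)))"
          using eq[OF t] by (simp add: vol)
        also have "\<dots> = (\<integral>x. ?\<phi> x *\<^sub>R F x \<partial>lebesgue)"
          by (rule integral_density) (auto simp: cigar_factor_pos less_imp_le)
        also have "\<dots> = (\<integral>x. (1 + (norm x)\<^sup>2) powr (p / 2) * norm (D' x) powr (p - 2) * (D' x \<bullet> differential \<psi> x) \<partial>lborel)"
        proof (rule integral_lebesgue_cong_lborel)
          show "AE x in lebesgue. ?\<phi> x *\<^sub>R F x = (1 + (norm x)\<^sup>2) powr (p / 2) * norm (D' x) powr (p - 2) * (D' x \<bullet> differential \<psi> x)"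
            using D'(2)
          proof eventually_elim
            case (elim x)
            \<comment> \<open>The volume density \<phi> cancels the 1/\<phi> from the inner product
              of the two gradients. What remains is \<phi>^((2-p)/2), the weight.\<close>
            have "- 1 / 2 * (p - 2) = (2 - p) / 2" by (simp add: field_simps)
            then have "(?\<phi> x powr (- 1 / 2)) powr (p - 2) = (1 + (norm x)\<^sup>2) powr (p / 2)"
              using cigar_factor_powr[OF p2] by (simp only: powr_powr)
            then show ?case using elim cigar_factor_pos[of p x] by (simp add: F_def powr_mult)
          qed
        qed measurable
        finally show ?thesis by simp
      qed
    qed measurable
    have "AE x in lebesgue. 0 < v x" using pos by (simp add: positive_ae_def AEv)
    with vv' have "AE x in lebesgue. 0 \<le> v' x" by eventually_elim auto
    then obtain c where "AE x in lebesgue. v' x = c" using liouville unfolding leb by blast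
    with vv' have "AE x in lebesgue. v x = c" by eventually_elim simp
    then show ?thesis unfolding constant_ae_def AEv by blast
  qed
  then show ?thesis unfolding geq by blast
qed

end
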